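(* Let $\sigma>0$, $\tau\in(0,2)$, and let $(q^{(0)},\alpha^{(0)},\beta^{(0)})\in\prod_{d=0}^D\mathbb R^{\mathcal G^s_d}\times\prod_{d=0}^D\mathbb R^{\mathcal G^s_d}\times\mathbb Q$ be an arbitrary initial point. Let the sequence $\{(\varphi^{(k)},z^{(k)},q^{(k)},\alpha^{(k)},\beta^{(k)})\}$ be generated, for $k=0,1,2,\dots$, by $$\begin{aligned}(\varphi^{(k+1)},z^{(k+1)})&=\operatorname*{arg\,min}_{\varphi,z}\{\mathfrak L_\sigma(\varphi,z,q^{(k)};\alpha^{(k)},\beta^{(k)})\mid\varphi\in\mathrm{rge}(\mathcal A^* )\},\\ q^{(k+1)}&=\operatorname*{arg\,min}_{q}\ \mathfrak L_\sigma(\varphi^{(k+1)},z^{(k+1)},q;\alpha^{(k)},\beta^{(k)}),\\ \alpha^{(k+1)}&=\alpha^{(k)}+\tau\sigma(\mathcal A\varphi^{(k+1)}-q^{(k+1)}),\\ \beta^{(k+1)}&=\beta^{(k)}+\tau\sigma(z^{(k+1)}-\mathcal B\mathcal Fq^{(k+1)}-\mathbf d),\end{aligned}$$ where $$\mathfrak L_\sigma(\varphi,z,q;\alpha,\beta):=\langle c,\varphi\rangle+\delta_{\mathbb Q}(z)+\langle\mathcal A\varphi-q,\alpha\rangle+\langle z-\mathcal B\mathcal Fq-\mathbf d,\beta\rangle+\tfrac\sigma2\|\mathcal A\varphi-q\|^2+\tfrac\sigma2\|z-\mathcal B\mathcal Fq-\mathbf d\|^2.$$ Then the sequence $\{(\varphi^{(k)},z^{(k)},q^{(k)},\alpha^{(k)},\beta^{(k)})\}$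 converges to a solution $(\varphi,z,q,\alpha,\beta)$ of the KKT system $$\begin{cases}\mathcal A\varphi=q,\quad z=\mathcal B\mathcal Fq+\mathbf d,\quad\varphi\in\mathrm{rge}(\mathcal A^* ),\\ \mathcal A^*\alpha=-c,\quad\alpha+\mathcal F^*\mathcal B^*\beta=0,\\ \mathbb Q\ni z\perp\beta\in\mathbb Q,\end{cases}$$ and hence to a solution of the same system with the condition $\varphi\in\mathrm{rge}(\mathcal A^* )$ omitted.
   Context: Grid. Let $D\ge1$ and let $n_0,\dots,n_D$ be positive integers, $h_d:=1/n_d$, $X=[0,1]^D$. Put $J^c_d:=\{0,1,\dots,n_d\}$ and $J^s_d:=\{j-\tfrac12\mid j=1,\dots,n_d\}$. Define $\mathcal G^c_X:=J^c_1\times\dots\times J^c_D$, $\mathcal G^c:=J^c_0\times\mathcal G^c_X$, and, for $d=0,\dots,D$, $\mathcal G^s_d:=J^c_0\times\dots\times J^c_{d-1}\times J^s_d\times J^c_{d+1}\times\dots\times J^c_D$. Indices are written $i=(i_0,\dots,i_D)$; $\mathbb R^{\mathcal G}$ is the Euclidean space of real vectors indexed by $\mathcal G$. Let $e_0,\dots,e_D$ be the standard basis vectors of $\mathbb R^{D+1}$ (the $(d+1)$-th component of $e_d$ is $1$). Variables: $\varphi\in\mathbb R^{\mathcal G^c}$; $q,\alpha\in\prod_{d=0}^D\mathbb R^{\mathcal G^s_d}$; $z,\beta\in(\mathbb R^{\mathcal G^s_0})^{4D+2}$. Operators. $\mathcal A\varphi:=(\mathcal A_0\varphi;\dots;\mathcal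 A_D\varphi)$ with $\mathcal A_d:\mathbb R^{\mathcal G^c}\to\mathbb R^{\mathcal G^s_d}$, $(\mathcal A_d\varphi)_i:=\frac1{h_d}(\varphi_{i+e_d/2}-\varphi_{i-e_d/2})$. A superscript $*$ denotes the adjoint with respect to the Euclidean inner products, and $\mathrm{rge}$ denotes the range. For $q=(q_0;\dots;q_D)$ with $q_d\in\mathbb R^{\mathcal G^s_d}$, $\mathcal Fq:=(\mathcal F_0q_0;\mathcal F^1_1q_1;\dots;\mathcal F^1_4q_1;\dots;\mathcal F^D_1q_D;\dots;\mathcal F^D_4q_D)\in(\mathbb R^{\mathcal G^s_0})^{4D+1}$, where $\mathcal F_0q_0=q_0$ and for $d=1,\dots,D$, $i\in\mathcal G^s_0$: $(\mathcal F^d_1q_d)_i=(q_d)_{i-(e_0+e_d)/2}$ if $i_d\ge1$ and $0$ if $i_d=0$; $(\mathcal F^d_2q_d)_i=(q_d)_{i-(e_0-e_d)/2}$ if $i_d\le n_d-1$ and $0$ if $i_d=n_d$; $(\mathcal F^d_3q_d)_i=(q_d)_{i+(e_0-e_d)/2}$ if $i_d\ge1$ and $0$ if $i_d=0$; $(\mathcal F^d_4q_d)_i=(q_d)_{i+(e_0+e_d)/2}$ if $i_d\le n_d-1$ and $0$ if $i_d=n_d$. For $\tilde q=(\tilde q_0;\dots;\tilde q_{4D})\in(\mathbb R^{\mathcal G^s_0})^{4D+1}$, $\mathcal B\tilde q:=(-\tilde q_0;\tfrac{\sqrt2}2\tilde q_1;\dots;\tfrac{\sqrt2}2\tilde q_{4D};\tilde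 q_0)\in(\mathbb R^{\mathcal G^s_0})^{4D+2}$. The vector $\mathbf d\in(\mathbb R^{\mathcal G^s_0})^{4D+2}$ has first and last blocks equal to the all-ones vector and all other blocks zero. Cones. $\mathbb K_{\rm soc}:=\{(y_0;\bar y)\in\mathbb R\times\mathbb R^{4D+1}\mid y_0\ge\|\bar y\|\}$, and $\mathbb Q:=\{(\beta_1;\dots;\beta_{4D+2})\in(\mathbb R^{\mathcal G^s_0})^{4D+2}\mid((\beta_1)_i;\dots;(\beta_{4D+2})_i)\in\mathbb K_{\rm soc}\ \forall i\in\mathcal G^s_0\}$; $\delta_{\mathbb Q}$ is the indicator function ($0$ on $\mathbb Q$, $+\infty$ elsewhere); $a\perp b$ means $\langle a,b\rangle=0$. Data. $\rho_0,\rho_1$ are Borel probability measures on $X$. For $\bar i=(i_1,\dots,i_D)\in\mathcal G^c_X$ let $X_{\bar i}:=\{y\in X\mid|i_dh_d-y_d|\le h_d/2,\ d=1,\dots,D\}$. The measures of these cells are assumed to satisfy $\sum_{\bar i\in\mathcal G^c_X}\rho_0(X_{\bar i})=\sum_{\bar i\in\mathcal G^c_X}\rho_1(X_{\bar i})=1$ (no mass on overlaps of cells is counted twice). The vector $c\in\mathbb R^{\mathcal G^c}$ is given by $c_{(i_0,\bar i)}:=\rho_0(X_{\bar i})$ if $i_0=0$, $c_{(i_0,\bar i)}:=-\rho_1(X_{\bar i})$ if $i_0=n_0$, and $c_{(i_0,\bar i)}:=0$ otherwise. *)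

theory Defs
  imports "HOL-Analysis.Analysis" "HOL-Library.Function_Algebras" "HOL-Probability.Probability"
begin

text \<open>
  The space of real vectors indexed by a finite set \<open>S\<close> is the set of functions vanishing
  outside \<open>S\<close>. Products of such spaces are vectors indexed by the disjoint union, that is, by
  pairs (block number, grid index).
\<close>

definition rvec :: "'i set \<Rightarrow> ('i \<Rightarrow> real) set" where
  "rvec S = {x. \<forall>i. i \<notin> S \<longrightarrow> x i = 0}"

definition inner_on :: "'i set \<Rightarrow> ('i \<Rightarrow> real) \<Rightarrow> ('i \<Rightarrow> real) \<Rightarrow> real" where
  "inner_on S x y = (\<Sum>i\<in>S. x i * y i)"

definition converges_on :: "'i set \<Rightarrow> (nat \<Rightarrow> 'i \<Rightarrow> real) \<Rightarrow> ('i \<Rightarrow> real) \<Rightarrow> bool" where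
  "converges_on S x l \<longleftrightarrow> (\<lambda>k. L2_set (x k - l) S) \<longlonglongrightarrow> 0"

definition adj_on ::
  "'i set \<Rightarrow> 'j set \<Rightarrow> (('i \<Rightarrow> real) \<Rightarrow> ('j \<Rightarrow> real)) \<Rightarrow> ('j \<Rightarrow> real) \<Rightarrow> ('i \<Rightarrow> real)" where
  "adj_on S T f y =
     (THE x. x \<in> rvec S \<and> (\<forall>u\<in>rvec S. inner_on T (f u) y = inner_on S u x))"


text \<open>
  A grid index is a tuple of (half-)integers, given as an extensional function on \<open>{0..D}\<close>;
  component \<open>0\<close> is time.
\<close>

type_synonym idx = "nat \<Rightarrow> real"

definition Jc :: "nat \<Rightarrow> real set" where
  "Jc m = {real j | j. j \<in> {0..m}}"

definition Js :: "nat \<Rightarrow> real set" where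
  "Js m = {real j - 1/2 | j. j \<in> {1..m}}"

definition step :: "(nat \<Rightarrow> nat) \<Rightarrow> nat \<Rightarrow> real" where
  "step n d = 1 / real (n d)"

definition GcX :: "nat \<Rightarrow> (nat \<Rightarrow> nat) \<Rightarrow> idx set" where
  "GcX D n = (\<Pi>\<^sub>E d\<in>{1..D}. Jc (n d))"

definition Gc :: "nat \<Rightarrow> (nat \<Rightarrow> nat) \<Rightarrow> idx set" where
  "Gc D n = (\<Pi>\<^sub>E d\<in>{0..D}. Jc (n d))"

definition Gs :: "nat \<Rightarrow> (nat \<Rightarrow> nat) \<Rightarrow> nat \<Rightarrow> idx set" where
  "Gs D n d = (\<Pi>\<^sub>E d'\<in>{0..D}. if d' = d then Js (n d') else Jc (n d'))"

text \<open>Index sets of \<open>q\<close> and \<open>\<alpha>\<close> (blocks \<open>0..D\<close>), of \<open>\<F> q\<close> (blocks \<open>0..4D\<close>)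
  and of \<open>z\<close> and \<open>\<beta>\<close> (blocks \<open>1..4D+2\<close>).\<close>

definition Iq :: "nat \<Rightarrow> (nat \<Rightarrow> nat) \<Rightarrow> (nat \<times> idx) set" where
  "Iq D n = (SIGMA d:{0..D}. Gs D n d)"

definition IF :: "nat \<Rightarrow> (nat \<Rightarrow> nat) \<Rightarrow> (nat \<times> idx) set" where
  "IF D n = {0..4 * D} \<times> Gs D n 0"

definition Iz :: "nat \<Rightarrow> (nat \<Rightarrow> nat) \<Rightarrow> (nat \<times> idx) set" where
  "Iz D n = {1..4 * D + 2} \<times> Gs D n 0"


definition opA :: "nat \<Rightarrow> (nat \<Rightarrow> nat) \<Rightarrow> (idx \<Rightarrow> real) \<Rightarrow> (nat \<times> idx \<Rightarrow> real)" where
  "opA D n \<phi> = (\<lambda>(d, i).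
     if (d, i) \<in> Iq D n
     then 1 / step n d * (\<phi> (i(d := i d + 1/2)) - \<phi> (i(d := i d - 1/2)))
     else 0)"

text \<open>\<open>Fblock n d r\<close> is \<open>\<F>\<^sup>d\<^sub>r\<close>, for \<open>d \<ge> 1\<close> and \<open>r = 1, \<dots>, 4\<close>.\<close>

definition Fblock ::
  "(nat \<Rightarrow> nat) \<Rightarrow> nat \<Rightarrow> nat \<Rightarrow> (nat \<times> idx \<Rightarrow> real) \<Rightarrow> (idx \<Rightarrow> real)" where
  "Fblock n d r q i =
    (if r = 1 then
       (if i d \<ge> 1 then q (d, i(0 := i 0 - 1/2, d := i d - 1/2)) else 0)
     else if r = 2 then
       (if i d \<le> real (n d) - 1 then q (d, i(0 := i 0 - 1/2, d := i d + 1/2)) else 0)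
     else if r = 3 then
       (if i d \<ge> 1 then q (d, i(0 := i 0 + 1/2, d := i d - 1/2)) else 0)
     else
       (if i d \<le> real (n d) - 1 then q (d, i(0 := i 0 + 1/2, d := i d + 1/2)) else 0))"

text \<open>Block \<open>4(d - 1) + r\<close> of \<open>\<F> q\<close> is \<open>\<F>\<^sup>d\<^sub>r q\<^sub>d\<close>.\<close>

definition opF :: "nat \<Rightarrow> (nat \<Rightarrow> nat) \<Rightarrow> (nat \<times> idx \<Rightarrow> real) \<Rightarrow> (nat \<times> idx \<Rightarrow> real)" where
  "opF D n q = (\<lambda>(m, i).
     if (m, i) \<in> IF D n
     then (if m = 0 then q (0, i)
           else Fblock n ((m - 1) div 4 + 1) ((m - 1) mod 4 + 1) q i)
     else 0)"

definition opB :: "nat \<Rightarrow> (nat \<Rightarrow> nat) \<Rightarrow> (nat \<times> idx \<Rightarrow> real) \<Rightarrow> (nat \<times> idx \<Rightarrow> real)" where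
  "opB D n w = (\<lambda>(m, i).
     if (m, i) \<in> Iz D n
     then (if m = 1 then - w (0, i)
           else if m = 4 * D + 2 then w (0, i)
           else sqrt 2 / 2 * w (m - 1, i))
     else 0)"

definition dvec :: "nat \<Rightarrow> (nat \<Rightarrow> nat) \<Rightarrow> (nat \<times> idx \<Rightarrow> real)" where
  "dvec D n = (\<lambda>(m, i).
     if (m, i) \<in> Iz D n \<and> (m = 1 \<or> m = 4 * D + 2) then 1 else 0)"

definition adjA :: "nat \<Rightarrow> (nat \<Rightarrow> nat) \<Rightarrow> (nat \<times> idx \<Rightarrow> real) \<Rightarrow> (idx \<Rightarrow> real)" where
  "adjA D n = adj_on (Gc D n) (Iq D n) (opA D n)"

definition adjF :: "nat \<Rightarrow> (nat \<Rightarrow> nat) \<Rightarrow> (nat \<times> idx \<Rightarrow> real) \<Rightarrow> (nat \<times> idx \<Rightarrow> real)" where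
  "adjF D n = adj_on (Iq D n) (IF D n) (opF D n)"

definition adjB :: "nat \<Rightarrow> (nat \<Rightarrow> nat) \<Rightarrow> (nat \<times> idx \<Rightarrow> real) \<Rightarrow> (nat \<times> idx \<Rightarrow> real)" where
  "adjB D n = adj_on (IF D n) (Iz D n) (opB D n)"

definition rge_adjA :: "nat \<Rightarrow> (nat \<Rightarrow> nat) \<Rightarrow> (idx \<Rightarrow> real) set" where
  "rge_adjA D n = adjA D n ` rvec (Iq D n)"


text \<open>The second-order cone in \<open>\<real> \<times> \<real>\<^sup>N\<close>; the components of \<open>y\<close> are \<open>y 0, \<dots>, y N\<close>.\<close>

definition Ksoc :: "nat \<Rightarrow> (nat \<Rightarrow> real) set" where
  "Ksoc N = {y. y 0 \<ge> L2_set y {1..N}}"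

definition coneQ :: "nat \<Rightarrow> (nat \<Rightarrow> nat) \<Rightarrow> (nat \<times> idx \<Rightarrow> real) set" where
  "coneQ D n = {\<beta> \<in> rvec (Iz D n). \<forall>i\<in>Gs D n 0. (\<lambda>m. \<beta> (m + 1, i)) \<in> Ksoc (4 * D + 1)}"

definition convex_indicator :: "'a set \<Rightarrow> 'a \<Rightarrow> ereal" where
  "convex_indicator C x = (if x \<in> C then 0 else \<infinity>)"


text \<open>Points of the cube are extensional functions on \<open>{1..D}\<close>; the subspace topology inherited
  from the product topology on \<^typ>\<open>nat \<Rightarrow> real\<close> is the usual one.\<close>

definition cube :: "nat \<Rightarrow> (nat \<Rightarrow> real) set" where
  "cube D = (\<Pi>\<^sub>E d\<in>{1..D}. {0..1})"

definition borel_prob_on :: "(nat \<Rightarrow> real) set \<Rightarrow> (nat \<Rightarrow> real) measure \<Rightarrow> bool" where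
  "borel_prob_on X \<rho> \<longleftrightarrow> prob_space \<rho> \<and> sets \<rho> = sets (restrict_space borel X)"

definition cell :: "nat \<Rightarrow> (nat \<Rightarrow> nat) \<Rightarrow> idx \<Rightarrow> (nat \<Rightarrow> real) set" where
  "cell D n i = {y \<in> cube D. \<forall>d\<in>{1..D}. \<bar>i d * step n d - y d\<bar> \<le> step n d / 2}"

definition cvec :: "nat \<Rightarrow> (nat \<Rightarrow> nat) \<Rightarrow> (nat \<Rightarrow> real) measure \<Rightarrow> (nat \<Rightarrow> real) measure
    \<Rightarrow> (idx \<Rightarrow> real)" where
  "cvec D n \<rho>0 \<rho>1 i =
    (if i \<in> Gc D n then
       (if i 0 = 0 then measure \<rho>0 (cell D n (restrict i {1..D}))
        else if i 0 = real (n 0) then - measure \<rho>1 (cell D n (restrict i {1..D}))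
        else 0)
     else 0)"


definition aug_lagrangian ::
  "nat \<Rightarrow> (nat \<Rightarrow> nat) \<Rightarrow> (idx \<Rightarrow> real) \<Rightarrow> real
    \<Rightarrow> (idx \<Rightarrow> real) \<Rightarrow> (nat \<times> idx \<Rightarrow> real) \<Rightarrow> (nat \<times> idx \<Rightarrow> real)
    \<Rightarrow> (nat \<times> idx \<Rightarrow> real) \<Rightarrow> (nat \<times> idx \<Rightarrow> real) \<Rightarrow> ereal" where
  "aug_lagrangian D n c \<sigma> \<phi> z q \<alpha> \<beta> =
     ereal (inner_on (Gc D n) c \<phi>) + convex_indicator (coneQ D n) z
     + ereal (inner_on (Iq D n) (opA D n \<phi> - q) \<alpha>
              + inner_on (Iz D n) (z - opB D n (opF D n q) - dvec D n) \<beta>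
              + \<sigma> / 2 * (L2_set (opA D n \<phi> - q) (Iq D n))\<^sup>2
              + \<sigma> / 2 * (L2_set (z - opB D n (opF D n q) - dvec D n) (Iz D n))\<^sup>2)"

text \<open>The KKT system without the condition that \<open>\<phi>\<close> lies in the range of \<open>\<A>\<^sup>*\<close>.\<close>

definition KKT_free ::
  "nat \<Rightarrow> (nat \<Rightarrow> nat) \<Rightarrow> (idx \<Rightarrow> real)
    \<Rightarrow> (idx \<Rightarrow> real) \<Rightarrow> (nat \<times> idx \<Rightarrow> real) \<Rightarrow> (nat \<times> idx \<Rightarrow> real)
    \<Rightarrow> (nat \<times> idx \<Rightarrow> real) \<Rightarrow> (nat \<times> idx \<Rightarrow> real) \<Rightarrow> bool" where
  "KKT_free D n c \<phi> z q \<alpha> \<beta> \<longleftrightarrow>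
     \<phi> \<in> rvec (Gc D n) \<and> z \<in> rvec (Iz D n) \<and> q \<in> rvec (Iq D n) \<and>
     \<alpha> \<in> rvec (Iq D n) \<and> \<beta> \<in> rvec (Iz D n) \<and>
     opA D n \<phi> = q \<and> z = opB D n (opF D n q) + dvec D n \<and>
     adjA D n \<alpha> = - c \<and> \<alpha> + adjF D n (adjB D n \<beta>) = 0 \<and>
     z \<in> coneQ D n \<and> \<beta> \<in> coneQ D n \<and> inner_on (Iz D n) z \<beta> = 0"

definition KKT ::
  "nat \<Rightarrow> (nat \<Rightarrow> nat) \<Rightarrow> (idx \<Rightarrow> real)
    \<Rightarrow> (idx \<Rightarrow> real) \<Rightarrow> (nat \<times> idx \<Rightarrow> real) \<Rightarrow> (nat \<times> idx \<Rightarrow> real)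
    \<Rightarrow> (nat \<times> idx \<Rightarrow> real) \<Rightarrow> (nat \<times> idx \<Rightarrow> real) \<Rightarrow> bool" where
  "KKT D n c \<phi> z q \<alpha> \<beta> \<longleftrightarrow> KKT_free D n c \<phi> z q \<alpha> \<beta> \<and> \<phi> \<in> rge_adjA D n"

end

theory Submission imports Defs begin

text \<open>
  Write \<open>N = \<B>\<F>\<close>. The iteration is an alternating direction method for
  \<open>min \<langle>c,\<phi>\<rangle> + \<delta>\<^bsub>Q\<^esub>(z)\<close> under \<open>\<A>\<phi> = q\<close>, \<open>z = N q + d\<close>, with the two blocks
  \<open>(\<phi>, z)\<close> and \<open>q\<close>. The objective does not contain \<open>q\<close>. Therefore the optimality condition of
  the \<open>q\<close>-step is a linear equation, and it makes the dual defect \<open>\<alpha>\<^sup>k + N\<^sup>*\<beta>\<^sup>k\<close> contract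
  by the exact factor \<open>1 - \<tau>\<close> in each step (lemma \<open>defect_Suc\<close>). This is why every
  \<open>\<tau> \<in> (0, 2)\<close> is admissible, whereas for a general second block the classical bound is the
  golden ratio: the only term of the energy balance without a sign is the pairing of the defect with
  the increment of \<open>q\<close>, and it costs a summable amount.

  The energy \<open>lyap\<close> measures the distance of \<open>(q\<^sup>k, \<alpha>\<^sup>k, \<beta>\<^sup>k)\<close> to a reference point. Its balance
  (lemma \<open>lyap_identity\<close>) holds for every reference point that is primal and dual feasible; it
  need not be a saddle point, its duality gap \<open>\<langle>z', \<beta>'\<rangle>\<close> then enters as a source term. This
  freedom is used twice.

  First, it yields a saddle point without any separation theorem (lemma \<open>saddle_point_exists\<close>).
  For a strictly feasible reference the balance keeps the averages of the iterates bounded and lets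
  the energy grow at most linearly, so that the averaged residuals vanish. A cluster point of the
  averages is then feasible, and the summed balance with this very point as the reference says
  that its duality gap is at most zero.

  Second, with a saddle point as the reference the energy decreases up to summable errors. The
  residuals therefore vanish, cluster points of the iterates are saddle points, and the
  energy relative to such a cluster point converges and has a subsequence tending to zero. Hence it tends to
  zero (theorem \<open>converges_to_saddle_point\<close>). For \<open>\<phi>\<close> one uses that it can be recovered
  continuously from \<open>\<A>\<phi>\<close> on the range of \<open>\<A>\<^sup>*\<close>.

  What remains is the geometry of the grid and of the cone. The grid graph is connected, so the
  range of \<open>\<A>\<^sup>*\<close> consists of all vectors with zero sum. Applied inside single time
  slices, the same argument moves the boundary masses to the uniform distribution at the initial
  time and back at the final time; so there is a flux with constant positive density that solves
  the continuity equation (lemma \<open>positive_density_flux\<close>). Such a flux lifts to a multiplier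
  strictly inside the self-dual cone \<open>Q\<close>. On the primal side the potential \<open>\<phi> = -t\<close> is strictly
  feasible.
\<close>

section \<open>Vectors on a finite index set\<close>

definition scl :: "real \<Rightarrow> ('i \<Rightarrow> real) \<Rightarrow> ('i \<Rightarrow> real)" (infixr "\<odot>" 75) where
  "c \<odot> x = (\<lambda>i. c * x i)"

definition unit_vec :: "'i \<Rightarrow> 'i \<Rightarrow> real" where
  "unit_vec i = (\<lambda>j. if j = i then 1 else 0)"

definition lin :: "(('i \<Rightarrow> real) \<Rightarrow> ('j \<Rightarrow> real)) \<Rightarrow> bool" where
  "lin f \<longleftrightarrow> (\<forall>x y. f (x + y) = f x + f y) \<and> (\<forall>c x. f (c \<odot> x) = c \<odot> f x)"

lemma scl_apply [simp]: "(c \<odot> x) i = c * x i"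
  by (simp add: scl_def)

lemma unit_vec_in_rvec [simp]: "unit_vec i \<in> rvec S \<longleftrightarrow> i \<in> S"
  by (auto simp: unit_vec_def rvec_def)

lemma rvec_closed [intro]:
  "x \<in> rvec S \<Longrightarrow> y \<in> rvec S \<Longrightarrow> x + y \<in> rvec S"
  "x \<in> rvec S \<Longrightarrow> y \<in> rvec S \<Longrightarrow> x - y \<in> rvec S"
  "x \<in> rvec S \<Longrightarrow> c \<odot> x \<in> rvec S"
  "x \<in> rvec S \<Longrightarrow> - x \<in> rvec S"
  "0 \<in> rvec S"
  by (simp_all add: rvec_def)

lemma sum_fun_apply: "(\<Sum>k\<in>K. x k) i = (\<Sum>k\<in>K. x k i)"
  for x :: "'k \<Rightarrow> 'i \<Rightarrow> real"
  by (induction K rule: infinite_finite_induct) auto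

lemma rvec_sum: "(\<And>k. k \<in> K \<Longrightarrow> x k \<in> rvec S) \<Longrightarrow> (\<Sum>k\<in>K. x k) \<in> rvec S"
  by (auto simp: rvec_def sum_fun_apply)

lemma scl_0 [simp]: "0 \<odot> x = 0" "c \<odot> 0 = 0"
  by (auto simp: fun_eq_iff)

lemma uminus_eq_scl: "- x = (- 1) \<odot> x" for x :: "'i \<Rightarrow> real"
  by (auto simp: fun_eq_iff)

lemma rvec_eqI: "x \<in> rvec S \<Longrightarrow> y \<in> rvec S \<Longrightarrow> (\<And>i. i \<in> S \<Longrightarrow> x i = y i) \<Longrightarrow> x = y"
  by (auto simp: rvec_def fun_eq_iff) metis

lemma inner_simps_on [simp]:
  "inner_on S (x + y) z = inner_on S x z + inner_on S y z"
  "inner_on S (x - y) z = inner_on S x z - inner_on S y z"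
  "inner_on S (- x) z = - inner_on S x z"
  "inner_on S (c \<odot> x) z = c * inner_on S x z"
  "inner_on S 0 z = 0"
  "inner_on S z (x + y) = inner_on S z x + inner_on S z y"
  "inner_on S z (x - y) = inner_on S z x - inner_on S z y"
  "inner_on S z (- x) = - inner_on S z x"
  "inner_on S z (c \<odot> x) = c * inner_on S z x"
  "inner_on S z 0 = 0"
  by (simp_all add: inner_on_def algebra_simps sum.distrib sum_subtractf sum_negf sum_distrib_left)

lemma inner_on_commute: "inner_on S x y = inner_on S y x"
  by (simp add: inner_on_def mult.commute)

lemma inner_on_sum_left: "inner_on S (\<Sum>k\<in>K. x k) y = (\<Sum>k\<in>K. inner_on S (x k) y)"
  by (simp add: inner_on_def sum_fun_apply sum_distrib_right sum.swap[of _ S])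

lemma inner_on_nonneg [simp]: "inner_on S x x \<ge> 0"
  by (simp add: inner_on_def sum_nonneg)

lemma inner_on_unit_vec:
  assumes "finite S" "i \<in> S"
  shows "inner_on S x (unit_vec i) = x i"
  using assms by (simp add: inner_on_def unit_vec_def if_distrib sum.delta cong: if_cong)

lemma L2_set_power2: "(L2_set x S)\<^sup>2 = inner_on S x x"
  by (simp add: L2_set_def inner_on_def sum_nonneg power2_eq_square)

lemma inner_on_self_eq_0:
  assumes "finite S" "x \<in> rvec S" "inner_on S x x = 0"
  shows "x = 0"
proof -
  have "\<forall>i\<in>S. x i * x i = 0"
    using assms unfolding inner_on_def by (subst (asm) sum_nonneg_eq_0_iff) auto
  then show ?thesis
    using assms(2) by (auto simp: rvec_def fun_eq_iff)
qed

lemma coord_sq_le_inner_on: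
  assumes "finite S" "i \<in> S"
  shows "(x i)\<^sup>2 \<le> inner_on S x x"
proof -
  have "x i * x i \<le> (\<Sum>i\<in>S. x i * x i)"
    using assms by (intro member_le_sum) auto
  then show ?thesis by (simp add: inner_on_def power2_eq_square)
qed

text \<open>
  Young's inequality; the weight is chosen by the caller so that one of the two squares is absorbed.
\<close>

lemma two_inner_on_le:
  assumes "e > 0"
  shows "2 * inner_on S x y \<le> e * inner_on S x x + inner_on S y y / e"
proof -
  have "0 \<le> inner_on S (e \<odot> x - y) (e \<odot> x - y) / e"
    using assms by (intro divide_nonneg_pos inner_on_nonneg)
  also have "\<dots> = e * inner_on S x x + inner_on S y y / e - 2 * inner_on S x y"
    using assms
    by (simp add: inner_on_commute[of S y x] right_diff_distrib diff_divide_distrib add_divide_distrib)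
  finally show ?thesis by simp
qed

lemma lin_add: "lin f \<Longrightarrow> f (x + y) = f x + f y"
  and lin_scl: "lin f \<Longrightarrow> f (c \<odot> x) = c \<odot> f x"
  by (simp_all add: lin_def)

lemma lin_uminus: "lin f \<Longrightarrow> f (- x) = - f x"
  using lin_scl[of f "- 1" x] by (simp add: uminus_eq_scl[symmetric])

lemma lin_diff: "lin f \<Longrightarrow> f (x - y) = f x - f y"
  using lin_add[of f x "- y"] lin_uminus[of f y] by simp

lemma lin_0: "lin f \<Longrightarrow> f 0 = 0"
  using lin_scl[of f 0 0] by simp

lemma lin_sum:
  assumes "lin f"
  shows "f (\<Sum>k\<in>K. x k) = (\<Sum>k\<in>K. f (x k))"
proof (cases "finite K")
  case True
  then show ?thesis
  proof induction
    case empty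
    show "f (\<Sum>k\<in>{}. x k) = (\<Sum>k\<in>{}. f (x k))" by (simp add: lin_0[OF assms])
  next
    case (insert a K)
    have "f (\<Sum>k\<in>K. x k) = (\<Sum>k\<in>K. f (x k))" by (rule insert.IH)
    with insert.hyps show "f (\<Sum>k\<in>insert a K. x k) = (\<Sum>k\<in>insert a K. f (x k))"
      by (simp add: lin_add[OF assms])
  qed
qed (simp add: lin_0[OF assms])

lemma lin_comp: "lin f \<Longrightarrow> lin g \<Longrightarrow> lin (\<lambda>x. g (f x))"
  by (simp add: lin_def)

lemma rvec_expand:
  assumes "finite S" "x \<in> rvec S"
  shows "x = (\<Sum>i\<in>S. x i \<odot> unit_vec i)"
  using assms
  by (auto simp: fun_eq_iff sum_fun_apply unit_vec_def rvec_def if_distrib sum.delta cong: if_cong)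

lemma lin_expand:
  assumes "lin f" "finite S" "x \<in> rvec S"
  shows "f x j = (\<Sum>i\<in>S. x i * f (unit_vec i) j)"
proof -
  have "f x = f (\<Sum>i\<in>S. x i \<odot> unit_vec i)"
    using rvec_expand[OF assms(2,3)] by simp
  then show ?thesis
    using assms(1) by (simp add: lin_sum lin_scl sum_fun_apply)
qed

lemma inner_lin_expand:
  assumes "lin f" "finite S" "u \<in> rvec S"
  shows "inner_on T (f u) y = (\<Sum>i\<in>S. u i * inner_on T (f (unit_vec i)) y)"
proof -
  have "f u = (\<Sum>i\<in>S. u i \<odot> f (unit_vec i))"
    using lin_expand[OF assms] by (auto simp: fun_eq_iff sum_fun_apply)
  then show ?thesis by (simp add: inner_on_sum_left)
qed

text \<open>
  The description by \<open>THE\<close> is replaced by a formula: the entries of the adjoint vector are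
  the pairings with the images of the unit vectors. It shows at once that the adjoint is linear and
  has the defining property.
\<close>

lemma adj_on_eq:
  assumes "lin f" "finite S"
  shows "adj_on S T f y = (\<lambda>i. if i \<in> S then inner_on T (f (unit_vec i)) y else 0)"
    (is "_ = ?x")
  unfolding adj_on_def
proof (rule the_equality)
  have "inner_on T (f u) y = inner_on S u ?x" if "u \<in> rvec S" for u
    unfolding inner_lin_expand[OF assms that] inner_on_def[of S] by (intro sum.cong) auto
  then show "?x \<in> rvec S \<and> (\<forall>u\<in>rvec S. inner_on T (f u) y = inner_on S u ?x)"
    by (auto simp: rvec_def)
next
  fix x assume x: "x \<in> rvec S \<and> (\<forall>u\<in>rvec S. inner_on T (f u) y = inner_on S u x)"
  show "x = ?x"
  proof
    fix i show "x i = ?x i"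
    proof (cases "i \<in> S")
      case True
      then have "inner_on T (f (unit_vec i)) y = inner_on S (unit_vec i) x" using x by simp
      then show ?thesis
        using True inner_on_unit_vec[OF assms(2) True, of x] by (simp add: inner_on_commute)
    qed (use x in \<open>auto simp: rvec_def\<close>)
  qed
qed

lemma lin_adj_on: "lin f \<Longrightarrow> finite S \<Longrightarrow> lin (adj_on S T f)"
  by (auto simp: lin_def adj_on_eq fun_eq_iff)

lemma inner_adj_on:
  assumes "lin f" "finite S" "u \<in> rvec S"
  shows "inner_on T (f u) y = inner_on S u (adj_on S T f y)"
  unfolding inner_lin_expand[OF assms] adj_on_eq[OF assms(1,2)] inner_on_def[of S]
  by (intro sum.cong) auto

section \<open>Convergence of vectors\<close>

lemma converges_on_iff:
  assumes "finite S"
  shows "converges_on S x l \<longleftrightarrow> (\<forall>i\<in>S. (\<lambda>k. x k i) \<longlonglongrightarrow> l i)"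
proof
  assume c: "converges_on S x l"
  show "\<forall>i\<in>S. (\<lambda>k. x k i) \<longlonglongrightarrow> l i"
  proof
    fix i assume i: "i \<in> S"
    have "\<bar>x k i - l i\<bar> \<le> L2_set (x k - l) S" for k
      using member_le_L2_set[OF assms i, of "\<lambda>i. \<bar>x k i - l i\<bar>"] by (simp add: L2_set_def)
    then have "(\<lambda>k. x k i - l i) \<longlonglongrightarrow> 0"
      using c unfolding converges_on_def
      by (intro Lim_null_comparison[of "\<lambda>k. x k i - l i"]) auto
    then show "(\<lambda>k. x k i) \<longlonglongrightarrow> l i" by (simp add: LIM_zero_iff)
  qed
next
  assume l: "\<forall>i\<in>S. (\<lambda>k. x k i) \<longlonglongrightarrow> l i"
  have "(\<lambda>k. sqrt (\<Sum>i\<in>S. (x k i - l i)\<^sup>2)) \<longlonglongrightarrow> sqrt (\<Sum>i\<in>S. (l i - l i)\<^sup>2)"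
    using l by (intro tendsto_intros) auto
  then show "converges_on S x l" by (simp add: converges_on_def L2_set_def)
qed

lemma converges_on_inner:
  assumes "finite S" "converges_on S x l" "converges_on S y m"
  shows "(\<lambda>k. inner_on S (x k) (y k)) \<longlonglongrightarrow> inner_on S l m"
  using assms unfolding inner_on_def by (auto simp: converges_on_iff intro!: tendsto_intros)

lemma converges_on_const: "finite S \<Longrightarrow> converges_on S (\<lambda>k. l) l"
  by (simp add: converges_on_iff)

lemma converges_on_add:
  "finite S \<Longrightarrow> converges_on S x l \<Longrightarrow> converges_on S y m \<Longrightarrow>
    converges_on S (\<lambda>k. x k + y k) (l + m)"
  by (auto simp: converges_on_iff intro!: tendsto_intros)

lemma converges_on_diff:
  "finite S \<Longrightarrow> converges_on S x l \<Longrightarrow> converges_on S y m \<Longrightarrow>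
    converges_on S (\<lambda>k. x k - y k) (l - m)"
  by (auto simp: converges_on_iff intro!: tendsto_intros)

lemma converges_on_scl:
  "finite S \<Longrightarrow> converges_on S x l \<Longrightarrow> converges_on S (\<lambda>k. c \<odot> x k) (c \<odot> l)"
  by (auto simp: converges_on_iff intro!: tendsto_intros)

lemma converges_on_subseq:
  "finite S \<Longrightarrow> converges_on S x l \<Longrightarrow> strict_mono r \<Longrightarrow> converges_on S (\<lambda>k. x (r k)) l"
  by (auto simp: converges_on_iff intro: LIMSEQ_subseq_LIMSEQ[unfolded o_def])

lemma converges_on_Suc:
  "finite S \<Longrightarrow> converges_on S (\<lambda>k. x (Suc k)) l \<longleftrightarrow> converges_on S x l"
  by (simp add: converges_on_iff filterlim_sequentially_Suc[of "\<lambda>k. x k i" for i])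

lemma converges_on_unique:
  assumes "finite S" "converges_on S x l" "converges_on S x m" "l \<in> rvec S" "m \<in> rvec S"
  shows "l = m"
  using assms by (auto simp: converges_on_iff intro!: rvec_eqI[of l S m] intro: LIMSEQ_unique)

lemma converges_on_lin:
  assumes "lin f" "finite S" "finite T" "\<And>k. x k \<in> rvec S" "l \<in> rvec S" "converges_on S x l"
  shows "converges_on T (\<lambda>k. f (x k)) (f l)"
  using assms by (auto simp: converges_on_iff lin_expand[OF assms(1,2)] intro!: tendsto_intros)

lemma converges_on_0I:
  assumes "finite S" "(\<lambda>k. inner_on S (x k) (x k)) \<longlonglongrightarrow> 0"
  shows "converges_on S x 0"
proof -
  have "(\<lambda>k. sqrt (inner_on S (x k) (x k))) \<longlonglongrightarrow> sqrt 0"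
    using assms(2) by (rule tendsto_real_sqrt)
  then show ?thesis
    by (simp add: converges_on_def L2_set_def inner_on_def power2_eq_square)
qed

text \<open>Bolzano--Weierstrass for vectors, one coordinate at a time.\<close>

lemma bounded_subseq_on:
  assumes "finite S" "\<And>i. i \<in> S \<Longrightarrow> bounded (range (\<lambda>k. x k i))"
  obtains r l where "strict_mono (r :: nat \<Rightarrow> nat)" "l \<in> rvec S" "converges_on S (\<lambda>k. x (r k)) l"
proof -
  have "\<exists>r. strict_mono (r :: nat \<Rightarrow> nat) \<and> (\<forall>i\<in>S. convergent (\<lambda>k. x (r k) i))"
    using assms
  proof (induction S rule: finite_induct)
    case empty
    then show ?case by (auto intro: exI[of _ id] simp: strict_mono_id)
  next
    case (insert i S)
    then obtain r where r: "strict_mono (r :: nat \<Rightarrow> nat)" "\<forall>i\<in>S. convergent (\<lambda>k. x (r k) i)"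
      by auto
    have "bounded (range (\<lambda>k. x (r k) i))"
      using insert.prems[of i] by (auto intro: bounded_subset)
    then obtain m s where s: "strict_mono (s :: nat \<Rightarrow> nat)" "(\<lambda>k. x (r (s k)) i) \<longlonglongrightarrow> m"
      using bounded_imp_convergent_subsequence[of "\<lambda>k. x (r k) i"] by (auto simp: o_def)
    have "convergent (\<lambda>k. x (r (s k)) j)" if "j \<in> S" for j
      using r(2) that s(1) convergent_subseq_convergent[of "\<lambda>k. x (r k) j" s] by (auto simp: o_def)
    then show ?case
      using s r(1) by (intro exI[of _ "r \<circ> s"]) (auto simp: convergent_def strict_mono_def)
  qed
  then obtain r where r: "strict_mono (r :: nat \<Rightarrow> nat)" "\<forall>i\<in>S. convergent (\<lambda>k. x (r k) i)"
    by blast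
  show thesis
  proof
    show "strict_mono r" by fact
    show "(\<lambda>i. if i \<in> S then lim (\<lambda>k. x (r k) i) else 0) \<in> rvec S" by (simp add: rvec_def)
    show "converges_on S (\<lambda>k. x (r k)) (\<lambda>i. if i \<in> S then lim (\<lambda>k. x (r k) i) else 0)"
      using r assms(1) by (simp add: converges_on_iff convergent_LIMSEQ_iff)
  qed
qed

lemma bounded_of_sq_diff:
  fixes x :: "nat \<Rightarrow> real"
  assumes "\<And>k. (x k - s)\<^sup>2 \<le> C"
  shows "bounded (range x)"
proof (rule boundedI)
  fix y assume "y \<in> range x"
  then obtain k where y: "y = x k" by blast
  have "\<bar>x k - s\<bar> \<le> sqrt C" using assms[of k] by (simp add: real_le_rsqrt real_sqrt_abs[symmetric] del: real_sqrt_abs)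
  then show "norm y \<le> sqrt C + \<bar>s\<bar>" by (simp add: y)
qed

section \<open>Averages\<close>

definition avg :: "(nat \<Rightarrow> 'i \<Rightarrow> real) \<Rightarrow> nat \<Rightarrow> 'i \<Rightarrow> real" where
  "avg x m = (1 / real (Suc m)) \<odot> (\<Sum>k<Suc m. x k)"

lemma avg_in_rvec: "(\<And>k. x k \<in> rvec S) \<Longrightarrow> avg x m \<in> rvec S"
  unfolding avg_def by (intro rvec_closed rvec_sum)

lemma lin_avg: "lin f \<Longrightarrow> f (avg x m) = avg (\<lambda>k. f (x k)) m"
  using lin_scl[of f "1 / real (Suc m)"] lin_sum[of f x "{..<Suc m}"] by (simp only: avg_def)

lemma avg_add: "avg (\<lambda>k. x k + y k) m = avg x m + avg y m"
  and avg_diff: "avg (\<lambda>k. x k - y k) m = avg x m - avg y m"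
  and avg_scl: "avg (\<lambda>k. c \<odot> x k) m = c \<odot> avg x m"
  and avg_uminus: "avg (\<lambda>k. - x k) m = - avg x m"
  and avg_const: "avg (\<lambda>k. a) m = a"
  by (auto simp: avg_def fun_eq_iff sum_fun_apply sum.distrib sum_subtractf sum_distrib_left
      sum_negf algebra_simps add_divide_distrib diff_divide_distrib simp del: sum.lessThan_Suc of_nat_Suc)

lemma inner_avg: "inner_on S (avg x m) y = (\<Sum>k<Suc m. inner_on S (x k) y) / real (Suc m)"
  by (simp add: avg_def inner_on_sum_left del: sum.lessThan_Suc of_nat_Suc)

lemma avg_telescope:
  "avg (\<lambda>k. x (Suc k) - x k) m = (1 / real (Suc m)) \<odot> (x (Suc m) - x 0)"
  for x :: "nat \<Rightarrow> 'i \<Rightarrow> real"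
  unfolding avg_def by (simp only: sum_lessThan_telescope)

lemma bounded_avg:
  assumes "\<And>k. \<bar>x k i\<bar> \<le> B k" "\<And>m. (\<Sum>k<Suc m. B k) \<le> C * real (Suc m)"
  shows "bounded (range (\<lambda>m. avg x m i))"
proof (rule boundedI)
  fix y assume "y \<in> range (\<lambda>m. avg x m i)"
  then obtain m where y: "y = avg x m i" by blast
  have "\<bar>\<Sum>k<Suc m. x k i\<bar> \<le> (\<Sum>k<Suc m. B k)"
    by (rule order_trans[OF sum_abs sum_mono]) (rule assms(1))
  also have "\<dots> \<le> C * real (Suc m)" by (rule assms(2))
  finally show "norm y \<le> C"
    by (simp add: y avg_def sum_fun_apply field_simps abs_mult del: sum.lessThan_Suc of_nat_Suc)
qed

lemma avg_in_cone:
  assumes add: "\<And>x y. x \<in> C \<Longrightarrow> y \<in> C \<Longrightarrow> x + y \<in> C"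
    and scl: "\<And>a x. a \<ge> 0 \<Longrightarrow> x \<in> C \<Longrightarrow> a \<odot> x \<in> C" and x: "\<And>k. x k \<in> C"
  shows "avg x m \<in> C"
proof -
  have "(\<Sum>k<Suc m. x k) \<in> C"
  proof (induction m)
    case 0
    show "(\<Sum>k<Suc 0. x k) \<in> C" using x[of 0] by simp
  next
    case (Suc m)
    have "(\<Sum>k<Suc m. x k) \<in> C" by (rule Suc.IH)
    from add[OF this x[of "Suc m"]]
    show "(\<Sum>k<Suc (Suc m). x k) \<in> C" by (simp only: sum.lessThan_Suc)
  qed
  then show ?thesis unfolding avg_def by (intro scl) simp_all
qed

text \<open>
  Quantities whose squares grow at most linearly are of order \<open>\<surd>m\<close>, so their averaged
  increments vanish. An energy that is not bounded but grows linearly is thus good enough for the averages.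
\<close>

lemma tendsto_0_of_sq_growth:
  fixes y :: "nat \<Rightarrow> real"
  assumes "\<And>m. (y m)\<^sup>2 \<le> C * real (Suc m)"
  shows "(\<lambda>m. y m / real (Suc m)) \<longlonglongrightarrow> 0"
proof -
  have lim: "(\<lambda>m. C / real (Suc m)) \<longlonglongrightarrow> 0"
    using tendsto_mult_right_zero[OF LIMSEQ_inverse_real_of_nat, of C] by (simp add: divide_inverse)
  have "(\<lambda>m. (y m / real (Suc m))\<^sup>2) \<longlonglongrightarrow> 0"
  proof (rule tendsto_sandwich[OF _ _ tendsto_const lim])
    have "(y m / real (Suc m))\<^sup>2 \<le> C / real (Suc m)" for m
    proof -
      have "(y m / real (Suc m))\<^sup>2 = (y m)\<^sup>2 / (real (Suc m) * real (Suc m))"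
        by (simp add: power2_eq_square)
      also have "\<dots> \<le> C * real (Suc m) / (real (Suc m) * real (Suc m))"
        by (intro divide_right_mono assms) simp
      finally show ?thesis by simp
    qed
    then show "\<forall>\<^sub>F m in sequentially. (y m / real (Suc m))\<^sup>2 \<le> C / real (Suc m)" by simp
  qed simp
  then have "(\<lambda>m. sqrt ((y m / real (Suc m))\<^sup>2)) \<longlonglongrightarrow> sqrt 0"
    by (rule tendsto_real_sqrt)
  then have "(\<lambda>m. \<bar>y m / real (Suc m)\<bar>) \<longlonglongrightarrow> 0" by simp
  then show ?thesis by (rule tendsto_rabs_zero_cancel)
qed

lemma increment_average_tendsto_0:
  fixes x :: "nat \<Rightarrow> real"
  assumes C: "\<And>k. (x k - s)\<^sup>2 \<le> C * real (Suc k)"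
  shows "(\<lambda>m. 1 / real (Suc m) * (x (Suc m) - x 0)) \<longlonglongrightarrow> 0"
proof -
  have "(x (Suc m) - x 0)\<^sup>2 \<le> (6 * C) * real (Suc m)" for m
  proof -
    have sq: "(a - b)\<^sup>2 \<le> 2 * a\<^sup>2 + 2 * b\<^sup>2" for a b :: real
      using zero_le_power2[of "a + b"] by (simp add: power2_eq_square algebra_simps)
    have "(x (Suc m) - x 0)\<^sup>2 \<le> 2 * (x (Suc m) - s)\<^sup>2 + 2 * (x 0 - s)\<^sup>2"
      using sq[of "x (Suc m) - s" "x 0 - s"] by simp
    also have "\<dots> \<le> 2 * (C * real (Suc (Suc m))) + 2 * (C * 1)"
      using C[of "Suc m"] C[of 0] by simp
    \<comment> \<open>The factor 6 comes from \<open>m+3 \<le> 3(m+1)\<close>.\<close>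
    also have "\<dots> \<le> (6 * C) * real (Suc m)"
    proof -
      have "0 \<le> C" using order_trans[OF zero_le_power2 C[of 0]] by simp
      then have "0 \<le> C * real m" by simp
      then show ?thesis by (simp add: algebra_simps)
    qed
    finally show ?thesis .
  qed
  from tendsto_0_of_sq_growth[OF this] show ?thesis by simp
qed

section \<open>The conic programme\<close>

text \<open>
  The properties of the discretised problem that the convergence proof uses. In the application
  \<open>V\<close> is the range of \<open>\<A>\<^sup>*\<close> and \<open>N = \<B>\<F>\<close>. The two recovery assumptions express injectivity of
  \<open>A\<close> on \<open>V\<close> and of \<open>N\<close> in the form of a continuous linear left inverse, coordinate by coordinate.
  In this form they turn convergence of images into convergence of preimages.
\<close>

locale conic_problem =
  fixes P :: "'p set" and S :: "'s set" and T :: "'t set"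
    and A :: "('p \<Rightarrow> real) \<Rightarrow> 's \<Rightarrow> real" and At :: "('s \<Rightarrow> real) \<Rightarrow> 'p \<Rightarrow> real"
    and N :: "('s \<Rightarrow> real) \<Rightarrow> 't \<Rightarrow> real" and Nt :: "('t \<Rightarrow> real) \<Rightarrow> 's \<Rightarrow> real"
    and c :: "'p \<Rightarrow> real" and d :: "'t \<Rightarrow> real"
    and V :: "('p \<Rightarrow> real) set" and Q :: "('t \<Rightarrow> real) set"
  assumes finite_index: "finite P" "finite S" "finite T"
    and lin_ops: "lin A" "lin At" "lin N" "lin Nt"
    and ops_in_rvec: "\<And>u. A u \<in> rvec S" "\<And>q. N q \<in> rvec T" "\<And>y. Nt y \<in> rvec S"
    and adjoint_A: "\<And>u y. u \<in> rvec P \<Longrightarrow> inner_on S (A u) y = inner_on P u (At y)"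
    and adjoint_N: "\<And>q y. q \<in> rvec S \<Longrightarrow> inner_on T (N q) y = inner_on S q (Nt y)"
    and V_sub: "V \<subseteq> rvec P"
    and V_add: "\<And>u v. u \<in> V \<Longrightarrow> v \<in> V \<Longrightarrow> u + v \<in> V"
    and V_scl: "\<And>a u. u \<in> V \<Longrightarrow> a \<odot> u \<in> V"
    and V_closed: "\<And>x l. (\<And>k. x k \<in> V) \<Longrightarrow> converges_on P x l \<Longrightarrow> l \<in> rvec P \<Longrightarrow> l \<in> V"
    and recover_V: "\<And>i. i \<in> P \<Longrightarrow> \<exists>y. \<forall>u\<in>V. u i = inner_on S (A u) y"
    and recover_S: "\<And>j. j \<in> S \<Longrightarrow> \<exists>y. \<forall>q\<in>rvec S. q j = inner_on T (N q) y"
    and At_in_rvec: "\<And>y. At y \<in> rvec P"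
    and c_in_rvec: "c \<in> rvec P"
    and d_in_rvec: "d \<in> rvec T"
    and Q_sub: "Q \<subseteq> rvec T"
    and Q_add: "\<And>x y. x \<in> Q \<Longrightarrow> y \<in> Q \<Longrightarrow> x + y \<in> Q"
    and Q_scl: "\<And>a x. a \<ge> 0 \<Longrightarrow> x \<in> Q \<Longrightarrow> a \<odot> x \<in> Q"
    and Q_closed: "\<And>x l. (\<And>k. x k \<in> Q) \<Longrightarrow> converges_on T x l \<Longrightarrow> l \<in> rvec T \<Longrightarrow> l \<in> Q"
    and Q_pairing: "\<And>x y. x \<in> Q \<Longrightarrow> y \<in> Q \<Longrightarrow> inner_on T x y \<ge> 0"
begin

text \<open>
  Primal and dual feasibility together. Such a point solves the KKT system if and only if
  \<open>\<langle>z, \<beta>\<rangle> = 0\<close>; in general \<open>\<langle>z, \<beta>\<rangle>\<close> is its duality gap.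
\<close>

definition feasible where
  "feasible \<phi> z q \<alpha> \<beta> \<longleftrightarrow> \<phi> \<in> V \<and> z \<in> Q \<and> q \<in> rvec S \<and> \<alpha> \<in> rvec S \<and> \<beta> \<in> Q \<and>
     A \<phi> = q \<and> z = N q + d \<and> At \<alpha> = - c \<and> \<alpha> + Nt \<beta> = 0"

text \<open>
  The pairing with \<open>y\<close> controls the size of the elements of \<open>Q\<close>. This is how a point in the interior of the dual
  cone acts in the estimates.
\<close>

definition interior_pt :: "('t \<Rightarrow> real) \<Rightarrow> bool" where
  "interior_pt y \<longleftrightarrow> (\<exists>K\<ge>0. \<forall>x\<in>Q. \<forall>p\<in>T. \<bar>x p\<bar> \<le> K * inner_on T x y)"

lemma V_in_rvec: "u \<in> V \<Longrightarrow> u \<in> rvec P"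
  and Q_in_rvec: "x \<in> Q \<Longrightarrow> x \<in> rvec T"
  using V_sub Q_sub by auto

lemma V_avg: "(\<And>k. x k \<in> V) \<Longrightarrow> avg x m \<in> V"
  by (rule avg_in_cone[OF V_add V_scl])

lemma Q_avg: "(\<And>k. x k \<in> Q) \<Longrightarrow> avg x m \<in> Q"
  by (rule avg_in_cone[OF Q_add Q_scl])

lemma converges_V_of_image:
  assumes u: "\<And>k. u k \<in> V" and l: "l \<in> rvec S" "converges_on S (\<lambda>k. A (u k)) l"
  obtains \<phi> where "\<phi> \<in> V" "converges_on P u \<phi>" "A \<phi> = l"
proof -
  obtain y where y: "\<And>i v. i \<in> P \<Longrightarrow> v \<in> V \<Longrightarrow> v i = inner_on S (A v) (y i)"
    using recover_V by metis
  define \<phi> where "\<phi> = (\<lambda>i. if i \<in> P then inner_on S l (y i) else 0)"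
  have "converges_on P u \<phi>"
    unfolding converges_on_iff[OF finite_index(1)]
  proof
    fix i assume i: "i \<in> P"
    have "(\<lambda>k. inner_on S (A (u k)) (y i)) \<longlonglongrightarrow> inner_on S l (y i)"
      using l(2) converges_on_const[OF finite_index(2)]
      by (rule converges_on_inner[OF finite_index(2)])
    then show "(\<lambda>k. u k i) \<longlonglongrightarrow> \<phi> i"
      using i y[OF i u] by (simp add: \<phi>_def)
  qed
  moreover have \<phi>P: "\<phi> \<in> rvec P" by (simp add: \<phi>_def rvec_def)
  ultimately have \<phi>: "\<phi> \<in> V" "converges_on P u \<phi>"
    using V_closed[OF u] by auto
  have "converges_on S (\<lambda>k. A (u k)) (A \<phi>)"
    using u \<phi>(2) \<phi>P V_in_rvec
    by (intro converges_on_lin[OF lin_ops(1) finite_index(1,2)]) auto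
  then have "A \<phi> = l"
    using l ops_in_rvec(1) by (intro converges_on_unique[OF finite_index(2)])
  with \<phi> show thesis by (rule that)
qed

lemma converges_S_of_image:
  assumes u: "\<And>k. u k \<in> rvec S" and l: "l \<in> rvec T" "converges_on T (\<lambda>k. N (u k)) l"
  obtains q where "q \<in> rvec S" "converges_on S u q" "N q = l"
proof -
  obtain y where y: "\<And>i v. i \<in> S \<Longrightarrow> v \<in> rvec S \<Longrightarrow> v i = inner_on T (N v) (y i)"
    using recover_S by metis
  define q where "q = (\<lambda>i. if i \<in> S then inner_on T l (y i) else 0)"
  have q: "converges_on S u q"
    unfolding converges_on_iff[OF finite_index(2)]
  proof
    fix i assume i: "i \<in> S"
    have "(\<lambda>k. inner_on T (N (u k)) (y i)) \<longlonglongrightarrow> inner_on T l (y i)"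
      using l(2) converges_on_const[OF finite_index(3)]
      by (rule converges_on_inner[OF finite_index(3)])
    then show "(\<lambda>k. u k i) \<longlonglongrightarrow> q i"
      using i y[OF i u] by (simp add: q_def)
  qed
  have qS: "q \<in> rvec S" by (simp add: q_def rvec_def)
  have "converges_on T (\<lambda>k. N (u k)) (N q)"
    using u q qS by (intro converges_on_lin[OF lin_ops(3) finite_index(2,3)]) auto
  then have "N q = l"
    using l ops_in_rvec(2) by (intro converges_on_unique[OF finite_index(3)])
  with qS q show thesis by (rule that)
qed

end

section \<open>The alternating direction iteration\<close>

text \<open>
  The two minimisations enter only through their first-order conditions: \<open>opt_\<phi>\<close> and \<open>opt_z\<close> for the
  joint step in \<open>\<phi>\<close> and \<open>z\<close>, which are decoupled, and \<open>opt_q\<close> for the step in \<open>q\<close>.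
\<close>

locale admm_iteration = conic_problem P S T A At N Nt c d V Q
  for P :: "'p set" and S :: "'s set" and T :: "'t set"
    and A :: "('p \<Rightarrow> real) \<Rightarrow> 's \<Rightarrow> real" and At :: "('s \<Rightarrow> real) \<Rightarrow> 'p \<Rightarrow> real"
    and N :: "('s \<Rightarrow> real) \<Rightarrow> 't \<Rightarrow> real" and Nt :: "('t \<Rightarrow> real) \<Rightarrow> 's \<Rightarrow> real"
    and c :: "'p \<Rightarrow> real" and d :: "'t \<Rightarrow> real"
    and V :: "('p \<Rightarrow> real) set" and Q :: "('t \<Rightarrow> real) set" +
  fixes \<sigma> \<tau> :: real
    and \<phi> :: "nat \<Rightarrow> 'p \<Rightarrow> real" and z \<beta> :: "nat \<Rightarrow> 't \<Rightarrow> real"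
    and q \<alpha> :: "nat \<Rightarrow> 's \<Rightarrow> real"
  assumes \<sigma>: "\<sigma> > 0" and \<tau>: "0 < \<tau>" "\<tau> < 2"
    and q_in: "\<And>k. q k \<in> rvec S" and \<alpha>_in: "\<And>k. \<alpha> k \<in> rvec S" and \<beta>_in: "\<And>k. \<beta> k \<in> rvec T"
    and \<phi>_in: "\<And>k. \<phi> (Suc k) \<in> V" and z_in: "\<And>k. z (Suc k) \<in> Q"
    and opt_\<phi>: "\<And>k. At (\<alpha> k + \<sigma> \<odot> (A (\<phi> (Suc k)) - q k)) = - c"
    and opt_z: "\<And>k. \<beta> k + \<sigma> \<odot> (z (Suc k) - N (q k) - d) \<in> Q"
      "\<And>k. inner_on T (z (Suc k)) (\<beta> k + \<sigma> \<odot> (z (Suc k) - N (q k) - d)) = 0"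
    and opt_q: "\<And>k. (\<alpha> k + \<sigma> \<odot> (A (\<phi> (Suc k)) - q (Suc k)))
      + Nt (\<beta> k + \<sigma> \<odot> (z (Suc k) - N (q (Suc k)) - d)) = 0"
    and update_\<alpha>: "\<And>k. \<alpha> (Suc k) = \<alpha> k + (\<tau> * \<sigma>) \<odot> (A (\<phi> (Suc k)) - q (Suc k))"
    and update_\<beta>: "\<And>k. \<beta> (Suc k) = \<beta> k + (\<tau> * \<sigma>) \<odot> (z (Suc k) - N (q (Suc k)) - d)"
begin

text \<open>
  \<open>resA\<close> and \<open>resN\<close> are the residuals of the two constraints after a full step, and \<open>defect\<close> is
  the violation of the dual equation \<open>\<alpha> + N\<^sup>*\<beta> = 0\<close>. The vectors \<open>\<alpha>_pred\<close> and \<open>\<beta>_pred\<close> are the multipliers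
  predicted with the old \<open>q\<close>; they satisfy the dual constraints \<open>A\<^sup>*\<alpha> = -c\<close> and \<open>\<beta> \<in> Q\<close> exactly,
  whereas the iterates \<open>\<alpha> k\<close> and \<open>\<beta> k\<close> in general do so only in the limit.
\<close>

definition resA where "resA k = A (\<phi> (Suc k)) - q (Suc k)"
definition resN where "resN k = z (Suc k) - N (q (Suc k)) - d"
definition dq where "dq k = q (Suc k) - q k"
definition defect where "defect k = \<alpha> k + Nt (\<beta> k)"
definition \<alpha>_pred where "\<alpha>_pred k = \<alpha> k + \<sigma> \<odot> (A (\<phi> (Suc k)) - q k)"
definition \<beta>_pred where "\<beta>_pred k = \<beta> k + \<sigma> \<odot> (z (Suc k) - N (q k) - d)"

text \<open>
  The squared distance to the reference multipliers plus \<open>\<tau> \<sigma>\<^sup>2\<close> times the squared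
  distance of \<open>q\<close> in the graph norm of \<open>N\<close>, the norm of the constraint operator \<open>q \<mapsto> (q, N q)\<close>.
\<close>

definition lyap where
  "lyap q' \<alpha>' \<beta>' k = inner_on S (\<alpha> k - \<alpha>') (\<alpha> k - \<alpha>') + inner_on T (\<beta> k - \<beta>') (\<beta> k - \<beta>')
    + \<tau> * \<sigma>\<^sup>2 * (inner_on S (q k - q') (q k - q') + inner_on T (N (q k - q')) (N (q k - q')))"

lemma diff_in_rvec: "dq k \<in> rvec S" "resA k \<in> rvec S" "resN k \<in> rvec T" "defect k \<in> rvec S"
  using q_in \<alpha>_in ops_in_rvec Q_in_rvec[OF z_in] d_in_rvec
  unfolding dq_def resA_def resN_def defect_def by (auto intro!: rvec_closed)

lemma \<alpha>_pred_eq: "\<alpha>_pred k = \<alpha> k + \<sigma> \<odot> resA k + \<sigma> \<odot> dq k"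
  by (auto simp: \<alpha>_pred_def resA_def dq_def fun_eq_iff algebra_simps)

lemma \<beta>_pred_eq: "\<beta>_pred k = \<beta> k + \<sigma> \<odot> resN k + \<sigma> \<odot> N (dq k)"
  by (auto simp: \<beta>_pred_def resN_def dq_def lin_diff[OF lin_ops(3)] fun_eq_iff algebra_simps)

text \<open>
  This is the optimality condition of the \<open>q\<close>-step: the residuals are a multiple of the defect when they are tested
  with directions \<open>(q, N q)\<close>.
\<close>

lemma defect_residual: "defect k + \<sigma> \<odot> (resA k + Nt (resN k)) = 0"
proof -
  have "defect k + \<sigma> \<odot> (resA k + Nt (resN k)) = (\<alpha> k + \<sigma> \<odot> resA k) + Nt (\<beta> k + \<sigma> \<odot> resN k)"
    by (auto simp: defect_def lin_add[OF lin_ops(4)] lin_scl[OF lin_ops(4)] fun_eq_iff algebra_simps)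
  then show ?thesis using opt_q[of k] by (simp add: resA_def resN_def)
qed

text \<open>
  The multiplier update adds \<open>\<tau> \<sigma>\<close> times the residuals, which by the preceding lemma removes
  exactly the fraction \<open>\<tau>\<close> of the defect.
\<close>

lemma defect_Suc: "defect (Suc k) = (1 - \<tau>) \<odot> defect k"
proof -
  have "defect (Suc k) = defect k + \<tau> \<odot> (\<sigma> \<odot> (resA k + Nt (resN k)))"
    unfolding defect_def update_\<alpha> update_\<beta> resA_def[symmetric] resN_def[symmetric]
    by (auto simp: lin_add[OF lin_ops(4)] lin_scl[OF lin_ops(4)] fun_eq_iff algebra_simps)
  also have "\<sigma> \<odot> (resA k + Nt (resN k)) = - defect k"
    using defect_residual[of k] by (simp add: eq_neg_iff_add_eq_0 add.commute)
  finally show ?thesis by (auto simp: fun_eq_iff algebra_simps)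
qed

text \<open>
  An upper bound for the contribution of the defect to the energy balance; it is summable because the
  defect is a geometric sequence of ratio \<open>1 - \<tau> \<in> (-1, 1)\<close>.
\<close>

definition defect_cost where "defect_cost k = 2 * \<tau> * inner_on S (defect k) (defect k)"

lemma defect_cost_nonneg: "defect_cost k \<ge> 0"
  using \<tau> by (simp add: defect_cost_def)

lemma summable_defect_cost: "summable defect_cost"
proof -
  have defect: "defect k = (1 - \<tau>) ^ k \<odot> defect 0" for k
    by (induction k) (auto simp: defect_Suc fun_eq_iff)
  have eq: "defect_cost = (\<lambda>k. defect_cost 0 * ((1 - \<tau>)\<^sup>2) ^ k)"
  proof
    fix k show "defect_cost k = defect_cost 0 * ((1 - \<tau>)\<^sup>2) ^ k"
      unfolding defect_cost_def defect[of k] by (simp add: power2_eq_square power_mult_distrib)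
  qed
  moreover have "(1 - \<tau>)\<^sup>2 < 1"
    using \<tau> abs_square_less_1[of "1 - \<tau>"] by auto
  ultimately show ?thesis
    by (subst eq, intro summable_mult summable_geometric) simp
qed

text \<open>
  Pair the optimality condition of each step with the displacement from the reference point and
  add up: \<open>orth\<close> comes from the \<open>\<phi>\<close>-step, \<open>stat\<close> from the \<open>q\<close>-step, \<open>gap\<close> is the pairing that
  belongs to the \<open>z\<close>-step, and \<open>cross\<close> evaluates the mixed term of residual and increment by means of the defect. All remaining terms are
  squares or telescoping differences.
\<close>

lemma lyap_identity:
  assumes "feasible \<phi>' z' q' \<alpha>' \<beta>'"
  shows "lyap q' \<alpha>' \<beta>' (Suc k) + \<tau> * (2 - \<tau>) * \<sigma>\<^sup>2 * (inner_on S (resA k) (resA k) + inner_on T (resN k) (resN k))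
      + \<tau> * \<sigma>\<^sup>2 * (inner_on S (dq k) (dq k) + inner_on T (N (dq k)) (N (dq k)))
    = lyap q' \<alpha>' \<beta>' k + 2 * \<tau> * \<sigma> * inner_on T (z (Suc k) - z') (\<beta>_pred k - \<beta>')
      + 2 * \<tau> * \<sigma> * inner_on S (defect k) (dq k)"
proof -
  note f = assms[unfolded feasible_def]
  define e where "e = q (Suc k) - q'"
  define xa where "xa = \<alpha> k - \<alpha>'"
  define xb where "xb = \<beta> k - \<beta>'"
  have eS: "e \<in> rvec S" using f q_in by (auto simp: e_def)
  have q_diff: "q k - q' = e - dq k" by (simp add: e_def dq_def)
  have a_Suc: "\<alpha> (Suc k) - \<alpha>' = xa + (\<tau> * \<sigma>) \<odot> resA k"
    by (simp add: update_\<alpha> xa_def resA_def)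
  have b_Suc: "\<beta> (Suc k) - \<beta>' = xb + (\<tau> * \<sigma>) \<odot> resN k"
    by (simp add: update_\<beta> xb_def resN_def)
  have gap: "inner_on T (z (Suc k) - z') (\<beta>_pred k - \<beta>')
      = inner_on T (resN k + N e) (xb + \<sigma> \<odot> resN k + \<sigma> \<odot> N (dq k))"
  proof -
    have "z (Suc k) - z' = resN k + N e"
      using f by (simp add: resN_def e_def lin_diff[OF lin_ops(3)])
    moreover have "\<beta>_pred k - \<beta>' = xb + \<sigma> \<odot> resN k + \<sigma> \<odot> N (dq k)"
      by (simp add: \<beta>_pred_eq xb_def)
    ultimately show ?thesis by (simp only:)
  qed
  have orth: "inner_on S (resA k + e) (xa + \<sigma> \<odot> resA k + \<sigma> \<odot> dq k) = 0"
  proof -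
    have "resA k + e = A (\<phi> (Suc k) - \<phi>')"
      using f by (simp add: resA_def e_def lin_diff[OF lin_ops(1)])
    moreover have "xa + \<sigma> \<odot> resA k + \<sigma> \<odot> dq k = \<alpha>_pred k - \<alpha>'"
      by (simp add: \<alpha>_pred_eq xa_def)
    moreover have "At (\<alpha>_pred k - \<alpha>') = 0"
      using f opt_\<phi>[of k] by (simp add: \<alpha>_pred_def lin_diff[OF lin_ops(2)])
    moreover have "\<phi> (Suc k) - \<phi>' \<in> rvec P"
      using f V_in_rvec \<phi>_in by (auto intro!: rvec_closed)
    ultimately show ?thesis by (simp only: adjoint_A) simp
  qed
  have stat: "inner_on S e (xa + \<sigma> \<odot> resA k) + inner_on T (N e) (xb + \<sigma> \<odot> resN k) = 0"
  proof -
    have "(xa + \<sigma> \<odot> resA k) + Nt (xb + \<sigma> \<odot> resN k)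
        = ((\<alpha> k + \<sigma> \<odot> resA k) + Nt (\<beta> k + \<sigma> \<odot> resN k)) - (\<alpha>' + Nt \<beta>')"
      by (simp add: xa_def xb_def lin_diff[OF lin_ops(4)] lin_add[OF lin_ops(4)])
    also have "\<dots> = 0" using opt_q[of k] f by (simp add: resA_def resN_def)
    finally have "inner_on S e ((xa + \<sigma> \<odot> resA k) + Nt (xb + \<sigma> \<odot> resN k)) = 0" by simp
    then show ?thesis
      using adjoint_N[OF eS, of "xb + \<sigma> \<odot> resN k"] by simp
  qed
  have cross: "\<sigma> * (inner_on S (dq k) (resA k) + inner_on T (N (dq k)) (resN k)) = - inner_on S (defect k) (dq k)"
  proof -
    have "inner_on S (dq k) (defect k + \<sigma> \<odot> (resA k + Nt (resN k))) = 0" by (simp add: defect_residual)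
    then show ?thesis
      by (simp add: adjoint_N[OF diff_in_rvec(1)] inner_on_commute[of S "defect k"] algebra_simps)
  qed
  have gap': "inner_on T (z (Suc k) - z') (\<beta>_pred k - \<beta>')
      = inner_on S (resA k) xa + inner_on T (resN k) xb
        + \<sigma> * (inner_on S (resA k) (resA k) + inner_on T (resN k) (resN k))
        + \<sigma> * (inner_on S e (dq k) + inner_on T (N e) (N (dq k))) - inner_on S (defect k) (dq k)"
    using orth stat cross unfolding gap
    by (simp add: inner_on_commute[of S "dq k" "resA k"] inner_on_commute[of T "N (dq k)" "resN k"]
        distrib_left)
  show ?thesis
    unfolding gap' lyap_def e_def[symmetric] a_Suc b_Suc xa_def[symmetric] xb_def[symmetric] q_diff
      lin_diff[OF lin_ops(3)]
    by (simp add: inner_on_commute[of S xa "resA k"] inner_on_commute[of T xb "resN k"]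
        inner_on_commute[of S "dq k" e] inner_on_commute[of T "N (dq k)" "N e"]
        algebra_simps power2_eq_square)
qed

text \<open>
  By complementarity of the \<open>z\<close>-step the gap term of the identity is the gap of the reference point, a
  constant, minus the pairings of the reference with the new \<open>z\<close> and the predicted \<open>\<beta>\<close>. These are
  nonnegative because the vectors lie in the cone, so they are kept on the left.
\<close>

lemma lyap_step:
  assumes f: "feasible \<phi>' z' q' \<alpha>' \<beta>'"
  shows "lyap q' \<alpha>' \<beta>' (Suc k) + \<tau> * (2 - \<tau>) * \<sigma>\<^sup>2 * (inner_on S (resA k) (resA k) + inner_on T (resN k) (resN k))
      + \<tau> * \<sigma>\<^sup>2 / 2 * inner_on S (dq k) (dq k)
      + 2 * \<tau> * \<sigma> * (inner_on T (z (Suc k)) \<beta>' + inner_on T z' (\<beta>_pred k))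
    \<le> lyap q' \<alpha>' \<beta>' k + 2 * \<tau> * \<sigma> * inner_on T z' \<beta>' + defect_cost k"
proof -
  \<comment> \<open>The weight \<open>2/\<sigma>\<close> spends one half of the dissipation in \<open>dq\<close>.\<close>
  have "2 * inner_on S (defect k) (dq k) \<le> (2 / \<sigma>) * inner_on S (defect k) (defect k) + inner_on S (dq k) (dq k) / (2 / \<sigma>)"
    using \<sigma> by (intro two_inner_on_le) simp
  then have "\<tau> * \<sigma> * (2 * inner_on S (defect k) (dq k))
      \<le> \<tau> * \<sigma> * ((2 / \<sigma>) * inner_on S (defect k) (defect k) + inner_on S (dq k) (dq k) / (2 / \<sigma>))"
    using \<sigma> \<tau> by (intro mult_left_mono) auto
  also have "\<dots> = defect_cost k + \<tau> * \<sigma>\<^sup>2 / 2 * inner_on S (dq k) (dq k)"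
    using \<sigma> by (simp add: defect_cost_def field_simps power2_eq_square)
  finally have young: "2 * \<tau> * \<sigma> * inner_on S (defect k) (dq k) \<le> defect_cost k + \<tau> * \<sigma>\<^sup>2 / 2 * inner_on S (dq k) (dq k)"
    by (simp add: mult_ac)
  have gap: "inner_on T (z (Suc k) - z') (\<beta>_pred k - \<beta>')
      = inner_on T z' \<beta>' - (inner_on T (z (Suc k)) \<beta>' + inner_on T z' (\<beta>_pred k))"
    using opt_z(2)[of k] by (simp add: \<beta>_pred_def[symmetric])
  have "0 \<le> \<tau> * \<sigma>\<^sup>2 * inner_on T (N (dq k)) (N (dq k))"
    using \<tau> by simp
  with lyap_identity[OF f, of k] young show ?thesis
    unfolding gap by (simp add: algebra_simps)
qed

lemma lyap_nonneg: "lyap q' \<alpha>' \<beta>' k \<ge> 0"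
  unfolding lyap_def using \<tau> by (intro add_nonneg_nonneg mult_nonneg_nonneg inner_on_nonneg) auto

lemma dissipation_nonneg:
  "0 \<le> \<tau> * (2 - \<tau>) * \<sigma>\<^sup>2 * (inner_on S (resA k) (resA k) + inner_on T (resN k) (resN k))"
  "0 \<le> \<tau> * \<sigma>\<^sup>2 / 2 * inner_on S (dq k) (dq k)"
  using \<tau> by simp_all

lemma sum_defect_cost_le: "(\<Sum>k<m. defect_cost k) \<le> suminf defect_cost"
  by (rule sum_le_suminf[OF summable_defect_cost]) (auto simp: defect_cost_nonneg)

lemma lyap_sum:
  assumes f: "feasible \<phi>' z' q' \<alpha>' \<beta>'"
  shows "lyap q' \<alpha>' \<beta>' m + 2 * \<tau> * \<sigma> * (\<Sum>k<m. inner_on T (z (Suc k)) \<beta>' + inner_on T z' (\<beta>_pred k))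
    \<le> lyap q' \<alpha>' \<beta>' 0 + suminf defect_cost + 2 * \<tau> * \<sigma> * inner_on T z' \<beta>' * real m"
proof -
  have "lyap q' \<alpha>' \<beta>' m + 2 * \<tau> * \<sigma> * (\<Sum>k<m. inner_on T (z (Suc k)) \<beta>' + inner_on T z' (\<beta>_pred k))
    \<le> lyap q' \<alpha>' \<beta>' 0 + (\<Sum>k<m. defect_cost k) + 2 * \<tau> * \<sigma> * inner_on T z' \<beta>' * real m"
  proof (induction m)
    case (Suc m)
    with lyap_step[OF f, of m] dissipation_nonneg[of m] show ?case
      by (simp add: algebra_simps)
  qed simp
  with sum_defect_cost_le[of m] show ?thesis by simp
qed

lemma coord_le_lyap:
  shows "i \<in> S \<Longrightarrow> (\<alpha> k i - \<alpha>' i)\<^sup>2 \<le> lyap q' \<alpha>' \<beta>' k"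
    and "i \<in> S \<Longrightarrow> (q k i - q' i)\<^sup>2 \<le> lyap q' \<alpha>' \<beta>' k / (\<tau> * \<sigma>\<^sup>2)"
    and "p \<in> T \<Longrightarrow> (\<beta> k p - \<beta>' p)\<^sup>2 \<le> lyap q' \<alpha>' \<beta>' k"
proof -
  have pos: "\<tau> * \<sigma>\<^sup>2 > 0" using \<tau> \<sigma> by simp
  have *: "0 \<le> inner_on S (\<alpha> k - \<alpha>') (\<alpha> k - \<alpha>')" "0 \<le> inner_on T (\<beta> k - \<beta>') (\<beta> k - \<beta>')"
    "0 \<le> \<tau> * \<sigma>\<^sup>2 * inner_on S (q k - q') (q k - q')"
    "0 \<le> \<tau> * \<sigma>\<^sup>2 * inner_on T (N (q k - q')) (N (q k - q'))"
    using mult_nonneg_nonneg[OF less_imp_le[OF pos] inner_on_nonneg] by (simp_all only: inner_on_nonneg)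
  show "i \<in> S \<Longrightarrow> (\<alpha> k i - \<alpha>' i)\<^sup>2 \<le> lyap q' \<alpha>' \<beta>' k"
    using * coord_sq_le_inner_on[OF finite_index(2), of i "\<alpha> k - \<alpha>'"]
    unfolding lyap_def distrib_left minus_apply by linarith
  show "p \<in> T \<Longrightarrow> (\<beta> k p - \<beta>' p)\<^sup>2 \<le> lyap q' \<alpha>' \<beta>' k"
    using * coord_sq_le_inner_on[OF finite_index(3), of p "\<beta> k - \<beta>'"]
    unfolding lyap_def distrib_left minus_apply by linarith
  assume i: "i \<in> S"
  have "(q k i - q' i)\<^sup>2 \<le> inner_on S (q k - q') (q k - q')"
    using coord_sq_le_inner_on[OF finite_index(2) i, of "q k - q'"] by simp
  also have "\<dots> \<le> lyap q' \<alpha>' \<beta>' k / (\<tau> * \<sigma>\<^sup>2)"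
    unfolding pos_le_divide_eq[OF pos] using *
    unfolding lyap_def distrib_left mult.commute[of _ "\<tau> * \<sigma>\<^sup>2"] by linarith
  finally show "(q k i - q' i)\<^sup>2 \<le> lyap q' \<alpha>' \<beta>' k / (\<tau> * \<sigma>\<^sup>2)" .
qed

section \<open>Existence of a saddle point\<close>

text \<open>
  By \<open>lyap_sum\<close> the energy grows at most linearly, whatever the gap of the reference point is.
\<close>

lemma increments_average_out:
  assumes f: "feasible \<phi>' z' q' \<alpha>' \<beta>'"
  shows "converges_on S (avg (\<lambda>k. \<alpha> (Suc k) - \<alpha> k)) 0"
    and "converges_on S (avg dq) 0"
    and "converges_on T (avg (\<lambda>k. \<beta> (Suc k) - \<beta> k)) 0"
proof -
  define C where "C = lyap q' \<alpha>' \<beta>' 0 + suminf defect_cost + 2 * \<tau> * \<sigma> * inner_on T z' \<beta>'"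
  have L: "lyap q' \<alpha>' \<beta>' m \<le> C * real (Suc m)" for m
  proof -
    have g: "0 \<le> inner_on T x y" if "x \<in> Q" "y \<in> Q" for x y using Q_pairing that by blast
    have zb: "z' \<in> Q" "\<beta>' \<in> Q" using f by (auto simp: feasible_def)
    have s: "0 \<le> 2 * \<tau> * \<sigma> * (\<Sum>k<m. inner_on T (z (Suc k)) \<beta>' + inner_on T z' (\<beta>_pred k))"
      using \<tau> \<sigma> opt_z(1) z_in zb unfolding \<beta>_pred_def
      by (intro mult_nonneg_nonneg sum_nonneg add_nonneg_nonneg g) auto
    have n: "0 \<le> lyap q' \<alpha>' \<beta>' 0 + suminf defect_cost" "0 \<le> 2 * \<tau> * \<sigma> * inner_on T z' \<beta>'"
      using \<tau> \<sigma> g[OF zb] lyap_nonneg suminf_nonneg[OF summable_defect_cost defect_cost_nonneg] by auto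
    then have "0 \<le> (lyap q' \<alpha>' \<beta>' 0 + suminf defect_cost) * real m" by simp
    then show ?thesis using lyap_sum[OF f, of m] s n unfolding C_def by (simp add: algebra_simps)
  qed
  have pos: "\<tau> * \<sigma>\<^sup>2 > 0" using \<tau> \<sigma> by simp
  have main: "converges_on I (avg (\<lambda>k. x (Suc k) - x k)) 0"
    if "finite I" "\<And>i k. i \<in> I \<Longrightarrow> (x k i - x' i)\<^sup>2 \<le> D * real (Suc k)"
    for I :: "'i set" and x :: "nat \<Rightarrow> 'i \<Rightarrow> real" and x' D
    unfolding converges_on_iff[OF that(1)] avg_telescope
  proof
    fix i assume "i \<in> I"
    then show "(\<lambda>k. ((1 / real (Suc k)) \<odot> (x (Suc k) - x 0)) i) \<longlonglongrightarrow> (0 :: 'i \<Rightarrow> real) i"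
      using increment_average_tendsto_0[of "\<lambda>k. x k i" "x' i" D, OF that(2)] by simp
  qed
  show "converges_on S (avg (\<lambda>k. \<alpha> (Suc k) - \<alpha> k)) 0"
    by (rule main[OF finite_index(2)]) (rule order_trans[OF coord_le_lyap(1) L])
  show "converges_on T (avg (\<lambda>k. \<beta> (Suc k) - \<beta> k)) 0"
    by (rule main[OF finite_index(3)]) (rule order_trans[OF coord_le_lyap(3) L])
  have "(q k i - q' i)\<^sup>2 \<le> (C / (\<tau> * \<sigma>\<^sup>2)) * real (Suc k)" if "i \<in> S" for i k
  proof -
    have "(q k i - q' i)\<^sup>2 \<le> lyap q' \<alpha>' \<beta>' k / (\<tau> * \<sigma>\<^sup>2)" by (rule coord_le_lyap(2)[OF that])
    also have "\<dots> \<le> C * real (Suc k) / (\<tau> * \<sigma>\<^sup>2)" using L pos by (intro divide_right_mono) auto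
    finally show ?thesis by simp
  qed
  from main[OF finite_index(2) this] show "converges_on S (avg dq) 0"
    unfolding dq_def[abs_def] .
qed

text \<open>
  For a strictly feasible reference the two pairings in \<open>lyap_sum\<close> dominate the coordinates of
  \<open>z\<close> and of the predicted \<open>\<beta>\<close>.
\<close>

lemma avg_bounded:
  assumes f: "feasible \<phi>' z' q' \<alpha>' \<beta>'" and int: "interior_pt z'" "interior_pt \<beta>'" and p: "p \<in> T"
  shows "bounded (range (\<lambda>m. avg (\<lambda>k. z (Suc k)) m p))" and "bounded (range (\<lambda>m. avg \<beta>_pred m p))"
proof -
  have zb: "z' \<in> Q" "\<beta>' \<in> Q" using f by (auto simp: feasible_def)
  have in_Q: "z (Suc k) \<in> Q" "\<beta>_pred k \<in> Q" for k
    using z_in opt_z(1) by (auto simp: \<beta>_pred_def)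
  define g where "g k = inner_on T (z (Suc k)) \<beta>' + inner_on T z' (\<beta>_pred k)" for k
  define C where "C = (lyap q' \<alpha>' \<beta>' 0 + suminf defect_cost + 2 * \<tau> * \<sigma> * inner_on T z' \<beta>') / (2 * \<tau> * \<sigma>)"
  have ts: "2 * \<tau> * \<sigma> > 0" using \<tau> \<sigma> by simp
  have g_sum: "(\<Sum>k<Suc m. g k) \<le> C * real (Suc m)" for m
  proof -
    have "0 \<le> lyap q' \<alpha>' \<beta>' 0 + suminf defect_cost"
      using lyap_nonneg suminf_nonneg[OF summable_defect_cost defect_cost_nonneg] by auto
    then have "0 \<le> (lyap q' \<alpha>' \<beta>' 0 + suminf defect_cost) * real m" by simp
    then have "(2 * \<tau> * \<sigma>) * (\<Sum>k<Suc m. g k)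
        \<le> (lyap q' \<alpha>' \<beta>' 0 + suminf defect_cost + 2 * \<tau> * \<sigma> * inner_on T z' \<beta>') * real (Suc m)"
      using lyap_sum[OF f, of "Suc m"] lyap_nonneg[of q' \<alpha>' \<beta>' "Suc m"]
      unfolding g_def[symmetric] by (simp add: algebra_simps del: sum.lessThan_Suc)
    then show ?thesis
      unfolding C_def using ts by (simp add: field_simps del: sum.lessThan_Suc)
  qed
  have *: "bounded (range (\<lambda>m. avg x m p))"
    if K: "K \<ge> 0" "\<And>k. \<bar>x k p\<bar> \<le> K * g k" for K and x :: "nat \<Rightarrow> 't \<Rightarrow> real"
  proof (rule bounded_avg[where B = "\<lambda>k. K * g k" and C = "K * C"])
    show "\<bar>x k p\<bar> \<le> K * g k" for k by (rule K)
    show "(\<Sum>k<Suc m. K * g k) \<le> K * C * real (Suc m)" for m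
      using mult_left_mono[OF g_sum K(1), of m]
      by (simp add: sum_distrib_left mult.assoc del: sum.lessThan_Suc)
  qed
  obtain K where K: "K \<ge> 0" "\<And>x. x \<in> Q \<Longrightarrow> \<bar>x p\<bar> \<le> K * inner_on T x \<beta>'"
    using int(2) p by (auto simp: interior_pt_def inner_on_commute)
  obtain L where L: "L \<ge> 0" "\<And>x. x \<in> Q \<Longrightarrow> \<bar>x p\<bar> \<le> L * inner_on T z' x"
    using int(1) p by (auto simp: interior_pt_def inner_on_commute)
  show "bounded (range (\<lambda>m. avg (\<lambda>k. z (Suc k)) m p))"
  proof (rule *[OF K(1)])
    fix k
    have "K * inner_on T (z (Suc k)) \<beta>' \<le> K * g k"
      using K(1) Q_pairing[OF zb(1) in_Q(2)[of k]] by (intro mult_left_mono) (auto simp: g_def)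
    then show "\<bar>z (Suc k) p\<bar> \<le> K * g k" using K(2)[OF in_Q(1)[of k]] by linarith
  qed
  show "bounded (range (\<lambda>m. avg \<beta>_pred m p))"
  proof (rule *[OF L(1)])
    fix k
    have "L * inner_on T z' (\<beta>_pred k) \<le> L * g k"
      using L(1) Q_pairing[OF in_Q(1)[of k] zb(2)] by (intro mult_left_mono) (auto simp: g_def)
    then show "\<bar>\<beta>_pred k p\<bar> \<le> L * g k" using L(2)[OF in_Q(2)[of k]] by linarith
  qed
qed

lemma \<beta>_pred_in: "\<beta>_pred k \<in> Q"
  using opt_z(1) by (simp add: \<beta>_pred_def)

text \<open>
  The averages of the iterates are asymptotically feasible because the averaged residuals are
  multiples of averaged increments of the multipliers. Complementarity cannot be averaged, but the balance summed with the limit point itself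
  as the reference gives, after division by the number of steps,
  \<open>2 \<langle>z', \<beta>'\<rangle> \<le> \<langle>z', \<beta>'\<rangle>\<close>, so the gap vanishes.
\<close>

lemma saddle_point_exists:
  assumes f: "feasible \<phi>0 z0 q0 \<alpha>0 \<beta>0" and int: "interior_pt z0" "interior_pt \<beta>0"
  obtains \<phi>' z' q' \<alpha>' \<beta>' where "feasible \<phi>' z' q' \<alpha>' \<beta>'" "inner_on T z' \<beta>' = 0"
proof -
  note fin = finite_index
  define zm where "zm = avg (\<lambda>k. z (Suc k))"
  define bm where "bm = avg \<beta>_pred"
  define qm where "qm = avg (\<lambda>k. q (Suc k))"
  define \<phi>m where "\<phi>m = avg (\<lambda>k. \<phi> (Suc k))"
  define am where "am = avg \<alpha>_pred"
  note avgs = zm_def bm_def qm_def \<phi>m_def am_def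
  have b: "bounded (range (\<lambda>m. zm m p))" "bounded (range (\<lambda>m. bm m p))" if "p \<in> T" for p
    using avg_bounded[OF f int that] by (auto simp: avgs)
  obtain r1 z' where r1: "strict_mono r1" "z' \<in> rvec T" "converges_on T (\<lambda>k. zm (r1 k)) z'"
    by (rule bounded_subseq_on[OF fin(3) b(1)])
  have b2: "bounded (range (\<lambda>k. bm (r1 k) p))" if "p \<in> T" for p
    using b(2)[OF that] by (auto intro: bounded_subset)
  obtain r2 \<beta>' where r2: "strict_mono r2" "\<beta>' \<in> rvec T" "converges_on T (\<lambda>k. bm (r1 (r2 k))) \<beta>'"
    by (rule bounded_subseq_on[OF fin(3) b2])
  define r where "r = (\<lambda>k. r1 (r2 k))"
  have r: "strict_mono r" using r1(1) r2(1) by (auto simp: r_def strict_mono_def)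
  have zlim: "converges_on T (\<lambda>k. zm (r k)) z'"
    using converges_on_subseq[OF fin(3) r1(3) r2(1)] by (simp add: r_def)
  have blim: "converges_on T (\<lambda>k. bm (r k)) \<beta>'"
    using r2(3) by (simp add: r_def)
  have z'Q: "z' \<in> Q"
    using Q_avg[of "\<lambda>k. z (Suc k)"] z_in by (intro Q_closed[OF _ zlim r1(2)]) (auto simp: zm_def)
  have \<beta>'Q: "\<beta>' \<in> Q"
    using Q_avg[of \<beta>_pred] \<beta>_pred_in by (intro Q_closed[OF _ blim r2(2)]) (auto simp: bm_def)
  note inc = increments_average_out[OF f]
  have resA_avg: "converges_on S (avg resA) 0" and resN_avg: "converges_on T (avg resN) 0"
  proof -
    have inv: "(1 / (\<tau> * \<sigma>)) \<odot> (x + (\<tau> * \<sigma>) \<odot> y - x) = y" for x y :: "'i \<Rightarrow> real"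
      using \<tau> \<sigma> by (simp add: fun_eq_iff)
    have "resA = (\<lambda>k. (1 / (\<tau> * \<sigma>)) \<odot> (\<alpha> (Suc k) - \<alpha> k))"
      "resN = (\<lambda>k. (1 / (\<tau> * \<sigma>)) \<odot> (\<beta> (Suc k) - \<beta> k))"
      unfolding update_\<alpha> update_\<beta> inv resA_def[abs_def] resN_def[abs_def] by (rule refl)+
    then have "avg resA = (\<lambda>m. (1 / (\<tau> * \<sigma>)) \<odot> avg (\<lambda>k. \<alpha> (Suc k) - \<alpha> k) m)"
      "avg resN = (\<lambda>m. (1 / (\<tau> * \<sigma>)) \<odot> avg (\<lambda>k. \<beta> (Suc k) - \<beta> k) m)"
      by (simp_all only: avg_scl[abs_def])
    then show "converges_on S (avg resA) 0" "converges_on T (avg resN) 0"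
      using converges_on_scl[OF fin(2) inc(1)] converges_on_scl[OF fin(3) inc(3)] by simp_all
  qed
  note resA_lim = converges_on_subseq[OF fin(2) resA_avg r]
    and resN_lim = converges_on_subseq[OF fin(3) resN_avg r]
    and dq_lim = converges_on_subseq[OF fin(2) inc(2) r]
  have qm_in: "qm m \<in> rvec S" for m
    unfolding qm_def by (rule avg_in_rvec) (rule q_in)
  have Nq: "N (qm m) = zm m - avg resN m - d" for m
  proof -
    have "avg resN m = zm m - avg (\<lambda>k. N (q (Suc k))) m - d"
      by (simp only: resN_def[abs_def] avg_diff avg_const zm_def)
    then show ?thesis by (simp add: qm_def lin_avg[OF lin_ops(3)])
  qed
  have "converges_on T (\<lambda>k. N (qm (r k))) (z' - d)"
    using converges_on_diff[OF fin(3) converges_on_diff[OF fin(3) zlim resN_lim] converges_on_const[OF fin(3), of d]]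
    by (simp add: Nq)
  note Nq_lim = this
  have zd: "z' - d \<in> rvec T" using r1(2) d_in_rvec by (auto intro!: rvec_closed)
  obtain q' where q': "q' \<in> rvec S" "converges_on S (\<lambda>k. qm (r k)) q'" "N q' = z' - d"
    by (rule converges_S_of_image[OF qm_in zd Nq_lim])
  have A\<phi>: "A (\<phi>m m) = avg resA m + qm m" for m
  proof -
    have "avg resA m = avg (\<lambda>k. A (\<phi> (Suc k))) m - qm m"
      by (simp only: resA_def[abs_def] avg_diff qm_def)
    then show ?thesis by (simp add: \<phi>m_def lin_avg[OF lin_ops(1)])
  qed
  have \<phi>m_in: "\<phi>m m \<in> V" for m
    unfolding \<phi>m_def by (rule V_avg) (rule \<phi>_in)
  have A_lim: "converges_on S (\<lambda>k. A (\<phi>m (r k))) q'"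
    using converges_on_add[OF fin(2) resA_lim q'(2)] by (simp add: A\<phi>)
  obtain \<phi>' where \<phi>': "\<phi>' \<in> V" "A \<phi>' = q'"
    by (rule converges_V_of_image[OF \<phi>m_in q'(1) A_lim])
  define \<alpha>' where "\<alpha>' = - Nt \<beta>'"
  have am: "am m = - Nt (bm m) + \<sigma> \<odot> (avg dq m + Nt (N (avg dq m)))" for m
  proof -
    have "\<alpha>_pred k = - Nt (\<beta>_pred k) + \<sigma> \<odot> (dq k + Nt (N (dq k)))" for k
    proof -
      have "(\<alpha> k + \<sigma> \<odot> resA k) + Nt (\<beta> k + \<sigma> \<odot> resN k) = 0"
        using opt_q[of k] by (simp add: resA_def resN_def)
      moreover have "\<alpha>_pred k + Nt (\<beta>_pred k)
          = ((\<alpha> k + \<sigma> \<odot> resA k) + Nt (\<beta> k + \<sigma> \<odot> resN k)) + \<sigma> \<odot> (dq k + Nt (N (dq k)))"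
        by (auto simp: \<alpha>_pred_eq \<beta>_pred_eq lin_add[OF lin_ops(4)] lin_scl[OF lin_ops(4)] fun_eq_iff algebra_simps)
      ultimately have "\<alpha>_pred k + Nt (\<beta>_pred k) = \<sigma> \<odot> (dq k + Nt (N (dq k)))" by simp
      then show ?thesis by (simp add: eq_diff_eq[symmetric])
    qed
    then have "\<alpha>_pred = (\<lambda>k. - Nt (\<beta>_pred k) + \<sigma> \<odot> (dq k + Nt (N (dq k))))" by blast
    then have "am m = avg (\<lambda>k. - Nt (\<beta>_pred k) + \<sigma> \<odot> (dq k + Nt (N (dq k)))) m"
      by (simp only: am_def)
    also have "\<dots> = - Nt (bm m) + \<sigma> \<odot> (avg dq m + Nt (N (avg dq m)))"
      by (simp only: avg_add avg_uminus avg_scl bm_def lin_avg[OF lin_ops(4)] lin_avg[OF lin_ops(3)])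
    finally show ?thesis .
  qed
  have \<alpha>'S: "\<alpha>' \<in> rvec S" using ops_in_rvec(3) by (auto simp: \<alpha>'_def intro!: rvec_closed)
  have "converges_on S (\<lambda>k. am (r k)) \<alpha>'"
  proof -
    have Ntlim: "converges_on S (\<lambda>k. Nt (x k)) (Nt l)"
      if "\<And>k. x k \<in> rvec T" "l \<in> rvec T" "converges_on T x l" for x l
      using that by (intro converges_on_lin[OF lin_ops(4) fin(3,2)])
    have Nlim: "converges_on T (\<lambda>k. N (x k)) (N l)"
      if "\<And>k. x k \<in> rvec S" "l \<in> rvec S" "converges_on S x l" for x l
      using that by (intro converges_on_lin[OF lin_ops(3) fin(2,3)])
    have dqS: "avg dq m \<in> rvec S" for m by (rule avg_in_rvec) (rule diff_in_rvec)
    have bmT: "bm m \<in> rvec T" for m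
      unfolding bm_def by (rule avg_in_rvec) (rule Q_in_rvec[OF \<beta>_pred_in])
    have "converges_on S (\<lambda>k. Nt (N (avg dq (r k)))) (Nt (N 0))"
      using dqS dq_lim ops_in_rvec by (intro Ntlim Nlim) auto
    then have "converges_on S (\<lambda>k. \<sigma> \<odot> (avg dq (r k) + Nt (N (avg dq (r k))))) (\<sigma> \<odot> (0 + Nt (N 0)))"
      by (intro converges_on_scl converges_on_add fin dq_lim)
    moreover have "converges_on S (\<lambda>k. - 1 \<odot> Nt (bm (r k))) (- 1 \<odot> Nt \<beta>')"
      using bmT r2(2) blim by (intro converges_on_scl Ntlim fin) auto
    ultimately have "converges_on S (\<lambda>k. - 1 \<odot> Nt (bm (r k)) + \<sigma> \<odot> (avg dq (r k) + Nt (N (avg dq (r k)))))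
        (- 1 \<odot> Nt \<beta>' + \<sigma> \<odot> (0 + Nt (N 0)))"
      by (intro converges_on_add fin)
    then show ?thesis
      by (simp add: am \<alpha>'_def uminus_eq_scl lin_0[OF lin_ops(3)] lin_0[OF lin_ops(4)])
  qed
  moreover have "am m \<in> rvec S" for m
    unfolding am_def \<alpha>_pred_def using \<alpha>_in q_in ops_in_rvec by (intro avg_in_rvec rvec_closed) auto
  ultimately have "converges_on P (\<lambda>k. At (am (r k))) (At \<alpha>')"
    using \<alpha>'S by (intro converges_on_lin[OF lin_ops(2) fin(2,1)])
  moreover have "At (am m) = - c" for m
    by (simp add: am_def lin_avg[OF lin_ops(2)] \<alpha>_pred_def opt_\<phi> avg_const)
  ultimately have "converges_on P (\<lambda>k. - c) (At \<alpha>')" by simp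
  then have At: "At \<alpha>' = - c"
    using At_in_rvec c_in_rvec by (intro converges_on_unique[OF fin(1) _ converges_on_const[OF fin(1)]]) auto
  have feas: "feasible \<phi>' z' q' \<alpha>' \<beta>'"
    using \<phi>' z'Q \<beta>'Q q' \<alpha>'S At by (simp add: feasible_def \<alpha>'_def)
  moreover have "inner_on T z' \<beta>' = 0"
  proof (rule antisym)
    define C where "C = (lyap q' \<alpha>' \<beta>' 0 + suminf defect_cost) / (2 * \<tau> * \<sigma>)"
    have ts: "2 * \<tau> * \<sigma> > 0" using \<tau> \<sigma> by simp
    then have tsC: "(2 * \<tau> * \<sigma>) * C = lyap q' \<alpha>' \<beta>' 0 + suminf defect_cost"
      unfolding C_def by (metis less_irrefl nonzero_eq_divide_eq mult.commute)
    have "inner_on T (zm m) \<beta>' + inner_on T z' (bm m) \<le> inner_on T z' \<beta>' + C / real (Suc m)" for m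
    proof -
      have "(2 * \<tau> * \<sigma>) * (\<Sum>k<Suc m. inner_on T (z (Suc k)) \<beta>' + inner_on T z' (\<beta>_pred k))
          \<le> (2 * \<tau> * \<sigma>) * (C + inner_on T z' \<beta>' * real (Suc m))"
        using lyap_sum[OF feas, of "Suc m"] lyap_nonneg[of q' \<alpha>' \<beta>' "Suc m"] tsC
        unfolding distrib_left by (simp add: mult.assoc del: sum.lessThan_Suc of_nat_Suc)
      then have "(\<Sum>k<Suc m. inner_on T (z (Suc k)) \<beta>' + inner_on T z' (\<beta>_pred k))
          \<le> C + inner_on T z' \<beta>' * real (Suc m)"
        by (rule mult_left_le_imp_le[OF _ ts])
      then have "(\<Sum>k<Suc m. inner_on T (z (Suc k)) \<beta>' + inner_on T z' (\<beta>_pred k)) / real (Suc m)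
          \<le> (C + inner_on T z' \<beta>' * real (Suc m)) / real (Suc m)"
        by (rule divide_right_mono) simp
      then show ?thesis
        unfolding zm_def bm_def inner_avg inner_on_commute[of T z' "avg \<beta>_pred m"]
        by (simp add: sum.distrib add_divide_distrib inner_on_commute[of T z'] del: sum.lessThan_Suc of_nat_Suc)
    qed
    then have le: "inner_on T (zm (r k)) \<beta>' + inner_on T z' (bm (r k))
        \<le> inner_on T z' \<beta>' + C / real (Suc (r k))" for k .
    have "(\<lambda>m. C / real (Suc m)) \<longlonglongrightarrow> 0"
      using tendsto_mult_right_zero[OF LIMSEQ_inverse_real_of_nat, of C] by (simp add: divide_inverse)
    then have "(\<lambda>k. C / real (Suc (r k))) \<longlonglongrightarrow> 0"
      using r LIMSEQ_subseq_LIMSEQ[of "\<lambda>m. C / real (Suc m)" 0 r] by (simp add: o_def)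
    then have rhs: "(\<lambda>k. inner_on T z' \<beta>' + C / real (Suc (r k))) \<longlonglongrightarrow> inner_on T z' \<beta>' + 0"
      by (intro tendsto_intros)
    have lhs: "(\<lambda>k. inner_on T (zm (r k)) \<beta>' + inner_on T z' (bm (r k)))
        \<longlonglongrightarrow> inner_on T z' \<beta>' + inner_on T z' \<beta>'"
      by (intro tendsto_add converges_on_inner fin zlim blim converges_on_const)
    have "inner_on T z' \<beta>' + inner_on T z' \<beta>' \<le> inner_on T z' \<beta>' + 0"
      by (rule LIMSEQ_le[OF lhs rhs]) (use le in auto)
    then show "inner_on T z' \<beta>' \<le> 0" by simp
    show "0 \<le> inner_on T z' \<beta>'" using Q_pairing z'Q \<beta>'Q by blast
  qed
  ultimately show thesis by (rule that)
qed

section \<open>Convergence to a saddle point\<close>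

lemma saddle_step:
  assumes f: "feasible \<phi>' z' q' \<alpha>' \<beta>'" and c: "inner_on T z' \<beta>' = 0"
  shows "lyap q' \<alpha>' \<beta>' (Suc k) + \<tau> * (2 - \<tau>) * \<sigma>\<^sup>2 * (inner_on S (resA k) (resA k) + inner_on T (resN k) (resN k))
      + \<tau> * \<sigma>\<^sup>2 / 2 * inner_on S (dq k) (dq k) \<le> lyap q' \<alpha>' \<beta>' k + defect_cost k"
proof -
  have "z' \<in> Q" "\<beta>' \<in> Q" using f by (auto simp: feasible_def)
  then have "0 \<le> inner_on T (z (Suc k)) \<beta>' + inner_on T z' (\<beta>_pred k)"
    by (intro add_nonneg_nonneg Q_pairing z_in \<beta>_pred_in)
  then have "0 \<le> 2 * \<tau> * \<sigma> * (inner_on T (z (Suc k)) \<beta>' + inner_on T z' (\<beta>_pred k))"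
    using \<tau> \<sigma> by (intro mult_nonneg_nonneg) auto
  with lyap_step[OF f, of k, unfolded c] show ?thesis by linarith
qed

text \<open>
  A sequence that decreases up to summable errors converges: subtracting the partial sums of the
  errors makes it monotone.
\<close>

lemma lyap_convergent:
  assumes f: "feasible \<phi>' z' q' \<alpha>' \<beta>'" and c: "inner_on T z' \<beta>' = 0"
  shows "convergent (lyap q' \<alpha>' \<beta>')"
proof -
  define U where "U k = lyap q' \<alpha>' \<beta>' k - (\<Sum>j<k. defect_cost j)" for k
  have "decseq U"
  proof (rule decseq_SucI)
    fix k show "U (Suc k) \<le> U k"
      using saddle_step[OF assms, of k] dissipation_nonneg[of k] unfolding U_def sum.lessThan_Suc by linarith
  qed
  moreover have "- suminf defect_cost \<le> U k" for k
    using lyap_nonneg[of q' \<alpha>' \<beta>' k] sum_defect_cost_le[of k] by (simp add: U_def)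
  ultimately obtain l where "U \<longlonglongrightarrow> l"
    using decseq_convergent[of U "- suminf defect_cost"] by blast
  then have "(\<lambda>k. U k + (\<Sum>j<k. defect_cost j)) \<longlonglongrightarrow> l + suminf defect_cost"
    by (intro tendsto_add summable_LIMSEQ summable_defect_cost)
  then show ?thesis by (auto simp: U_def convergent_def)
qed

lemma residuals_vanish:
  assumes f: "feasible \<phi>' z' q' \<alpha>' \<beta>'" and c: "inner_on T z' \<beta>' = 0"
  shows "converges_on S resA 0" "converges_on T resN 0" "converges_on S dq 0"
proof -
  define k1 where "k1 = \<tau> * (2 - \<tau>) * \<sigma>\<^sup>2"
  define k2 where "k2 = \<tau> * \<sigma>\<^sup>2 / 2"
  have pos: "k1 > 0" "k2 > 0" using \<tau> \<sigma> by (auto simp: k1_def k2_def)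
  define D where "D k = lyap q' \<alpha>' \<beta>' k - lyap q' \<alpha>' \<beta>' (Suc k) + defect_cost k" for k
  obtain l where "lyap q' \<alpha>' \<beta>' \<longlonglongrightarrow> l"
    using lyap_convergent[OF assms] by (auto simp: convergent_def)
  then have "D \<longlonglongrightarrow> l - l + 0"
    unfolding D_def[abs_def]
    by (intro tendsto_add tendsto_diff summable_LIMSEQ_zero summable_defect_cost LIMSEQ_Suc)
  then have D: "D \<longlonglongrightarrow> 0" by simp
  have step: "k1 * (inner_on S (resA k) (resA k) + inner_on T (resN k) (resN k)) + k2 * inner_on S (dq k) (dq k) \<le> D k" for k
    using saddle_step[OF assms, of k] by (simp add: D_def k1_def k2_def)
  have lim: "x \<longlonglongrightarrow> 0" if "a > 0" "\<And>k. 0 \<le> x k" "\<And>k. a * x k \<le> D k" for a and x :: "nat \<Rightarrow> real"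
  proof (rule tendsto_sandwich[OF _ _ tendsto_const])
    show "(\<lambda>k. D k / a) \<longlonglongrightarrow> 0" using tendsto_divide[OF D tendsto_const[of a]] that(1) by simp
    show "\<forall>\<^sub>F k in sequentially. x k \<le> D k / a"
      using that by (simp add: pos_le_divide_eq mult.commute)
  qed (use that in simp)
  have nn: "0 \<le> k1 * inner_on S (resA k) (resA k)" "0 \<le> k1 * inner_on T (resN k) (resN k)"
    "0 \<le> k2 * inner_on S (dq k) (dq k)" for k
    using pos mult_nonneg_nonneg[OF less_imp_le inner_on_nonneg] by metis+
  have bounds: "k1 * inner_on S (resA k) (resA k) \<le> D k" "k1 * inner_on T (resN k) (resN k) \<le> D k"
    "k2 * inner_on S (dq k) (dq k) \<le> D k" for k
    using step[of k] nn[of k] unfolding distrib_left by linarith+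
  show "converges_on S resA 0" "converges_on T resN 0" "converges_on S dq 0"
    by (rule converges_on_0I[OF _ lim[OF pos(1) inner_on_nonneg bounds(1)]]
        converges_on_0I[OF _ lim[OF pos(1) inner_on_nonneg bounds(2)]]
        converges_on_0I[OF _ lim[OF pos(2) inner_on_nonneg bounds(3)]], rule finite_index)+
qed

text \<open>
  A saddle point is first used to bound the iterates; then a cluster point is seen to be a
  saddle point itself and replaces it as the reference.
\<close>

theorem converges_to_saddle_point:
  assumes f0: "feasible \<phi>0 z0 q0 \<alpha>0 \<beta>0" and int: "interior_pt z0" "interior_pt \<beta>0"
  obtains \<phi>' z' q' \<alpha>' \<beta>' where "feasible \<phi>' z' q' \<alpha>' \<beta>'" "inner_on T z' \<beta>' = 0"
    "converges_on P \<phi> \<phi>'" "converges_on T z z'" "converges_on S q q'"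
    "converges_on S \<alpha> \<alpha>'" "converges_on T \<beta> \<beta>'"
proof -
  note fin = finite_index
  obtain \<phi>1 z1 q1 \<alpha>1 \<beta>1 where s1: "feasible \<phi>1 z1 q1 \<alpha>1 \<beta>1" "inner_on T z1 \<beta>1 = 0"
    by (rule saddle_point_exists[OF f0 int])
  note res = residuals_vanish[OF s1]
  define C where "C = lyap q1 \<alpha>1 \<beta>1 0 + suminf defect_cost"
  have L: "lyap q1 \<alpha>1 \<beta>1 m \<le> C" for m
  proof (induction m)
    case 0
    show ?case using suminf_nonneg[OF summable_defect_cost defect_cost_nonneg] by (simp add: C_def)
  next
    case (Suc m)
    have "0 \<le> (\<Sum>k<Suc m. inner_on T (z (Suc k)) \<beta>1 + inner_on T z1 (\<beta>_pred k))"
      using s1(1) by (intro sum_nonneg add_nonneg_nonneg Q_pairing z_in \<beta>_pred_in) (auto simp: feasible_def)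
    then have "0 \<le> 2 * \<tau> * \<sigma> * (\<Sum>k<Suc m. inner_on T (z (Suc k)) \<beta>1 + inner_on T z1 (\<beta>_pred k))"
      using \<tau> \<sigma> by (intro mult_nonneg_nonneg) auto
    then show ?case using lyap_sum[OF s1(1), of "Suc m", unfolded s1(2)] unfolding C_def by linarith
  qed
  have ts: "\<tau> * \<sigma>\<^sup>2 > 0" using \<tau> \<sigma> by simp
  have b\<alpha>: "bounded (range (\<lambda>k. \<alpha> k i))" if "i \<in> S" for i
    by (rule bounded_of_sq_diff[OF order_trans[OF coord_le_lyap(1)[OF that] L]])
  have b\<beta>: "bounded (range (\<lambda>k. \<beta> k i))" if "i \<in> T" for i
    by (rule bounded_of_sq_diff[OF order_trans[OF coord_le_lyap(3)[OF that] L]])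
  have bq: "bounded (range (\<lambda>k. q k i))" if "i \<in> S" for i
    by (rule bounded_of_sq_diff[OF order_trans[OF coord_le_lyap(2)[OF that] divide_right_mono[OF L]]])
      (use ts in simp)
  obtain r1 \<alpha>' where r1: "strict_mono r1" "\<alpha>' \<in> rvec S" "converges_on S (\<lambda>k. \<alpha> (r1 k)) \<alpha>'"
    by (rule bounded_subseq_on[OF fin(2) b\<alpha>])
  have b\<beta>': "bounded (range (\<lambda>k. \<beta> (r1 k) i))" if "i \<in> T" for i
    using b\<beta>[OF that] by (auto intro: bounded_subset)
  obtain r2 \<beta>' where r2: "strict_mono r2" "\<beta>' \<in> rvec T" "converges_on T (\<lambda>k. \<beta> (r1 (r2 k))) \<beta>'"
    by (rule bounded_subseq_on[OF fin(3) b\<beta>'])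
  have bq': "bounded (range (\<lambda>k. q (r1 (r2 k)) i))" if "i \<in> S" for i
    using bq[OF that] by (auto intro: bounded_subset)
  obtain r3 q' where r3: "strict_mono r3" "q' \<in> rvec S" "converges_on S (\<lambda>k. q (r1 (r2 (r3 k)))) q'"
    by (rule bounded_subseq_on[OF fin(2) bq'])
  define r where "r = (\<lambda>k. r1 (r2 (r3 k)))"
  have r: "strict_mono r" using r1(1) r2(1) r3(1) by (auto simp: r_def strict_mono_def)
  have \<alpha>r: "converges_on S (\<lambda>k. \<alpha> (r k)) \<alpha>'"
    using converges_on_subseq[OF fin(2) converges_on_subseq[OF fin(2) r1(3) r2(1)] r3(1)] by (simp add: r_def)
  have \<beta>r: "converges_on T (\<lambda>k. \<beta> (r k)) \<beta>'"
    using converges_on_subseq[OF fin(3) r2(3) r3(1)] by (simp add: r_def)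
  have qr: "converges_on S (\<lambda>k. q (r k)) q'" using r3(3) by (simp add: r_def)
  have Nlim: "converges_on T (\<lambda>k. N (x k)) (N l)"
    if "\<And>k. x k \<in> rvec S" "l \<in> rvec S" "converges_on S x l" for x l
    using that by (intro converges_on_lin[OF lin_ops(3) fin(2,3)])
  have z_eq: "z (Suc k) = resN k + N (q (Suc k)) + d" for k
    by (simp add: resN_def)
  have A_eq: "A (\<phi> (Suc k)) = resA k + q (Suc k)" for k
    by (simp add: resA_def)
  have rar: "converges_on S (\<lambda>k. resA (r k)) 0" and rbr: "converges_on T (\<lambda>k. resN (r k)) 0"
    and dqr: "converges_on S (\<lambda>k. dq (r k)) 0"
    by (rule converges_on_subseq[OF _ _ r], rule fin, rule res)+
  have "converges_on S (\<lambda>k. q (r k) + dq (r k)) (q' + 0)"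
    by (intro converges_on_add fin qr dqr)
  then have qSr: "converges_on S (\<lambda>k. q (Suc (r k))) q'" by (simp add: dq_def)
  define z' where "z' = N q' + d"
  have z'T: "z' \<in> rvec T" using ops_in_rvec d_in_rvec by (auto simp: z'_def intro!: rvec_closed)
  have "converges_on T (\<lambda>k. resN (r k) + N (q (Suc (r k))) + d) (0 + N q' + d)"
    by (intro converges_on_add fin rbr Nlim q_in r3(2) qSr converges_on_const)
  then have zr: "converges_on T (\<lambda>k. z (Suc (r k))) z'"
    by (simp add: z_eq z'_def)
  have z'Q: "z' \<in> Q" by (rule Q_closed[OF z_in zr z'T])
  have "converges_on T (\<lambda>k. \<beta> (r k) + \<sigma> \<odot> resN (r k) + \<sigma> \<odot> N (dq (r k))) (\<beta>' + \<sigma> \<odot> 0 + \<sigma> \<odot> N 0)"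
    by (intro converges_on_add converges_on_scl fin \<beta>r rbr Nlim dqr diff_in_rvec rvec_closed)
  then have \<beta>pr: "converges_on T (\<lambda>k. \<beta>_pred (r k)) \<beta>'"
    by (simp add: \<beta>_pred_eq lin_0[OF lin_ops(3)])
  have \<beta>'Q: "\<beta>' \<in> Q" by (rule Q_closed[OF \<beta>_pred_in \<beta>pr r2(2)])
  have "(\<lambda>k. inner_on T (z (Suc (r k))) (\<beta>_pred (r k))) \<longlonglongrightarrow> inner_on T z' \<beta>'"
    by (intro converges_on_inner fin zr \<beta>pr)
  then have comp: "inner_on T z' \<beta>' = 0"
    using opt_z(2) by (simp add: \<beta>_pred_def[symmetric] LIMSEQ_const_iff)
  have "converges_on S (\<lambda>k. \<alpha> (r k) + \<sigma> \<odot> resA (r k) + \<sigma> \<odot> dq (r k)) (\<alpha>' + \<sigma> \<odot> 0 + \<sigma> \<odot> 0)"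
    by (intro converges_on_add converges_on_scl fin \<alpha>r rar dqr)
  then have \<alpha>pr: "converges_on S (\<lambda>k. \<alpha>_pred (r k)) \<alpha>'" by (simp add: \<alpha>_pred_eq)
  have \<alpha>pS: "\<alpha>_pred k \<in> rvec S" for k
    unfolding \<alpha>_pred_def using \<alpha>_in q_in ops_in_rvec by (intro rvec_closed) auto
  have "converges_on P (\<lambda>k. At (\<alpha>_pred (r k))) (At \<alpha>')"
    using \<alpha>pS \<alpha>pr r1(2) by (intro converges_on_lin[OF lin_ops(2) fin(2,1)])
  then have "converges_on P (\<lambda>k. - c) (At \<alpha>')"
    by (simp add: \<alpha>_pred_def opt_\<phi>)
  then have At: "At \<alpha>' = - c"
    using At_in_rvec c_in_rvec by (intro converges_on_unique[OF fin(1) _ converges_on_const[OF fin(1)]]) auto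
  have "converges_on S (\<lambda>k. (\<alpha> (r k) + \<sigma> \<odot> resA (r k)) + Nt (\<beta> (r k) + \<sigma> \<odot> resN (r k)))
      ((\<alpha>' + \<sigma> \<odot> 0) + Nt (\<beta>' + \<sigma> \<odot> 0))"
    using \<beta>_in diff_in_rvec r2(2)
    by (intro converges_on_add converges_on_scl fin \<alpha>r rar converges_on_lin[OF lin_ops(4) fin(3,2)]
        \<beta>r rbr rvec_closed) auto
  then have "converges_on S (\<lambda>k. 0) (\<alpha>' + Nt \<beta>')"
    using opt_q by (simp add: resA_def resN_def)
  then have stat: "\<alpha>' + Nt \<beta>' = 0"
    using r1(2) ops_in_rvec(3)
    by (intro converges_on_unique[OF fin(2) _ converges_on_const[OF fin(2)]]) (auto intro!: rvec_closed)
  have "converges_on S (\<lambda>k. resA (r k) + q (Suc (r k))) (0 + q')"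
    by (intro converges_on_add fin rar qSr)
  then have Ar: "converges_on S (\<lambda>k. A (\<phi> (Suc (r k)))) q'" by (simp add: A_eq)
  obtain \<phi>' where \<phi>': "\<phi>' \<in> V" "A \<phi>' = q'"
    by (rule converges_V_of_image[OF \<phi>_in r3(2) Ar])
  have feas: "feasible \<phi>' z' q' \<alpha>' \<beta>'"
    using \<phi>' z'Q \<beta>'Q r3(2) r1(2) At stat by (simp add: feasible_def z'_def)
  \<comment> \<open>Now the cluster point is the reference: the limit of the energy is read off along \<open>r\<close>.\<close>
  obtain l where l: "lyap q' \<alpha>' \<beta>' \<longlonglongrightarrow> l"
    using lyap_convergent[OF feas comp] by (auto simp: convergent_def)
  have dif0: "converges_on I (\<lambda>k. x (r k) - y) 0" if "finite I" "converges_on I (\<lambda>k. x (r k)) y"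
    for I :: "'i set" and x :: "nat \<Rightarrow> 'i \<Rightarrow> real" and y
    using converges_on_diff[OF that converges_on_const[OF that(1)], of y] by simp
  have qr0: "converges_on T (\<lambda>k. N (q (r k) - q')) (N 0)"
    using q_in r3(2) by (intro Nlim dif0 fin qr rvec_closed)
  have "(\<lambda>k. lyap q' \<alpha>' \<beta>' (r k)) \<longlonglongrightarrow> inner_on S (0 :: 's \<Rightarrow> real) 0 + inner_on T (0 :: 't \<Rightarrow> real) 0
     + \<tau> * \<sigma>\<^sup>2 * (inner_on S (0 :: 's \<Rightarrow> real) 0 + inner_on T (N 0) (N 0))"
    unfolding lyap_def
    by (intro tendsto_add tendsto_mult tendsto_const converges_on_inner fin dif0 \<alpha>r \<beta>r qr qr0)
  then have "(\<lambda>k. lyap q' \<alpha>' \<beta>' (r k)) \<longlonglongrightarrow> 0" by (simp add: lin_0[OF lin_ops(3)])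
  moreover have "(\<lambda>k. lyap q' \<alpha>' \<beta>' (r k)) \<longlonglongrightarrow> l"
    using LIMSEQ_subseq_LIMSEQ[OF l r] by (simp add: o_def)
  ultimately have "l = 0" using LIMSEQ_unique by blast
  with l have l0: "lyap q' \<alpha>' \<beta>' \<longlonglongrightarrow> 0" by simp
  have conv: "converges_on I x y"
    if "finite I" "b \<longlonglongrightarrow> 0" "\<And>i k. i \<in> I \<Longrightarrow> (x k i - y i)\<^sup>2 \<le> b k"
    for I :: "'i set" and x :: "nat \<Rightarrow> 'i \<Rightarrow> real" and y and b :: "nat \<Rightarrow> real"
    unfolding converges_on_iff[OF that(1)]
  proof
    fix i assume i: "i \<in> I"
    have "(\<lambda>k. (x k i - y i)\<^sup>2) \<longlonglongrightarrow> 0"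
      by (rule tendsto_sandwich[OF _ _ tendsto_const that(2)]) (use that(3)[OF i] in auto)
    then have "(\<lambda>k. sqrt ((x k i - y i)\<^sup>2)) \<longlonglongrightarrow> sqrt 0" by (rule tendsto_real_sqrt)
    then have "(\<lambda>k. \<bar>x k i - y i\<bar>) \<longlonglongrightarrow> 0" by simp
    then have "(\<lambda>k. x k i - y i) \<longlonglongrightarrow> 0" by (rule tendsto_rabs_zero_cancel)
    then show "(\<lambda>k. x k i) \<longlonglongrightarrow> y i" by (simp add: LIM_zero_iff)
  qed
  have \<alpha>lim: "converges_on S \<alpha> \<alpha>'" by (rule conv[OF fin(2) l0 coord_le_lyap(1)])
  have \<beta>lim: "converges_on T \<beta> \<beta>'" by (rule conv[OF fin(3) l0 coord_le_lyap(3)])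
  have "(\<lambda>k. lyap q' \<alpha>' \<beta>' k / (\<tau> * \<sigma>\<^sup>2)) \<longlonglongrightarrow> 0 / (\<tau> * \<sigma>\<^sup>2)"
    by (intro tendsto_divide l0 tendsto_const) (rule less_imp_neq[OF ts, symmetric])
  then have qlim: "converges_on S q q'"
    by (intro conv[OF fin(2) _ coord_le_lyap(2)]) simp_all
  have qlim': "converges_on S (\<lambda>k. q (Suc k)) q'"
    using qlim converges_on_Suc[OF fin(2)] by blast
  have "converges_on T (\<lambda>k. resN k + N (q (Suc k)) + d) (0 + N q' + d)"
    by (intro converges_on_add fin res Nlim q_in r3(2) qlim' converges_on_const)
  then have "converges_on T (\<lambda>k. z (Suc k)) z'" by (simp add: z_eq z'_def)
  then have zlim: "converges_on T z z'" using converges_on_Suc[OF fin(3)] by blast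
  have "converges_on S (\<lambda>k. resA k + q (Suc k)) (0 + q')"
    by (intro converges_on_add fin res qlim')
  then have Alim: "converges_on S (\<lambda>k. A (\<phi> (Suc k))) q'" by (simp add: A_eq)
  obtain \<phi>2 where \<phi>2: "\<phi>2 \<in> V" "converges_on P (\<lambda>k. \<phi> (Suc k)) \<phi>2" "A \<phi>2 = q'"
    by (rule converges_V_of_image[OF \<phi>_in r3(2) Alim])
  have "feasible \<phi>2 z' q' \<alpha>' \<beta>'" using feas \<phi>2 unfolding feasible_def by blast
  moreover have "converges_on P \<phi> \<phi>2" using \<phi>2(2) converges_on_Suc[OF fin(1)] by blast
  ultimately show thesis using that comp zlim qlim \<alpha>lim \<beta>lim by blast
qed

end

section \<open>The staggered grid\<close>

lemma finite_grid [simp]: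
  "finite (Jc m)" "finite (Js m)" "finite (Gc D n)" "finite (Gs D n d)"
  "finite (Iq D n)" "finite (IF D n)" "finite (Iz D n)"
proof -
  show J: "finite (Jc m)" "finite (Js m)" for m
    unfolding Jc_def Js_def by (simp_all add: Setcompr_eq_image)
  show "finite (Gc D n)" "finite (Gs D n d)" for d
    unfolding Gc_def Gs_def by (auto intro!: finite_PiE J)
  then show "finite (Iq D n)" "finite (IF D n)" "finite (Iz D n)"
    by (auto simp: Iq_def IF_def Iz_def)
qed

lemma lin_opA: "lin (opA D n)"
  by (auto simp: lin_def opA_def fun_eq_iff algebra_simps)

lemma lin_opF: "lin (opF D n)"
  by (auto simp: lin_def opF_def Fblock_def fun_eq_iff algebra_simps)

lemma lin_opB: "lin (opB D n)"
  by (auto simp: lin_def opB_def fun_eq_iff algebra_simps)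

lemma ops_in_rvec:
  "opA D n u \<in> rvec (Iq D n)" "opF D n q \<in> rvec (IF D n)" "opB D n v \<in> rvec (Iz D n)"
  "adjA D n y \<in> rvec (Gc D n)" "adjF D n v \<in> rvec (Iq D n)" "adjB D n x \<in> rvec (IF D n)"
  by (auto simp: rvec_def opA_def opF_def opB_def)
     (simp_all add: adjA_def adjF_def adjB_def adj_on_eq lin_opA lin_opB lin_opF)

lemma lin_adj: "lin (adjA D n)" "lin (adjF D n)" "lin (adjB D n)"
  unfolding adjA_def adjF_def adjB_def
  by (simp_all add: lin_adj_on lin_opA lin_opB lin_opF)

lemma inner_adjA:
  "u \<in> rvec (Gc D n) \<Longrightarrow> inner_on (Iq D n) (opA D n u) y = inner_on (Gc D n) u (adjA D n y)"
  unfolding adjA_def by (rule inner_adj_on) (simp_all add: lin_opA)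

lemma inner_adjFB:
  assumes "q \<in> rvec (Iq D n)"
  shows "inner_on (Iz D n) (opB D n (opF D n q)) y = inner_on (Iq D n) q (adjF D n (adjB D n y))"
proof -
  have "inner_on (Iz D n) (opB D n (opF D n q)) y = inner_on (IF D n) (opF D n q) (adjB D n y)"
    unfolding adjB_def by (rule inner_adj_on) (simp_all add: lin_opB ops_in_rvec)
  also have "\<dots> = inner_on (Iq D n) q (adjF D n (adjB D n y))"
    unfolding adjF_def by (rule inner_adj_on) (simp_all add: lin_opF assms)
  finally show ?thesis .
qed

lemma half_steps_in_Gc:
  assumes "(d, k) \<in> Iq D n"
  shows "k(d := k d + 1/2) \<in> Gc D n" "k(d := k d - 1/2) \<in> Gc D n"
proof -
  have d: "d \<in> {0..D}" and k: "k \<in> Gs D n d" using assms by (auto simp: Iq_def)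
  then have "k d \<in> Js (n d)" by (auto simp: Gs_def PiE_iff dest!: bspec[of _ _ d])
  then obtain j where j: "j \<in> {1..n d}" "k d = real j - 1/2" by (auto simp: Js_def)
  then have "k d + 1/2 = real j" "k d - 1/2 = real (j - 1)" by auto
  then have up: "k d + 1/2 \<in> Jc (n d)" "k d - 1/2 \<in> Jc (n d)"
    using j(1) unfolding Jc_def by (auto intro!: exI[of _ "j - 1"])
  have *: "k(d := a) \<in> Gc D n" if "a \<in> Jc (n d)" for a
    using k d that by (auto simp: Gs_def Gc_def PiE_iff extensional_def split: if_splits)
  show "k(d := k d + 1/2) \<in> Gc D n" "k(d := k d - 1/2) \<in> Gc D n"
    using *[OF up(1)] *[OF up(2)] by auto
qed

lemma edge_in_Iq:
  assumes "i \<in> Gc D n" "d \<in> {0..D}" "Suc j \<le> n d"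
  shows "(d, i(d := real j + 1/2)) \<in> Iq D n"
proof -
  have "real j + 1/2 = real (Suc j) - 1/2" by simp
  then have "real j + 1/2 \<in> Js (n d)" using assms(3) unfolding Js_def by (auto intro!: exI[of _ "Suc j"])
  then show ?thesis
    using assms by (auto simp: Iq_def Gs_def Gc_def PiE_iff extensional_def)
qed

text \<open>
  A half-integer index is an edge of the grid graph, and \<open>\<A>\<^sup>*\<close> is the boundary operator of this
  graph up to scaling.
\<close>

lemma adjA_unit_vec:
  assumes e: "(d, k) \<in> Iq D n"
  shows "adjA D n (unit_vec (d, k))
    = (1 / step n d) \<odot> (unit_vec (k(d := k d + 1/2)) - unit_vec (k(d := k d - 1/2)))"
proof
  fix i
  show "adjA D n (unit_vec (d, k)) i
    = ((1 / step n d) \<odot> (unit_vec (k(d := k d + 1/2)) - unit_vec (k(d := k d - 1/2)))) i"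
  proof (cases "i \<in> Gc D n")
    case True
    then have "adjA D n (unit_vec (d, k)) i = opA D n (unit_vec i) (d, k)"
      by (simp add: adjA_def adj_on_eq lin_opA inner_on_unit_vec e)
    also have "\<dots> = 1 / step n d * (unit_vec i (k(d := k d + 1/2)) - unit_vec i (k(d := k d - 1/2)))"
      using e by (simp add: opA_def)
    finally show ?thesis by (auto simp: unit_vec_def)
  next
    case False
    then have "i \<noteq> k(d := k d + 1/2)" "i \<noteq> k(d := k d - 1/2)"
      using half_steps_in_Gc[OF e] by auto
    with False show ?thesis
      by (simp add: adjA_def adj_on_eq lin_opA unit_vec_def)
  qed
qed

section \<open>Connectedness of the grid\<close>

text \<open>
  The divergences of fluxes that run only in the directions from \<open>W\<close>.
\<close>

definition flux_range :: "nat \<Rightarrow> (nat \<Rightarrow> nat) \<Rightarrow> nat set \<Rightarrow> (idx \<Rightarrow> real) set" where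
  "flux_range D n W = adjA D n ` {\<alpha> \<in> rvec (Iq D n). \<forall>d k. d \<notin> W \<longrightarrow> \<alpha> (d, k) = 0}"

lemma flux_rangeE:
  assumes "u \<in> flux_range D n W"
  obtains \<alpha> where "\<alpha> \<in> rvec (Iq D n)" "\<forall>d k. d \<notin> W \<longrightarrow> \<alpha> (d, k) = 0" "u = adjA D n \<alpha>"
  using assms unfolding flux_range_def by blast

lemma flux_rangeI:
  "\<alpha> \<in> rvec (Iq D n) \<Longrightarrow> (\<And>d k. d \<notin> W \<Longrightarrow> \<alpha> (d, k) = 0) \<Longrightarrow> adjA D n \<alpha> \<in> flux_range D n W"
  unfolding flux_range_def by blast

lemma flux_range_add:
  assumes "u \<in> flux_range D n W" "v \<in> flux_range D n W"
  shows "u + v \<in> flux_range D n W"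
proof -
  obtain \<alpha> where \<alpha>: "\<alpha> \<in> rvec (Iq D n)" "\<forall>d k. d \<notin> W \<longrightarrow> \<alpha> (d, k) = 0" "u = adjA D n \<alpha>"
    by (rule flux_rangeE[OF assms(1)])
  obtain \<beta> where \<beta>: "\<beta> \<in> rvec (Iq D n)" "\<forall>d k. d \<notin> W \<longrightarrow> \<beta> (d, k) = 0" "v = adjA D n \<beta>"
    by (rule flux_rangeE[OF assms(2)])
  have "adjA D n (\<alpha> + \<beta>) \<in> flux_range D n W"
    using \<alpha>(1,2) \<beta>(1,2) by (intro flux_rangeI) auto
  then show ?thesis by (simp add: \<alpha>(3) \<beta>(3) lin_add[OF lin_adj(1)])
qed

lemma flux_range_scl:
  assumes "u \<in> flux_range D n W"
  shows "a \<odot> u \<in> flux_range D n W"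
proof -
  obtain \<alpha> where \<alpha>: "\<alpha> \<in> rvec (Iq D n)" "\<forall>d k. d \<notin> W \<longrightarrow> \<alpha> (d, k) = 0" "u = adjA D n \<alpha>"
    by (rule flux_rangeE[OF assms])
  then have "adjA D n (a \<odot> \<alpha>) \<in> flux_range D n W" by (intro flux_rangeI) auto
  then show ?thesis by (simp add: \<alpha>(3) lin_scl[OF lin_adj(1)])
qed

lemma flux_range_0: "0 \<in> flux_range D n W"
  using flux_rangeI[of 0 D n W] by (auto simp: lin_0[OF lin_adj(1)])

lemma flux_range_sum: "(\<And>k. k \<in> K \<Longrightarrow> x k \<in> flux_range D n W) \<Longrightarrow> (\<Sum>k\<in>K. x k) \<in> flux_range D n W"
proof (induction K rule: infinite_finite_induct)
  case (infinite K)
  then have "(\<Sum>k\<in>K. x k) = 0" by simp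
  then show "(\<Sum>k\<in>K. x k) \<in> flux_range D n W" by (simp add: flux_range_0)
next
  case empty
  have "(\<Sum>k\<in>{}. x k) = 0" by simp
  then show "(\<Sum>k\<in>{}. x k) \<in> flux_range D n W" by (simp add: flux_range_0)
next
  case (insert a K)
  then have "(\<Sum>k\<in>K. x k) \<in> flux_range D n W" "x a \<in> flux_range D n W" by auto
  then have "x a + (\<Sum>k\<in>K. x k) \<in> flux_range D n W" by (intro flux_range_add)
  also have "x a + (\<Sum>k\<in>K. x k) = (\<Sum>k\<in>insert a K. x k)" using insert.hyps by simp
  finally show "(\<Sum>k\<in>insert a K. x k) \<in> flux_range D n W" .
qed

text \<open>
  Unit masses at two points of a grid line differ by the divergence of the edges between them.
\<close>

lemma unit_diff_line:
  assumes "i \<in> Gc D n" "d \<in> W" "W \<subseteq> {0..D}" "j \<le> n d"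
  shows "unit_vec (i(d := real j)) - unit_vec (i(d := 0)) \<in> flux_range D n W"
  using assms(4)
proof (induction j)
  case 0
  show "unit_vec (i(d := real 0)) - unit_vec (i(d := 0)) \<in> flux_range D n W"
    by (simp add: flux_range_0)
next
  case (Suc j)
  let ?e = "(d, i(d := real j + 1/2))"
  have e: "?e \<in> Iq D n" using assms Suc.prems by (intro edge_in_Iq) auto
  have "unit_vec ?e \<in> {\<alpha> \<in> rvec (Iq D n). \<forall>d k. d \<notin> W \<longrightarrow> \<alpha> (d, k) = 0}"
    using e assms(2) by (auto simp: unit_vec_def rvec_def)
  then have "adjA D n (unit_vec ?e) \<in> flux_range D n W" unfolding flux_range_def by (rule imageI)
  then have "step n d \<odot> adjA D n (unit_vec ?e) \<in> flux_range D n W" by (rule flux_range_scl)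
  also have "step n d \<odot> adjA D n (unit_vec ?e) = unit_vec (i(d := real (Suc j))) - unit_vec (i(d := real j))"
    using Suc.prems by (simp add: adjA_unit_vec[OF e] fun_eq_iff step_def add.commute)
  finally have "(unit_vec (i(d := real (Suc j))) - unit_vec (i(d := real j)))
      + (unit_vec (i(d := real j)) - unit_vec (i(d := 0))) \<in> flux_range D n W"
  proof (rule flux_range_add)
    show "unit_vec (i(d := real j)) - unit_vec (i(d := 0)) \<in> flux_range D n W"
      using Suc.prems by (intro Suc.IH) simp
  qed
  then show "unit_vec (i(d := real (Suc j))) - unit_vec (i(d := 0)) \<in> flux_range D n W" by simp
qed

definition drop_coords :: "nat set \<Rightarrow> idx \<Rightarrow> idx" where
  "drop_coords W i = (\<lambda>d. if d \<in> W then 0 else i d)"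

lemma drop_coords_in_Gc: "i \<in> Gc D n \<Longrightarrow> W \<subseteq> {0..D} \<Longrightarrow> drop_coords W i \<in> Gc D n"
  by (auto simp: Gc_def PiE_iff drop_coords_def extensional_def Jc_def)

lemma unit_diff_drop_coords:
  assumes "i \<in> Gc D n" "W \<subseteq> {0..D}"
  shows "unit_vec i - unit_vec (drop_coords W i) \<in> flux_range D n W"
proof -
  have "unit_vec i - unit_vec (drop_coords U i) \<in> flux_range D n W" if "finite U" "U \<subseteq> W" for U
    using that
  proof (induction U rule: finite_induct)
    case empty
    show "unit_vec i - unit_vec (drop_coords {} i) \<in> flux_range D n W"
      by (simp add: drop_coords_def flux_range_0)
  next
    case (insert d U)
    let ?k = "drop_coords U i"
    have dW: "d \<in> W" "U \<subseteq> W" using insert.prems by auto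
    have k: "?k \<in> Gc D n" using dW assms insert.hyps by (intro drop_coords_in_Gc) auto
    have dD: "d \<in> {0..D}" using assms dW by auto
    then have "?k d \<in> Jc (n d)" using k by (auto simp: Gc_def PiE_iff)
    then obtain j where j: "j \<le> n d" "?k d = real j" by (auto simp: Jc_def)
    have eqs: "?k(d := real j) = ?k" "?k(d := 0) = drop_coords (insert d U) i"
      using j insert.hyps by (auto simp: drop_coords_def fun_eq_iff)
    have "unit_vec ?k - unit_vec (drop_coords (insert d U) i) \<in> flux_range D n W"
      using unit_diff_line[OF k dW(1) assms(2) j(1)] by (simp only: eqs)
    moreover have "unit_vec i - unit_vec ?k \<in> flux_range D n W" by (rule insert.IH[OF dW(2)])
    ultimately have "(unit_vec i - unit_vec ?k) + (unit_vec ?k - unit_vec (drop_coords (insert d U) i))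
        \<in> flux_range D n W" by (intro flux_range_add)
    then show "unit_vec i - unit_vec (drop_coords (insert d U) i) \<in> flux_range D n W" by simp
  qed
  then show ?thesis using assms(2) finite_subset[of W "{0..D}"] by simp
qed

text \<open>
  Move the mass of \<open>v\<close> along the directions in \<open>W\<close> to the points whose coordinates in \<open>W\<close> vanish.
  Each of these points collects the total mass of its fibre, which is zero.
\<close>

lemma in_flux_range:
  assumes v: "v \<in> rvec (Gc D n)" and W: "W \<subseteq> {0..D}"
    and zero: "\<And>j. j \<in> Gc D n \<Longrightarrow> (\<Sum>i | i \<in> Gc D n \<and> drop_coords W i = drop_coords W j. v i) = 0"
  shows "v \<in> flux_range D n W"
proof -
  have "(\<Sum>i\<in>Gc D n. v i \<odot> unit_vec (drop_coords W i)) = (0 :: idx \<Rightarrow> real)"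
  proof
    fix k
    have "(\<Sum>i\<in>Gc D n. v i \<odot> unit_vec (drop_coords W i)) k
        = (\<Sum>i\<in>Gc D n. if drop_coords W i = k then v i else 0)"
      unfolding sum_fun_apply by (intro sum.cong) (auto simp: unit_vec_def)
    also have "\<dots> = (\<Sum>i | i \<in> Gc D n \<and> drop_coords W i = k. v i)"
      by (simp add: sum.inter_filter)
    also have "\<dots> = 0"
    proof (cases "\<exists>j\<in>Gc D n. drop_coords W j = k")
      case True
      then obtain j where j: "j \<in> Gc D n" "drop_coords W j = k" by blast
      show ?thesis using zero[OF j(1)] unfolding j(2) .
    next
      case False
      then have "{i \<in> Gc D n. drop_coords W i = k} = {}" by blast
      then show ?thesis by (simp only: sum.empty)
    qed
    finally show "(\<Sum>i\<in>Gc D n. v i \<odot> unit_vec (drop_coords W i)) k = (0 :: idx \<Rightarrow> real) k" by simp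
  qed
  then have "v = (\<Sum>i\<in>Gc D n. v i \<odot> unit_vec i) - (\<Sum>i\<in>Gc D n. v i \<odot> unit_vec (drop_coords W i))"
    using rvec_expand[OF _ v] by simp
  also have "\<dots> = (\<Sum>i\<in>Gc D n. v i \<odot> (unit_vec i - unit_vec (drop_coords W i)))"
    by (auto simp: fun_eq_iff sum_fun_apply sum_subtractf right_diff_distrib)
  also have "\<dots> \<in> flux_range D n W"
    using W by (intro flux_range_sum flux_range_scl unit_diff_drop_coords)
  finally show ?thesis .
qed

text \<open>
  The range of \<open>\<A>\<^sup>*\<close>. The explicit form makes it evident that the space is closed.
\<close>

definition sum_zero :: "nat \<Rightarrow> (nat \<Rightarrow> nat) \<Rightarrow> (idx \<Rightarrow> real) set" where
  "sum_zero D n = {u \<in> rvec (Gc D n). (\<Sum>i\<in>Gc D n. u i) = 0}"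

lemma sum_zero_closed_ops:
  "u \<in> sum_zero D n \<Longrightarrow> v \<in> sum_zero D n \<Longrightarrow> u + v \<in> sum_zero D n"
  "u \<in> sum_zero D n \<Longrightarrow> a \<odot> u \<in> sum_zero D n"
  by (auto simp: sum_zero_def sum.distrib sum_distrib_left[symmetric] intro: rvec_closed)

lemma sum_zero_closed:
  assumes "\<And>k. x k \<in> sum_zero D n" "converges_on (Gc D n) x l" "l \<in> rvec (Gc D n)"
  shows "l \<in> sum_zero D n"
proof -
  have "(\<lambda>k. \<Sum>i\<in>Gc D n. x k i) \<longlonglongrightarrow> (\<Sum>i\<in>Gc D n. l i)"
    using assms(2) by (intro tendsto_sum) (simp add: converges_on_iff)
  then show ?thesis using assms(1,3) by (simp add: sum_zero_def LIMSEQ_const_iff)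
qed

lemma adjA_in_sum_zero: "adjA D n y \<in> sum_zero D n"
proof -
  define e where "e = (\<lambda>i. if i \<in> Gc D n then 1 else 0 :: real)"
  have "opA D n e = 0"
  proof
    fix p show "opA D n e p = 0 p"
      using half_steps_in_Gc[of "fst p" "snd p" D n]
      by (cases p) (auto simp: opA_def e_def)
  qed
  moreover have "e \<in> rvec (Gc D n)" by (simp add: e_def rvec_def)
  ultimately have "inner_on (Gc D n) e (adjA D n y) = 0"
    using inner_adjA[of e D n y] by simp
  moreover have "inner_on (Gc D n) e (adjA D n y) = (\<Sum>i\<in>Gc D n. adjA D n y i)"
    unfolding inner_on_def e_def by (intro sum.cong) auto
  ultimately show ?thesis by (simp add: sum_zero_def ops_in_rvec)
qed

lemma rge_adjA_eq_sum_zero: "rge_adjA D n = sum_zero D n"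
proof (rule antisym; rule subsetI)
  fix u assume "u \<in> rge_adjA D n"
  then show "u \<in> sum_zero D n" by (auto simp: rge_adjA_def adjA_in_sum_zero)
next
  fix u assume u: "u \<in> sum_zero D n"
  have "u \<in> flux_range D n {0..D}"
  proof (rule in_flux_range)
    fix j assume j: "j \<in> Gc D n"
    have "drop_coords {0..D} i = drop_coords {0..D} j" if "i \<in> Gc D n" for i
      using that j by (auto simp: drop_coords_def fun_eq_iff Gc_def PiE_iff extensional_def)
    then have "{i. i \<in> Gc D n \<and> drop_coords {0..D} i = drop_coords {0..D} j} = Gc D n" by blast
    then show "(\<Sum>i | i \<in> Gc D n \<and> drop_coords {0..D} i = drop_coords {0..D} j. u i) = 0"
      using u by (simp add: sum_zero_def)
  qed (use u in \<open>auto simp: sum_zero_def\<close>)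
  then show "u \<in> rge_adjA D n" by (auto simp: flux_range_def rge_adjA_def)
qed

text \<open>
  The unit vector minus the uniform distribution has zero sum, so it is \<open>\<A>\<^sup>*y\<close> for some \<open>y\<close>;
  pairing it with \<open>u\<close> gives \<open>u i\<close> because \<open>u\<close> itself has zero sum.
\<close>

lemma recover_potential:
  assumes i: "i \<in> Gc D n"
  shows "\<exists>y. \<forall>u\<in>sum_zero D n. u i = inner_on (Iq D n) (opA D n u) y"
proof -
  define e where "e = (\<lambda>j. if j \<in> Gc D n then 1 / card (Gc D n) else 0 :: real)"
  have ne: "card (Gc D n) > 0" using i by (subst card_gt_0_iff) auto
  have eG: "e \<in> rvec (Gc D n)" by (simp add: e_def rvec_def)
  have "(\<Sum>j\<in>Gc D n. e j) = 1" using i by (auto simp: e_def)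
  moreover have "(\<Sum>j\<in>Gc D n. unit_vec i j) = 1" using i by (simp add: unit_vec_def)
  ultimately have "unit_vec i - e \<in> sum_zero D n"
    using i eG by (auto simp: sum_zero_def sum_subtractf intro!: rvec_closed)
  then obtain y where y: "unit_vec i - e = adjA D n y"
    unfolding rge_adjA_eq_sum_zero[symmetric] rge_adjA_def by blast
  have "u i = inner_on (Iq D n) (opA D n u) y" if u: "u \<in> sum_zero D n" for u
  proof -
    have uG: "u \<in> rvec (Gc D n)" using u by (simp add: sum_zero_def)
    have "inner_on (Gc D n) u e = (\<Sum>j\<in>Gc D n. u j) / card (Gc D n)"
      unfolding inner_on_def sum_divide_distrib by (intro sum.cong) (auto simp: e_def)
    then have "inner_on (Gc D n) u e = 0" using u by (simp add: sum_zero_def)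
    then have "u i = inner_on (Gc D n) u (unit_vec i - e)"
      using inner_on_unit_vec[OF finite_grid(3) i, of u] by simp
    then show ?thesis unfolding y inner_adjA[OF uG] .
  qed
  then show ?thesis by blast
qed

section \<open>A flux with positive density\<close>

lemma Gs0_time: "k \<in> Gs D n 0 \<Longrightarrow> k 0 \<in> Js (n 0)"
  by (auto simp: Gs_def PiE_iff dest!: bspec[of _ _ 0])

lemma Gs0_upd: "k \<in> Gs D n 0 \<Longrightarrow> a \<in> Js (n 0) \<Longrightarrow> k(0 := a) \<in> Gs D n 0"
  by (auto simp: Gs_def PiE_iff extensional_def)

text \<open>
  Changing the time coordinate is a bijection between any two layers.
\<close>

lemma card_layer:
  "card {k \<in> Gs D n 0. k 0 = real s - 1/2}
    = (if 1 \<le> s \<and> s \<le> n 0 then card {k \<in> Gs D n 0. k 0 = 1/2} else 0)"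
proof (cases "1 \<le> s \<and> s \<le> n 0")
  case True
  then have a: "real s - 1/2 \<in> Js (n 0)" "1/2 \<in> Js (n 0)"
    unfolding Js_def by (force intro: exI[of _ s])+
  have "bij_betw (\<lambda>k. k(0 := 1/2)) {k \<in> Gs D n 0. k 0 = real s - 1/2} {k \<in> Gs D n 0. k 0 = 1/2}"
    by (rule bij_betw_byWitness[where f' = "\<lambda>k. k(0 := real s - 1/2)"])
      (auto simp: Gs0_upd a fun_upd_idem)
  then show ?thesis using True by (simp add: bij_betw_same_card)
next
  case False
  have "{k \<in> Gs D n 0. k 0 = real s - 1/2} = {}"
    using False by (auto dest!: Gs0_time simp: Js_def)
  then show ?thesis unfolding if_not_P[OF False] by (simp only: card.empty)
qed

lemma card_layer_pos:
  assumes "n 0 \<ge> 1"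
  shows "card {k \<in> Gs D n 0. k 0 = 1/2} > 0"
proof -
  let ?k = "\<lambda>d. if d \<in> {0..D} then if d = 0 then 1/2 else 0 else undefined :: real"
  have "1/2 \<in> Js (n 0)" "\<And>m. 0 \<in> Jc m"
    using assms unfolding Js_def Jc_def by force+
  then have "?k \<in> {k \<in> Gs D n 0. k 0 = 1/2}" by (auto simp: Gs_def PiE_iff extensional_def)
  then show ?thesis by (subst card_gt_0_iff) (auto intro: finite_subset[OF _ finite_grid(4)])
qed

text \<open>
  A constant time density carries the same mass through every time layer. Scaled to total
  mass one, its divergence has the same sums over time slices as \<open>-c\<close>, so the difference is the divergence of
  a purely spatial flux. The spatial fluxes also live at the first and the last time
  level, and it is there that they spread out and collect the boundary masses.
\<close>

lemma positive_density_flux: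
  assumes n0: "n 0 \<ge> 1" and c: "c \<in> rvec (Gc D n)"
    and slices: "\<And>s. s \<le> n 0 \<Longrightarrow> (\<Sum>i | i \<in> Gc D n \<and> i 0 = real s. c i)
      = (if s = 0 then 1 else 0) - (if s = n 0 then 1 else 0)"
  obtains \<alpha> \<kappa> where "\<alpha> \<in> rvec (Iq D n)" "adjA D n \<alpha> = - c" "\<kappa> > 0" "\<forall>k\<in>Gs D n 0. \<alpha> (0, k) = \<kappa>"
proof -
  define M where "M = card {k \<in> Gs D n 0. k 0 = 1/2}"
  have M: "M > 0" using card_layer_pos[of n D] n0 by (simp add: M_def)
  have h: "step n 0 > 0" using n0 by (simp add: step_def)
  define \<kappa> where "\<kappa> = step n 0 / M"
  have \<kappa>: "\<kappa> > 0" using M h by (simp add: \<kappa>_def)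
  define \<alpha>0 where "\<alpha>0 = (\<lambda>(d :: nat, k). if d = 0 \<and> k \<in> Gs D n 0 then \<kappa> else 0)"
  have \<alpha>0: "\<alpha>0 \<in> rvec (Iq D n)" by (auto simp: \<alpha>0_def rvec_def Iq_def)
  have slice_\<alpha>0: "(\<Sum>i | i \<in> Gc D n \<and> i 0 = real s. adjA D n \<alpha>0 i)
      = (if s = n 0 then 1 else 0) - (if s = 0 then 1 else 0)" if s: "s \<le> n 0" for s
  proof -
    define e where "e = (\<lambda>i. if i \<in> Gc D n \<and> i 0 = real s then 1 else 0 :: real)"
    have eG: "e \<in> rvec (Gc D n)" by (simp add: e_def rvec_def)
    have "(\<Sum>i | i \<in> Gc D n \<and> i 0 = real s. adjA D n \<alpha>0 i) = inner_on (Gc D n) e (adjA D n \<alpha>0)"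
      unfolding inner_on_def e_def by (subst sum.inter_filter) (auto intro!: sum.cong)
    also have "\<dots> = inner_on (Iq D n) (opA D n e) \<alpha>0" by (rule inner_adjA[OF eG, symmetric])
    also have "\<dots> = (\<Sum>d\<in>{0..D}. \<Sum>k\<in>Gs D n d. opA D n e (d, k) * \<alpha>0 (d, k))"
      unfolding inner_on_def Iq_def by (subst sum.Sigma) auto
    also have "\<dots> = (\<Sum>k\<in>Gs D n 0. opA D n e (0, k) * \<kappa>)"
    proof -
      have "(\<Sum>k\<in>Gs D n d. opA D n e (d, k) * \<alpha>0 (d, k))
          = (if d = 0 then \<Sum>k\<in>Gs D n 0. opA D n e (0, k) * \<kappa> else 0)" for d
        by (auto simp: \<alpha>0_def intro!: sum.cong)
      then show ?thesis by simp
    qed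
    also have "\<dots> = (\<Sum>k\<in>Gs D n 0. (if k 0 = real s - 1/2 then 1 / M else 0) - (if k 0 = real (Suc s) - 1/2 then 1 / M else 0))"
    proof (rule sum.cong[OF refl])
      fix k assume k: "k \<in> Gs D n 0"
      then have I: "(0, k) \<in> Iq D n" by (simp add: Iq_def)
      have "opA D n e (0, k) = 1 / step n 0 * (e (k(0 := k 0 + 1/2)) - e (k(0 := k 0 - 1/2)))"
        using I by (simp add: opA_def)
      moreover have "e (k(0 := k 0 + 1/2)) = (if k 0 = real s - 1/2 then 1 else 0)"
        "e (k(0 := k 0 - 1/2)) = (if k 0 = real (Suc s) - 1/2 then 1 else 0)"
        using half_steps_in_Gc[OF I] by (auto simp: e_def)
      ultimately show "opA D n e (0, k) * \<kappa>
          = (if k 0 = real s - 1/2 then 1 / M else 0) - (if k 0 = real (Suc s) - 1/2 then 1 / M else 0)"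
        using h by (simp add: \<kappa>_def)
    qed
    also have "\<dots> = real (card {k \<in> Gs D n 0. k 0 = real s - 1/2}) / M
        - real (card {k \<in> Gs D n 0. k 0 = real (Suc s) - 1/2}) / M"
      by (simp add: sum_subtractf sum.inter_filter[symmetric] del: of_nat_Suc)
    also have "\<dots> = (if s = n 0 then 1 else 0) - (if s = 0 then 1 else 0)"
      unfolding card_layer M_def[symmetric] using M s n0 by auto
    finally show ?thesis .
  qed
  define v where "v = - c - adjA D n \<alpha>0"
  have "v \<in> flux_range D n {1..D}"
  proof (rule in_flux_range)
    show "v \<in> rvec (Gc D n)" using c ops_in_rvec by (auto simp: v_def intro!: rvec_closed)
    fix j assume j: "j \<in> Gc D n"
    then have "j 0 \<in> Jc (n 0)" by (auto simp: Gc_def PiE_iff)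
    then obtain s where s: "s \<le> n 0" "j 0 = real s" by (auto simp: Jc_def)
    have "drop_coords {1..D} i = drop_coords {1..D} j \<longleftrightarrow> i 0 = j 0" if "i \<in> Gc D n" for i
      using that j
      by (auto simp: drop_coords_def fun_eq_iff Gc_def PiE_iff extensional_def Suc_le_eq)
    then have "{i. i \<in> Gc D n \<and> drop_coords {1..D} i = drop_coords {1..D} j}
        = {i. i \<in> Gc D n \<and> i 0 = real s}" using s by auto
    then show "(\<Sum>i | i \<in> Gc D n \<and> drop_coords {1..D} i = drop_coords {1..D} j. v i) = 0"
      using slices[OF s(1)] slice_\<alpha>0[OF s(1)] by (simp add: v_def sum_subtractf sum_negf)
  qed auto
  then obtain \<alpha>1 where \<alpha>1: "\<alpha>1 \<in> rvec (Iq D n)" "\<forall>d k. d \<notin> {1..D} \<longrightarrow> \<alpha>1 (d, k) = 0" "v = adjA D n \<alpha>1"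
    by (rule flux_rangeE)
  show thesis
  proof
    show "\<alpha>0 + \<alpha>1 \<in> rvec (Iq D n)" using \<alpha>0 \<alpha>1(1) by (rule rvec_closed)
    show "adjA D n (\<alpha>0 + \<alpha>1) = - c"
      using \<alpha>1(3) by (simp add: lin_add[OF lin_adj(1)] v_def[symmetric] \<alpha>1(3)[symmetric]) (simp add: v_def)
    show "\<kappa> > 0" by fact
    show "\<forall>k\<in>Gs D n 0. (\<alpha>0 + \<alpha>1) (0, k) = \<kappa>"
      using \<alpha>1(2) by (simp add: \<alpha>0_def)
  qed
qed

lemma slice_sum:
  assumes "t \<in> Jc (n 0)"
  shows "(\<Sum>i | i \<in> Gc D n \<and> i 0 = t. f (restrict i {1..D})) = (\<Sum>i\<in>GcX D n. f i)"
proof (rule sum.reindex_bij_witness[where i = "\<lambda>i. i(0 := t)" and j = "\<lambda>i. restrict i {1..D}"])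
  show "(restrict i {1..D})(0 := t) = i" if "i \<in> {i. i \<in> Gc D n \<and> i 0 = t}" for i
    using that by (auto simp: fun_eq_iff Gc_def PiE_iff extensional_def restrict_def not_le)
  show "restrict (i(0 := t)) {1..D} = i" if "i \<in> GcX D n" for i
    using that by (auto simp: fun_eq_iff GcX_def PiE_iff extensional_def restrict_def)
  show "restrict i {1..D} \<in> GcX D n" if "i \<in> {i. i \<in> Gc D n \<and> i 0 = t}" for i
    using that by (auto simp: GcX_def Gc_def PiE_iff)
  show "i(0 := t) \<in> {i. i \<in> Gc D n \<and> i 0 = t}" if "i \<in> GcX D n" for i
    using that assms by (auto simp: GcX_def Gc_def PiE_iff extensional_def Suc_le_eq)
qed simp

lemma cvec_slices:
  assumes n0: "n 0 \<ge> 1" and "s \<le> n 0"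
    and "(\<Sum>i\<in>GcX D n. measure \<rho>0 (cell D n i)) = 1" "(\<Sum>i\<in>GcX D n. measure \<rho>1 (cell D n i)) = 1"
  shows "(\<Sum>i | i \<in> Gc D n \<and> i 0 = real s. cvec D n \<rho>0 \<rho>1 i)
    = (if s = 0 then 1 else 0) - (if s = n 0 then 1 else 0)"
proof -
  have s: "real s \<in> Jc (n 0)" using assms(2) by (auto simp: Jc_def)
  note slice = slice_sum[where n = n and D = D, OF s]
  consider "s = 0" | "s = n 0" "s \<noteq> 0" | "s \<noteq> 0" "s \<noteq> n 0" by blast
  then show ?thesis
  proof cases
    case 1
    have "(\<Sum>i | i \<in> Gc D n \<and> i 0 = real s. cvec D n \<rho>0 \<rho>1 i)
        = (\<Sum>i | i \<in> Gc D n \<and> i 0 = real s. measure \<rho>0 (cell D n (restrict i {1..D})))"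
      using 1 by (intro sum.cong) (auto simp: cvec_def)
    also have "\<dots> = 1" using slice[of "\<lambda>i. measure \<rho>0 (cell D n i)"] assms(3) by simp
    finally show ?thesis using 1 n0 by simp
  next
    case 2
    have "(\<Sum>i | i \<in> Gc D n \<and> i 0 = real s. cvec D n \<rho>0 \<rho>1 i)
        = (\<Sum>i | i \<in> Gc D n \<and> i 0 = real s. - measure \<rho>1 (cell D n (restrict i {1..D})))"
      using 2 by (intro sum.cong) (auto simp: cvec_def)
    also have "\<dots> = - 1" using slice[of "\<lambda>i. - measure \<rho>1 (cell D n i)"] assms(4) by (simp add: sum_negf)
    finally show ?thesis using 2 by simp
  next
    case 3
    have "(\<Sum>i | i \<in> Gc D n \<and> i 0 = real s. cvec D n \<rho>0 \<rho>1 i) = 0"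
      using 3 by (intro sum.neutral) (auto simp: cvec_def)
    then show ?thesis using 3 by simp
  qed
qed

section \<open>The interpolation operator is injective\<close>

lemma opBF_block:
  assumes "d \<in> {1..D}" "r \<in> {1..4}" "k \<in> Gs D n 0"
  shows "opB D n (opF D n q) (4 * (d - 1) + r + 1, k) = sqrt 2 / 2 * Fblock n d r q k"
proof -
  let ?m = "4 * (d - 1) + r"
  have m: "1 \<le> ?m" "?m \<le> 4 * D" using assms by auto
  have "(?m - 1) div 4 + 1 = d" "(?m - 1) mod 4 + 1 = r"
  proof -
    have "?m - 1 = (r - 1) + 4 * (d - 1)" "r - 1 < 4" using assms by auto
    then have "(?m - 1) div 4 = d - 1" "(?m - 1) mod 4 = r - 1" by simp_all
    then show "(?m - 1) div 4 + 1 = d" "(?m - 1) mod 4 + 1 = r" using assms by auto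
  qed
  then have "opF D n q (?m, k) = Fblock n d r q k"
    using m assms(3) by (simp add: opF_def IF_def)
  moreover have "opB D n w (Suc l, k) = sqrt 2 / 2 * w (l, k)" if "1 \<le> l" "l \<le> 4 * D" for w l
    using that assms(3) by (simp add: opB_def Iz_def)
  ultimately show ?thesis using m by simp
qed

text \<open>
  Every component of \<open>q\<close> occurs in \<open>\<F>q\<close>. A spatial component at time \<open>t \<ge> 1\<close> is seen by block
  \<open>r = 3\<close> from the half step before it; at \<open>t = 0\<close> it is seen by block \<open>r = 1\<close> from the half step after it.
  The middle blocks \<open>2, \<dots>, 4D + 1\<close> of \<open>\<B>\<F>q\<close> never contain the density \<open>q\<^sub>0\<close>.
\<close>

lemma recover_flux:
  assumes n0: "n 0 \<ge> 1" and "(d, i) \<in> Iq D n"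
  obtains m k a where "(m, k) \<in> Iz D n" "d = 0 \<and> m = 4 * D + 2 \<and> k = i \<and> a = 1 \<or> d \<noteq> 0 \<and> m \<in> {2..4 * D + 1}"
    "\<forall>q. q (d, i) = a * opB D n (opF D n q) (m, k)"
proof (cases "d = 0")
  case True
  then have i: "i \<in> Gs D n 0" using assms by (simp add: Iq_def)
  show thesis
  proof (rule that[of "4 * D + 2" i 1])
    show "(4 * D + 2, i) \<in> Iz D n" using i by (simp add: Iz_def)
    show "\<forall>q. q (d, i) = 1 * opB D n (opF D n q) (4 * D + 2, i)"
      using i True by (simp add: opB_def opF_def Iz_def IF_def)
  qed (use True in simp)
next
  case False
  have d: "d \<in> {1..D}" and i: "i \<in> Gs D n d" using assms False by (auto simp: Iq_def)
  have "i d \<in> Js (n d)" using i d by (auto simp: Gs_def PiE_iff dest!: bspec[of _ _ d])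
  then obtain j where j: "j \<in> {1..n d}" "i d = real j - 1/2" by (auto simp: Js_def)
  have "i 0 \<in> Jc (n 0)" using i False by (auto simp: Gs_def PiE_iff dest!: bspec[of _ _ 0])
  then obtain t where t: "t \<le> n 0" "i 0 = real t" by (auto simp: Jc_def)
  have k_in: "i(0 := a, d := real j) \<in> Gs D n 0" if "a \<in> Js (n 0)" for a
    using i d j(1) that False
    by (auto simp: Gs_def PiE_iff extensional_def Jc_def split: if_splits)
  have "\<exists>r\<in>{1..4}. \<exists>k\<in>Gs D n 0. \<forall>q. Fblock n d r q k = q (d, i)"
  proof (cases "t = 0")
    case True
    have "1/2 \<in> Js (n 0)" using n0 unfolding Js_def by force
    moreover have "Fblock n d 1 q (i(0 := 1/2, d := real j)) = q (d, i)" for q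
    proof -
      have "(i(0 := 1/2, d := real j))(0 := 1/2 - 1/2, d := real j - 1/2) = i"
        using j t True False by (auto simp: fun_eq_iff)
      then show ?thesis using j(1) False by (simp add: Fblock_def)
    qed
    ultimately show ?thesis using k_in by (intro bexI[of _ 1] bexI[of _ "i(0 := 1/2, d := real j)"]) auto
  next
    case t0: False
    then have "real t - 1/2 \<in> Js (n 0)" using t unfolding Js_def by (force intro: exI[of _ t])
    moreover have "Fblock n d 3 q (i(0 := real t - 1/2, d := real j)) = q (d, i)" for q
    proof -
      have "(i(0 := real t - 1/2, d := real j))(0 := real t - 1/2 + 1/2, d := real j - 1/2) = i"
        using j t False by (auto simp: fun_eq_iff)
      then show ?thesis using j(1) False by (simp add: Fblock_def)
    qed
    ultimately show ?thesis using k_in by (intro bexI[of _ 3] bexI[of _ "i(0 := real t - 1/2, d := real j)"]) auto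
  qed
  then obtain r k where r: "r \<in> {1..4}" and k: "k \<in> Gs D n 0" and F: "\<And>q. Fblock n d r q k = q (d, i)" by blast
  show thesis
  proof (rule that[of "4 * (d - 1) + r + 1" k "sqrt 2"])
    show "(4 * (d - 1) + r + 1, k) \<in> Iz D n" using r k d by (auto simp: Iz_def)
    show "d = 0 \<and> 4 * (d - 1) + r + 1 = 4 * D + 2 \<and> k = i \<and> sqrt 2 = 1 \<or> d \<noteq> 0 \<and> 4 * (d - 1) + r + 1 \<in> {2..4 * D + 1}"
      using r d by auto
    show "\<forall>q. q (d, i) = sqrt 2 * opB D n (opF D n q) (4 * (d - 1) + r + 1, k)"
      unfolding opBF_block[OF d r k] F by simp
  qed
qed

section \<open>The product of second-order cones\<close>

abbreviation head :: "(nat \<times> 'i \<Rightarrow> real) \<Rightarrow> 'i \<Rightarrow> real" where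
  "head x i \<equiv> x (1, i)"

definition tail_norm :: "nat \<Rightarrow> (nat \<times> 'i \<Rightarrow> real) \<Rightarrow> 'i \<Rightarrow> real" where
  "tail_norm D x i = L2_set (\<lambda>m. x (Suc m, i)) {1..4 * D + 1}"

lemma coneQ_iff:
  "x \<in> coneQ D n \<longleftrightarrow> x \<in> rvec (Iz D n) \<and> (\<forall>i\<in>Gs D n 0. tail_norm D x i \<le> head x i)"
  by (simp add: coneQ_def Ksoc_def tail_norm_def)

lemma tail_norm_nonneg [simp]: "0 \<le> tail_norm D x i"
  by (simp add: tail_norm_def L2_set_nonneg)

lemma inner_on_Iz:
  "inner_on (Iz D n) x y
    = (\<Sum>i\<in>Gs D n 0. head x i * head y i + (\<Sum>m\<in>{1..4 * D + 1}. x (Suc m, i) * y (Suc m, i)))"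
proof -
  have "inner_on (Iz D n) x y = (\<Sum>i\<in>Gs D n 0. \<Sum>m\<in>{1..4 * D + 2}. x (m, i) * y (m, i))"
    unfolding inner_on_def Iz_def
    by (subst sum.swap, subst sum.cartesian_product) (simp add: case_prod_beta)
  also have "\<dots> = (\<Sum>i\<in>Gs D n 0. head x i * head y i + (\<Sum>m\<in>{1..4 * D + 1}. x (Suc m, i) * y (Suc m, i)))"
  proof (rule sum.cong[OF refl])
    fix i
    have "(\<Sum>m\<in>{1..4 * D + 2}. x (m, i) * y (m, i))
        = x (1, i) * y (1, i) + (\<Sum>m\<in>{Suc 1..Suc (4 * D + 1)}. x (m, i) * y (m, i))"
      by (subst sum.atLeast_Suc_atMost) auto
    then show "(\<Sum>m\<in>{1..4 * D + 2}. x (m, i) * y (m, i))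
        = head x i * head y i + (\<Sum>m\<in>{1..4 * D + 1}. x (Suc m, i) * y (Suc m, i))"
      by (simp only: sum.shift_bounds_cl_Suc_ivl)
  qed
  finally show ?thesis .
qed

text \<open>
  Cauchy--Schwarz at every grid point. Both the positivity of the pairing and the lower bound in the interior
  follow from it.
\<close>

lemma inner_on_Iz_ge:
  assumes x: "x \<in> coneQ D n"
  shows "(\<Sum>i\<in>Gs D n 0. head x i * (head y i - tail_norm D y i)) \<le> inner_on (Iz D n) x y"
  unfolding inner_on_Iz
proof (rule sum_mono)
  fix i assume i: "i \<in> Gs D n 0"
  have "- (\<Sum>m\<in>{1..4 * D + 1}. x (Suc m, i) * y (Suc m, i))
      \<le> (\<Sum>m\<in>{1..4 * D + 1}. \<bar>x (Suc m, i)\<bar> * \<bar>y (Suc m, i)\<bar>)"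
    unfolding sum_negf[symmetric] by (intro sum_mono) (simp add: abs_mult[symmetric] abs_ge_minus_self)
  also have "\<dots> \<le> tail_norm D x i * tail_norm D y i"
    unfolding tail_norm_def by (rule L2_set_mult_ineq)
  also have "\<dots> \<le> head x i * tail_norm D y i"
    using x i by (intro mult_right_mono) (auto simp: coneQ_iff)
  finally show "head x i * (head y i - tail_norm D y i)
      \<le> head x i * head y i + (\<Sum>m\<in>{1..4 * D + 1}. x (Suc m, i) * y (Suc m, i))"
    by (simp add: right_diff_distrib)
qed

lemma coneQ_head_nonneg: "x \<in> coneQ D n \<Longrightarrow> i \<in> Gs D n 0 \<Longrightarrow> 0 \<le> head x i"
  using tail_norm_nonneg[of D x i] unfolding coneQ_iff by (meson order_trans)

lemma coneQ_pairing:
  assumes "x \<in> coneQ D n" "y \<in> coneQ D n"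
  shows "0 \<le> inner_on (Iz D n) x y"
proof -
  have "0 \<le> (\<Sum>i\<in>Gs D n 0. head x i * (head y i - tail_norm D y i))"
    using assms coneQ_head_nonneg[OF assms(1)]
    by (intro sum_nonneg mult_nonneg_nonneg) (auto simp: coneQ_iff)
  also have "\<dots> \<le> inner_on (Iz D n) x y" by (rule inner_on_Iz_ge[OF assms(1)])
  finally show ?thesis .
qed

lemma coneQ_coord_le_head:
  assumes "x \<in> coneQ D n" "(m, i) \<in> Iz D n"
  shows "\<bar>x (m, i)\<bar> \<le> head x i"
proof (cases "m = 1")
  case True
  then show ?thesis using coneQ_head_nonneg[OF assms(1)] assms(2) by (simp add: Iz_def)
next
  case False
  then obtain m' where m': "m = Suc m'" "m' \<in> {1..4 * D + 1}"
    using assms(2) by (cases m) (auto simp: Iz_def)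
  have "\<bar>x (m, i)\<bar> \<le> L2_set (\<lambda>m. \<bar>x (Suc m, i)\<bar>) {1..4 * D + 1}"
    unfolding m'(1) by (rule member_le_L2_set[OF _ m'(2)]) simp
  also have "\<dots> = tail_norm D x i" by (simp add: tail_norm_def L2_set_def)
  also have "\<dots> \<le> head x i" using assms by (auto simp: coneQ_iff Iz_def)
  finally show ?thesis .
qed

lemma coneQ_interior:
  assumes "\<And>i. i \<in> Gs D n 0 \<Longrightarrow> tail_norm D y i < head y i"
  shows "\<exists>K\<ge>0. \<forall>x\<in>coneQ D n. \<forall>p\<in>Iz D n. \<bar>x p\<bar> \<le> K * inner_on (Iz D n) x y"
proof -
  define e where "e = Min (insert 1 ((\<lambda>i. head y i - tail_norm D y i) ` Gs D n 0))"
  have e: "e > 0" using assms unfolding e_def by (subst Min_gr_iff) auto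
  have e_le: "e \<le> head y i - tail_norm D y i" if "i \<in> Gs D n 0" for i
    unfolding e_def using that by (intro Min_le) auto
  have "\<bar>x p\<bar> \<le> 1 / e * inner_on (Iz D n) x y" if x: "x \<in> coneQ D n" and p: "p \<in> Iz D n" for x p
  proof -
    obtain m i where mi: "p = (m, i)" "i \<in> Gs D n 0" using p by (auto simp: Iz_def)
    have "e * \<bar>x p\<bar> \<le> e * head x i"
      using coneQ_coord_le_head[OF x] p e by (simp add: mi)
    also have "\<dots> \<le> (\<Sum>i\<in>Gs D n 0. e * head x i)"
      using mi(2) e coneQ_head_nonneg[OF x] by (intro member_le_sum[of i _ "\<lambda>i. e * head x i"]) auto
    also have "\<dots> \<le> (\<Sum>i\<in>Gs D n 0. head x i * (head y i - tail_norm D y i))"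
      using e_le coneQ_head_nonneg[OF x] by (intro sum_mono) (simp add: mult.commute[of e] mult_left_mono)
    also have "\<dots> \<le> inner_on (Iz D n) x y" by (rule inner_on_Iz_ge[OF x])
    finally show ?thesis using e by (simp add: field_simps)
  qed
  then show ?thesis using e by (intro exI[of _ "1 / e"]) auto
qed

lemma coneQ_0: "0 \<in> coneQ D n"
  by (auto simp: coneQ_iff tail_norm_def L2_set_def)

lemma coneQ_add: "x \<in> coneQ D n \<Longrightarrow> y \<in> coneQ D n \<Longrightarrow> x + y \<in> coneQ D n"
  unfolding coneQ_iff
proof (intro conjI ballI; elim conjE)
  fix i assume "i \<in> Gs D n 0" "\<forall>i\<in>Gs D n 0. tail_norm D x i \<le> head x i"
    "\<forall>i\<in>Gs D n 0. tail_norm D y i \<le> head y i"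
  moreover have "tail_norm D (x + y) i \<le> tail_norm D x i + tail_norm D y i"
    unfolding tail_norm_def plus_fun_apply by (rule L2_set_triangle_ineq)
  ultimately show "tail_norm D (x + y) i \<le> head (x + y) i" by fastforce
qed (rule rvec_closed)

lemma coneQ_scl:
  assumes "a \<ge> 0" "x \<in> coneQ D n"
  shows "a \<odot> x \<in> coneQ D n"
proof -
  have "tail_norm D (a \<odot> x) i = a * tail_norm D x i" for i
    unfolding tail_norm_def scl_apply by (rule L2_set_right_distrib[OF assms(1), symmetric])
  then show ?thesis using assms by (auto simp: coneQ_iff intro: mult_left_mono)
qed

lemma coneQ_closed:
  assumes "\<And>k. x k \<in> coneQ D n" "converges_on (Iz D n) x l" "l \<in> rvec (Iz D n)"
  shows "l \<in> coneQ D n"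
  unfolding coneQ_iff
proof (intro conjI ballI)
  fix i assume i: "i \<in> Gs D n 0"
  have lim: "(\<lambda>k. x k (m, i)) \<longlonglongrightarrow> l (m, i)" if "m \<in> {1..4 * D + 2}" for m
    using assms(2) that i by (auto simp: converges_on_iff Iz_def)
  have t: "(\<lambda>k. tail_norm D (x k) i) \<longlonglongrightarrow> tail_norm D l i"
    unfolding tail_norm_def L2_set_def by (intro tendsto_intros lim) auto
  show "tail_norm D l i \<le> head l i"
    by (rule LIMSEQ_le[OF t lim]) (use assms(1) i in \<open>auto simp: coneQ_iff\<close>)
qed fact

text \<open>
  Test at a single grid point: the reflected vector with head \<open>\<parallel>y\<parallel>\<close> and tail \<open>-y\<close> gives
  \<open>\<parallel>y\<parallel> (y\<^sub>0 - \<parallel>y\<parallel>) \<ge> 0\<close>, and if the tail vanishes the axis of the cone gives \<open>y\<^sub>0 \<ge> 0\<close>.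
\<close>

lemma coneQ_self_dual:
  assumes y: "y \<in> rvec (Iz D n)" and dual: "\<And>x. x \<in> coneQ D n \<Longrightarrow> 0 \<le> inner_on (Iz D n) x y"
  shows "y \<in> coneQ D n"
  unfolding coneQ_iff
proof (intro conjI ballI)
  fix i assume i: "i \<in> Gs D n 0"
  define x where "x = (\<lambda>(m, k). if k = i \<and> m \<in> {1..4 * D + 2}
    then (if m = 1 then tail_norm D y i else - y (m, i)) else 0)"
  have tail: "tail_norm D x k = (if k = i then tail_norm D y i else 0)" for k
    by (auto simp: tail_norm_def x_def L2_set_def)
  have "x \<in> coneQ D n"
    using i tail by (auto simp: coneQ_iff) (auto simp: x_def rvec_def Iz_def)
  then have "0 \<le> inner_on (Iz D n) x y" by (rule dual)
  also have "\<dots> = (\<Sum>k\<in>Gs D n 0. if k = i then tail_norm D y i * head y i - (tail_norm D y i)\<^sup>2 else 0)"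
    unfolding inner_on_Iz
  proof (rule sum.cong[OF refl])
    fix k
    show "head x k * head y k + (\<Sum>m\<in>{1..4 * D + 1}. x (Suc m, k) * y (Suc m, k))
        = (if k = i then tail_norm D y i * head y i - (tail_norm D y i)\<^sup>2 else 0)"
    proof (cases "k = i")
      case True
      have "(\<Sum>m\<in>{1..4 * D + 1}. x (Suc m, k) * y (Suc m, k)) = - (tail_norm D y i)\<^sup>2"
        unfolding tail_norm_def L2_set_power2 inner_on_def sum_negf[symmetric]
        using True by (intro sum.cong) (auto simp: x_def)
      then show ?thesis using True by (simp add: x_def)
    qed (auto simp: x_def)
  qed
  also have "\<dots> = tail_norm D y i * (head y i - tail_norm D y i)"
    using i by (simp add: power2_eq_square right_diff_distrib)
  finally have pos: "0 \<le> tail_norm D y i * (head y i - tail_norm D y i)" .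
  show "tail_norm D y i \<le> head y i"
  proof (cases "tail_norm D y i = 0")
    case True
    define u where "u = unit_vec (1 :: nat, i)"
    have "tail_norm D u k = 0" for k by (simp add: tail_norm_def u_def unit_vec_def L2_set_def)
    then have "u \<in> coneQ D n" using i by (auto simp: coneQ_iff u_def) (auto simp: Iz_def unit_vec_def)
    then have "0 \<le> inner_on (Iz D n) u y" by (rule dual)
    also have "\<dots> = head y i"
    proof -
      have "(1, i) \<in> Iz D n" using i by (simp add: Iz_def)
      from inner_on_unit_vec[OF finite_grid(7) this] show ?thesis
        unfolding u_def by (subst inner_on_commute) simp
    qed
    finally show ?thesis using True by simp
  next
    case False
    then have "tail_norm D y i > 0" using tail_norm_nonneg[of D y i] by linarith
    then show ?thesis using pos by (simp add: zero_le_mult_iff)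
  qed
qed fact

section \<open>Strictly feasible points\<close>

lemma dvec_in_rvec: "dvec D n \<in> rvec (Iz D n)"
  by (auto simp: dvec_def rvec_def)

lemma inner_eq_imp_eq:
  assumes "finite S" "x \<in> rvec S" "y \<in> rvec S" "\<And>u. u \<in> rvec S \<Longrightarrow> inner_on S u x = inner_on S u y"
  shows "x = y"
proof -
  have xy: "x - y \<in> rvec S" using assms(2,3) by (rule rvec_closed)
  have "x - y = 0" using assms(4)[OF xy] by (intro inner_on_self_eq_0[OF assms(1) xy]) simp
  then show ?thesis by simp
qed

text \<open>
  Solve \<open>N\<^sup>*y = \<alpha>\<close> with the components singled out by \<open>recover_flux\<close>; the density then sits in the
  last block only. Adding the same constant \<open>L\<close> to the first and the last block does not
  change \<open>N\<^sup>*\<close>, since these blocks of \<open>N q\<close> are \<open>-q\<^sub>0\<close> and \<open>q\<^sub>0\<close>. The first block of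
  \<open>\<gamma> - y\<close> is then \<open>L\<close>, the last one \<open>L - \<kappa>\<close>, and \<open>L\<^sup>2 - (L - \<kappa>)\<^sup>2 = 2 L \<kappa> - \<kappa>\<^sup>2\<close> exceeds the
  square of the middle blocks for large \<open>L\<close>. Positivity of the density is what makes this work.
\<close>

lemma strictly_feasible_multiplier:
  assumes n0: "n 0 \<ge> 1" and \<alpha>: "\<alpha> \<in> rvec (Iq D n)" and \<kappa>: "\<kappa> > 0" "\<forall>k\<in>Gs D n 0. \<alpha> (0, k) = \<kappa>"
  obtains \<beta> where "\<beta> \<in> rvec (Iz D n)" "\<alpha> + adjF D n (adjB D n \<beta>) = 0"
    "\<forall>i\<in>Gs D n 0. tail_norm D \<beta> i < head \<beta> i"
proof -
  have "\<exists>s a. s \<in> Iz D n \<and> (fst p = 0 \<and> s = (4 * D + 2, snd p) \<and> a = 1 \<or> fst p \<noteq> 0 \<and> fst s \<in> {2..4 * D + 1})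
      \<and> (\<forall>q. q p = a * opB D n (opF D n q) s)" if pI: "p \<in> Iq D n" for p
  proof -
    obtain d i where p: "p = (d, i)" by (cases p)
    obtain m k a where "(m, k) \<in> Iz D n" "d = 0 \<and> m = 4 * D + 2 \<and> k = i \<and> a = 1 \<or> d \<noteq> 0 \<and> m \<in> {2..4 * D + 1}"
      "\<forall>q. q (d, i) = a * opB D n (opF D n q) (m, k)"
      by (rule recover_flux[where n = n and D = D, OF n0 pI[unfolded p]])
    then show ?thesis unfolding p by (intro exI[of _ "(m, k)"] exI[of _ a]) auto
  qed
  then obtain s a where s: "\<And>p. p \<in> Iq D n \<Longrightarrow> s p \<in> Iz D n"
      "\<And>p. p \<in> Iq D n \<Longrightarrow> fst p = 0 \<and> s p = (4 * D + 2, snd p) \<and> a p = 1 \<or> fst p \<noteq> 0 \<and> fst (s p) \<in> {2..4 * D + 1}"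
      "\<And>p q. p \<in> Iq D n \<Longrightarrow> q p = a p * opB D n (opF D n q) (s p)"
    by metis
  define y where "y = (\<Sum>p\<in>Iq D n. (\<alpha> p * a p) \<odot> unit_vec (s p))"
  have yT: "y \<in> rvec (Iz D n)"
    unfolding y_def by (intro rvec_sum rvec_closed) (simp add: s)
  have inner_y: "inner_on (Iz D n) (opB D n (opF D n q)) y = inner_on (Iq D n) q \<alpha>" for q
  proof -
    have "inner_on (Iz D n) (opB D n (opF D n q)) y
        = (\<Sum>p\<in>Iq D n. inner_on (Iz D n) ((\<alpha> p * a p) \<odot> unit_vec (s p)) (opB D n (opF D n q)))"
      unfolding y_def by (subst inner_on_commute) (rule inner_on_sum_left)
    also have "\<dots> = (\<Sum>p\<in>Iq D n. q p * \<alpha> p)"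
    proof (rule sum.cong[OF refl])
      fix p assume p: "p \<in> Iq D n"
      have "inner_on (Iz D n) ((\<alpha> p * a p) \<odot> unit_vec (s p)) (opB D n (opF D n q))
          = (\<alpha> p * a p) * opB D n (opF D n q) (s p)"
        using inner_on_unit_vec[OF finite_grid(7) s(1)[OF p]] by (simp add: inner_on_commute[of _ "unit_vec (s p)"])
      also have "\<dots> = \<alpha> p * (a p * opB D n (opF D n q) (s p))" by simp
      also have "\<dots> = q p * \<alpha> p" unfolding s(3)[OF p, symmetric] by simp
      finally show "inner_on (Iz D n) ((\<alpha> p * a p) \<odot> unit_vec (s p)) (opB D n (opF D n q)) = q p * \<alpha> p" .
    qed
    finally show ?thesis by (simp add: inner_on_def)
  qed
  have y_first: "y (1, i) = 0" for i
  proof -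
    have "((\<alpha> p * a p) \<odot> unit_vec (s p)) (1, i) = 0" if "p \<in> Iq D n" for p
    proof -
      have "(1, i) \<noteq> s p" using s(2)[OF that] by (cases "s p") auto
      then show ?thesis by (simp add: unit_vec_def)
    qed
    then show ?thesis unfolding y_def sum_fun_apply by (intro sum.neutral) blast
  qed
  have y_last: "y (4 * D + 2, i) = \<kappa>" if i: "i \<in> Gs D n 0" for i
  proof -
    have p0: "(0, i) \<in> Iq D n" using i by (simp add: Iq_def)
    have "(\<alpha> p * a p) * unit_vec (s p) (4 * D + 2, i) = (if p = (0, i) then \<kappa> else 0)" if p: "p \<in> Iq D n" for p
    proof (cases "p = (0, i)")
      case True
      then have "s p = (4 * D + 2, i)" "a p = 1" using s(2)[OF p] by auto
      then show ?thesis using True \<kappa>(2) i by (simp add: unit_vec_def)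
    next
      case False
      then have "s p \<noteq> (4 * D + 2, i)" using s(2)[OF p] by (cases p) auto
      then show ?thesis using False by (simp add: unit_vec_def)
    qed
    then have "y (4 * D + 2, i) = (\<Sum>p\<in>Iq D n. if p = (0, i) then \<kappa> else 0)"
      by (simp add: y_def sum_fun_apply)
    then show ?thesis using p0 by simp
  qed
  define B where "B = (\<Sum>i\<in>Gs D n 0. \<Sum>m\<in>{1..4 * D}. (y (Suc m, i))\<^sup>2)"
  have B: "B \<ge> 0" unfolding B_def by (intro sum_nonneg) auto
  define L where "L = (B + \<kappa>\<^sup>2) / \<kappa>"
  have L: "L > 0" using B \<kappa>(1) by (simp add: L_def add_nonneg_pos)
  define \<gamma> where "\<gamma> = (\<lambda>(m :: nat, i). if i \<in> Gs D n 0 \<and> (m = 1 \<or> m = 4 * D + 2) then L else 0)"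
  have \<gamma>T: "\<gamma> \<in> rvec (Iz D n)" by (auto simp: \<gamma>_def rvec_def Iz_def)
  have inner_\<gamma>: "inner_on (Iz D n) (opB D n (opF D n q)) \<gamma> = 0" for q
  proof -
    have "inner_on (Iz D n) (opB D n (opF D n q)) \<gamma>
        = (\<Sum>i\<in>Gs D n 0. - q (0, i) * L + (\<Sum>m\<in>{1..4 * D + 1}. if m = 4 * D + 1 then q (0, i) * L else 0))"
      unfolding inner_on_Iz
      by (intro sum.cong arg_cong2[of _ _ _ _ "(+)"]) (auto simp: opB_def opF_def Iz_def IF_def \<gamma>_def)
    also have "\<dots> = 0" by simp
    finally show ?thesis .
  qed
  show thesis
  proof
    show \<beta>T: "\<gamma> - y \<in> rvec (Iz D n)" using \<gamma>T yT by (rule rvec_closed)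
    show "\<alpha> + adjF D n (adjB D n (\<gamma> - y)) = 0"
    proof -
      have "adjF D n (adjB D n (\<gamma> - y)) = - \<alpha>"
        by (rule inner_eq_imp_eq[of "Iq D n"])
          (simp_all add: ops_in_rvec rvec_closed \<alpha> inner_adjFB[symmetric] inner_y inner_\<gamma>)
      then show ?thesis by simp
    qed
    show "\<forall>i\<in>Gs D n 0. tail_norm D (\<gamma> - y) i < head (\<gamma> - y) i"
    proof
      fix i assume i: "i \<in> Gs D n 0"
      have h: "head (\<gamma> - y) i = L" using i y_first[of i] by (simp add: \<gamma>_def)
      have "(tail_norm D (\<gamma> - y) i)\<^sup>2 = (\<Sum>m\<in>{1..Suc (4 * D)}. ((\<gamma> - y) (Suc m, i))\<^sup>2)"
        unfolding tail_norm_def L2_set_power2 inner_on_def by (simp add: power2_eq_square)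
      also have "\<dots> = (L - \<kappa>)\<^sup>2 + (\<Sum>m\<in>{1..4 * D}. (y (Suc m, i))\<^sup>2)"
        using i y_last[OF i] by (simp add: \<gamma>_def)
      also have "\<dots> \<le> (L - \<kappa>)\<^sup>2 + B"
        unfolding B_def using i by (intro add_left_mono member_le_sum[of i _ "\<lambda>i. \<Sum>m\<in>{1..4 * D}. (y (Suc m, i))\<^sup>2"])
          (auto intro: sum_nonneg)
      also have "\<dots> < L\<^sup>2"
      proof -
        have "L * \<kappa> = B + \<kappa>\<^sup>2" using \<kappa>(1) by (simp add: L_def)
        moreover have "\<kappa>\<^sup>2 > 0" using \<kappa>(1) by simp
        ultimately show ?thesis using B unfolding power2_diff by linarith
      qed
      finally show "tail_norm D (\<gamma> - y) i < head (\<gamma> - y) i"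
        unfolding h using L by (intro power2_less_imp_less[of _ L]) auto
    qed
  qed
qed

text \<open>
  For \<open>\<phi> = -t\<close> one has \<open>q\<^sub>0 = -1\<close> and \<open>q\<^sub>d = 0\<close> otherwise, so \<open>z = (2; 0; \<dots>; 0)\<close>. A constant
  is added to make the sum vanish.
\<close>

lemma strictly_feasible_potential:
  assumes n: "\<forall>d\<in>{0..D}. n d \<ge> 1"
  obtains \<phi> where "\<phi> \<in> sum_zero D n"
    "\<forall>i\<in>Gs D n 0. tail_norm D (opB D n (opF D n (opA D n \<phi>)) + dvec D n) i
      < head (opB D n (opF D n (opA D n \<phi>)) + dvec D n) i"
proof -
  define a where "a = step n 0 * (\<Sum>i\<in>Gc D n. i 0) / card (Gc D n)"
  define \<phi> where "\<phi> = (\<lambda>i. if i \<in> Gc D n then a - step n 0 * i 0 else 0)"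
  have ne: "card (Gc D n) > 0"
  proof -
    have "(\<lambda>d. if d \<in> {0..D} then 0 else undefined) \<in> Gc D n"
      by (auto simp: Gc_def PiE_iff extensional_def Jc_def)
    then show ?thesis by (subst card_gt_0_iff) auto
  qed
  have "(\<Sum>i\<in>Gc D n. \<phi> i) = (\<Sum>i\<in>Gc D n. a - step n 0 * i 0)"
    by (rule sum.cong) (auto simp: \<phi>_def)
  also have "\<dots> = 0" using ne by (simp add: sum_subtractf sum_distrib_left[symmetric] a_def)
  finally have V: "\<phi> \<in> sum_zero D n" by (simp add: sum_zero_def rvec_def \<phi>_def)
  have A: "opA D n \<phi> (d, k) = (if d = 0 then - 1 else 0)" if "(d, k) \<in> Iq D n" for d k
  proof -
    have "n 0 \<ge> 1" using n by (auto dest: bspec[of _ _ 0])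
    then have "step n 0 > 0" by (simp add: step_def)
    then show ?thesis
      using that half_steps_in_Gc[OF that] by (auto simp: opA_def \<phi>_def field_simps)
  qed
  have A': "opA D n \<phi> (d, k) = 0" if "d \<noteq> 0" for d k
    using A[of d k] that by (cases "(d, k) \<in> Iq D n") (auto simp: opA_def)
  have A0: "opA D n \<phi> (0, k) = - 1" if "k \<in> Gs D n 0" for k
    using A[of 0 k] that by (simp add: Iq_def)
  let ?z = "opB D n (opF D n (opA D n \<phi>)) + dvec D n"
  have "tail_norm D ?z i < head ?z i" if i: "i \<in> Gs D n 0" for i
  proof -
    have F: "opF D n (opA D n \<phi>) (m, i) = (if m = 0 then - 1 else 0)" if "m \<le> 4 * D" for m
      using that i A' A0 by (auto simp: opF_def IF_def Fblock_def)
    have "head ?z i = 2"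
      using i F[of 0] by (simp add: opB_def dvec_def Iz_def)
    moreover have "?z (Suc m, i) = 0" if "m \<in> {1..4 * D + 1}" for m
      using that i F[of 0] F[of m] by (auto simp: opB_def dvec_def Iz_def)
    then have "tail_norm D ?z i = 0" unfolding tail_norm_def L2_set_def by simp
    ultimately show ?thesis by simp
  qed
  then show thesis using V that by blast
qed

section \<open>Optimality conditions of the subproblems\<close>

text \<open>
  For small \<open>t\<close> the linear term dominates. With \<open>penalty_perturb\<close> this turns minimality into a
  first-order condition.
\<close>

lemma nonneg_of_quadratic:
  fixes p s :: real
  assumes "\<And>t. 0 < t \<Longrightarrow> t \<le> 1 \<Longrightarrow> 0 \<le> t * p + t\<^sup>2 * s"
  shows "0 \<le> p"
proof (rule ccontr)
  assume "\<not> 0 \<le> p"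
  then have p: "p < 0" by simp
  define t where "t = min 1 (- p / (2 * (\<bar>s\<bar> + 1)))"
  have "- p / (2 * (\<bar>s\<bar> + 1)) > 0" using p by (intro divide_pos_pos) auto
  then have t: "0 < t" "t \<le> 1" by (auto simp: t_def)
  have "t * (\<bar>s\<bar> + 1) \<le> - p / (2 * (\<bar>s\<bar> + 1)) * (\<bar>s\<bar> + 1)"
    by (rule mult_right_mono) (auto simp: t_def)
  also have "\<dots> = - p / 2" by (simp add: field_simps)
  finally have "t * \<bar>s\<bar> + t \<le> - p / 2" by (simp add: distrib_left)
  moreover have "t * s \<le> t * \<bar>s\<bar>" using t by (intro mult_left_mono) auto
  ultimately have "p + t * s < 0" using t p by linarith
  then have "t * (p + t * s) < 0" using t by (simp add: mult_pos_neg)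
  then show False using assms[OF t] by (simp add: power2_eq_square algebra_simps)
qed

definition penalty where
  "penalty S \<sigma> x y = inner_on S x y + \<sigma> / 2 * inner_on S x x"

lemma penalty_perturb:
  "penalty S \<sigma> (x + t \<odot> u) y
    = penalty S \<sigma> x y + t * inner_on S u (y + \<sigma> \<odot> x) + t\<^sup>2 * (\<sigma> / 2 * inner_on S u u)"
  by (simp add: penalty_def inner_on_commute[of S x u] power2_eq_square algebra_simps)

lemma aug_lagrangian_eq:
  "aug_lagrangian D n c \<sigma> \<phi> z q \<alpha> \<beta> =
    (if z \<in> coneQ D n then ereal (inner_on (Gc D n) c \<phi> + penalty (Iq D n) \<sigma> (opA D n \<phi> - q) \<alpha>
      + penalty (Iz D n) \<sigma> (z - opB D n (opF D n q) - dvec D n) \<beta>) else \<infinity>)"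
  by (simp add: aug_lagrangian_def convex_indicator_def penalty_def L2_set_power2[symmetric] ac_simps)

text \<open>
  In the linear space of potentials the first variation vanishes in all directions, in particular in
  the direction of the gradient, which lies in that space because \<open>c\<close> does. For \<open>z\<close> the first variation
  towards \<open>0\<close> and \<open>2 z\<close> gives complementarity, and towards the other elements of the cone it
  shows that the predicted multiplier lies in the dual cone.
\<close>

lemma optimality_potential_slack:
  assumes \<sigma>: "\<sigma> > 0" and min: "is_arg_min
           (\<lambda>(\<phi>', z'). aug_lagrangian D n c \<sigma> \<phi>' z' q \<alpha> \<beta>)
           (\<lambda>(\<phi>', z'). \<phi>' \<in> sum_zero D n \<and> z' \<in> rvec (Iz D n)) (\<phi>, z)"
    and c: "c \<in> sum_zero D n" and \<beta>T: "\<beta> \<in> rvec (Iz D n)"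
  shows "\<phi> \<in> sum_zero D n" "z \<in> coneQ D n"
    "adjA D n (\<alpha> + \<sigma> \<odot> (opA D n \<phi> - q)) = - c"
    "\<beta> + \<sigma> \<odot> (z - opB D n (opF D n q) - dvec D n) \<in> coneQ D n"
    "inner_on (Iz D n) z (\<beta> + \<sigma> \<odot> (z - opB D n (opF D n q) - dvec D n)) = 0"
proof -
  let ?P = "Gc D n" and ?S = "Iq D n" and ?T = "Iz D n"
  define rA where "rA = opA D n \<phi> - q"
  define rN where "rN = z - opB D n (opF D n q) - dvec D n"
  define f where "f \<phi>' z' = inner_on ?P c \<phi>' + penalty ?S \<sigma> (opA D n \<phi>' - q) \<alpha>
    + penalty ?T \<sigma> (z' - opB D n (opF D n q) - dvec D n) \<beta>" for \<phi>' z'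
  have \<phi>: "\<phi> \<in> sum_zero D n" and zT: "z \<in> rvec ?T"
    using min by (auto simp: is_arg_min_def)
  have le: "aug_lagrangian D n c \<sigma> \<phi> z q \<alpha> \<beta> \<le> aug_lagrangian D n c \<sigma> \<phi>' z' q \<alpha> \<beta>"
    if "\<phi>' \<in> sum_zero D n" "z' \<in> rvec ?T" for \<phi>' z'
    using min that by (auto simp: is_arg_min_def not_less)
  have zQ: "z \<in> coneQ D n"
  proof (rule ccontr)
    assume "z \<notin> coneQ D n"
    then show False
      using le[OF \<phi>, of 0] coneQ_0[of D n] by (auto simp: aug_lagrangian_eq rvec_closed)
  qed
  have f_le: "f \<phi> z \<le> f \<phi>' z'" if "\<phi>' \<in> sum_zero D n" "z' \<in> coneQ D n" for \<phi>' z'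
    using le[OF that(1), of z'] that zQ by (auto simp: aug_lagrangian_eq f_def coneQ_iff)
  let ?g = "c + adjA D n (\<alpha> + \<sigma> \<odot> rA)"
  have gV: "?g \<in> sum_zero D n"
    using c adjA_in_sum_zero by (rule sum_zero_closed_ops)
  have \<phi>_dir: "0 \<le> inner_on ?P ?g \<psi>" if \<psi>: "\<psi> \<in> sum_zero D n" for \<psi>
  proof (rule nonneg_of_quadratic)
    fix t :: real assume "0 < t" "t \<le> 1"
    have "f \<phi> z \<le> f (\<phi> + t \<odot> \<psi>) z" by (intro f_le sum_zero_closed_ops \<phi> \<psi> zQ)
    moreover have "opA D n (\<phi> + t \<odot> \<psi>) - q = rA + t \<odot> opA D n \<psi>"
      by (simp add: rA_def lin_add[OF lin_opA] lin_scl[OF lin_opA])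
    ultimately have "inner_on ?P c \<phi> + penalty ?S \<sigma> rA \<alpha>
        \<le> inner_on ?P c (\<phi> + t \<odot> \<psi>) + penalty ?S \<sigma> (rA + t \<odot> opA D n \<psi>) \<alpha>"
      by (simp only: f_def rA_def[symmetric] add_le_cancel_right)
    moreover have adj: "inner_on ?S (opA D n \<psi>) (\<alpha> + \<sigma> \<odot> rA) = inner_on ?P (adjA D n (\<alpha> + \<sigma> \<odot> rA)) \<psi>"
      using \<psi> by (subst inner_on_commute[of ?P]) (rule inner_adjA, simp add: sum_zero_def)
    ultimately show "0 \<le> t * inner_on ?P ?g \<psi> + t\<^sup>2 * (\<sigma> / 2 * inner_on ?S (opA D n \<psi>) (opA D n \<psi>))"
      unfolding penalty_perturb adj inner_simps_on(1)[of ?P c] inner_simps_on(6)[of ?P c] inner_simps_on(9)[of ?P c]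
        distrib_left by linarith
  qed
  have "inner_on ?P ?g ?g = 0"
    using \<phi>_dir[OF sum_zero_closed_ops(2)[OF gV, of "- 1"]] inner_on_nonneg[of ?P ?g] by simp
  then have "?g = 0" using gV by (intro inner_on_self_eq_0[of ?P]) (auto simp: sum_zero_def)
  then show "adjA D n (\<alpha> + \<sigma> \<odot> (opA D n \<phi> - q)) = - c"
    unfolding rA_def by (simp add: eq_neg_iff_add_eq_0 add.commute)
  let ?b = "\<beta> + \<sigma> \<odot> rN"
  have z_dir: "0 \<le> inner_on ?T (x - z) ?b" if x: "x \<in> coneQ D n" for x
  proof (rule nonneg_of_quadratic)
    fix t :: real assume t: "0 < t" "t \<le> 1"
    have "z + t \<odot> (x - z) = (1 - t) \<odot> z + t \<odot> x" by (simp add: fun_eq_iff algebra_simps)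
    also have "\<dots> \<in> coneQ D n" using t x zQ by (intro coneQ_add coneQ_scl) auto
    finally have "f \<phi> z \<le> f \<phi> (z + t \<odot> (x - z))" by (intro f_le \<phi>)
    moreover have "z + t \<odot> (x - z) - opB D n (opF D n q) - dvec D n = rN + t \<odot> (x - z)"
      by (simp add: rN_def)
    ultimately have "0 \<le> penalty ?T \<sigma> (rN + t \<odot> (x - z)) \<beta> - penalty ?T \<sigma> rN \<beta>"
      by (simp add: f_def rN_def[symmetric])
    then show "0 \<le> t * inner_on ?T (x - z) ?b + t\<^sup>2 * (\<sigma> / 2 * inner_on ?T (x - z) (x - z))"
      unfolding penalty_perturb by linarith
  qed
  have "0 \<le> inner_on ?T (2 \<odot> z - z) ?b" "0 \<le> inner_on ?T (0 - z) ?b"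
    by (rule z_dir, rule coneQ_scl[OF _ zQ], simp) (rule z_dir[OF coneQ_0])
  then have zb: "inner_on ?T z ?b = 0" by simp
  then show "inner_on ?T z (\<beta> + \<sigma> \<odot> (z - opB D n (opF D n q) - dvec D n)) = 0" by (simp only: rN_def)
  have bT: "?b \<in> rvec ?T"
    using \<beta>T zT ops_in_rvec dvec_in_rvec unfolding rN_def by (intro rvec_closed)
  have "?b \<in> coneQ D n"
  proof (rule coneQ_self_dual[OF bT])
    fix x assume "x \<in> coneQ D n"
    from z_dir[OF this] show "0 \<le> inner_on ?T x ?b" using zb by (simp only: inner_simps_on(2))
  qed
  then show "\<beta> + \<sigma> \<odot> (z - opB D n (opF D n q) - dvec D n) \<in> coneQ D n" by (simp only: rN_def)
  show "\<phi> \<in> sum_zero D n" "z \<in> coneQ D n" by (rule \<phi>, rule zQ)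
qed

lemma optimality_flux:
  assumes z: "z \<in> coneQ D n" and \<alpha>S: "\<alpha> \<in> rvec (Iq D n)"
    and min: "is_arg_min (\<lambda>q'. aug_lagrangian D n c \<sigma> \<phi> z q' \<alpha> \<beta>) (\<lambda>q'. q' \<in> rvec (Iq D n)) q"
  shows "q \<in> rvec (Iq D n)"
    "(\<alpha> + \<sigma> \<odot> (opA D n \<phi> - q)) + adjF D n (adjB D n (\<beta> + \<sigma> \<odot> (z - opB D n (opF D n q) - dvec D n))) = 0"
proof -
  let ?S = "Iq D n" and ?T = "Iz D n"
  define rA where "rA = opA D n \<phi> - q"
  define rN where "rN = z - opB D n (opF D n q) - dvec D n"
  define f where "f q' = penalty ?S \<sigma> (opA D n \<phi> - q') \<alpha>
    + penalty ?T \<sigma> (z - opB D n (opF D n q') - dvec D n) \<beta>" for q'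
  show qS: "q \<in> rvec ?S" using min by (auto simp: is_arg_min_def)
  have f_le: "f q \<le> f q'" if "q' \<in> rvec ?S" for q'
    using min that z by (auto simp: is_arg_min_def not_less aug_lagrangian_eq f_def)
  let ?g = "(\<alpha> + \<sigma> \<odot> rA) + adjF D n (adjB D n (\<beta> + \<sigma> \<odot> rN))"
  have gS: "?g \<in> rvec ?S"
    using \<alpha>S qS ops_in_rvec unfolding rA_def by (intro rvec_closed)
  have dir: "0 \<le> inner_on ?S \<psi> ?g" if \<psi>: "\<psi> \<in> rvec ?S" for \<psi>
  proof (rule nonneg_of_quadratic)
    fix t :: real assume "0 < t" "t \<le> 1"
    let ?N = "opB D n (opF D n \<psi>)"
    have "f q \<le> f (q - t \<odot> \<psi>)" by (intro f_le rvec_closed qS \<psi>)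
    moreover have "opA D n \<phi> - (q - t \<odot> \<psi>) = rA + t \<odot> \<psi>" by (simp add: rA_def)
    moreover have "z - opB D n (opF D n (q - t \<odot> \<psi>)) - dvec D n = rN + t \<odot> ?N"
      by (simp add: rN_def lin_diff[OF lin_opF] lin_scl[OF lin_opF] lin_diff[OF lin_opB] lin_scl[OF lin_opB])
    ultimately have "penalty ?S \<sigma> rA \<alpha> + penalty ?T \<sigma> rN \<beta>
        \<le> penalty ?S \<sigma> (rA + t \<odot> \<psi>) \<alpha> + penalty ?T \<sigma> (rN + t \<odot> ?N) \<beta>"
      by (simp only: f_def rA_def[symmetric] rN_def[symmetric])
    moreover have adj: "inner_on ?T ?N (\<beta> + \<sigma> \<odot> rN) = inner_on ?S \<psi> (adjF D n (adjB D n (\<beta> + \<sigma> \<odot> rN)))"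
      by (rule inner_adjFB[OF \<psi>])
    ultimately show "0 \<le> t * inner_on ?S \<psi> ?g
        + t\<^sup>2 * (\<sigma> / 2 * inner_on ?S \<psi> \<psi> + \<sigma> / 2 * inner_on ?T ?N ?N)"
      unfolding penalty_perturb adj inner_simps_on(6)[of ?S \<psi> "\<alpha> + \<sigma> \<odot> rA"]
        distrib_left by linarith
  qed
  have "0 \<le> inner_on ?S (- ?g) ?g" by (intro dir rvec_closed(4) gS)
  then have "inner_on ?S ?g ?g = 0" using inner_on_nonneg[of ?S ?g] by (simp only: inner_simps_on(3))
  then have "?g = 0" by (intro inner_on_self_eq_0[OF _ gS]) simp
  then show "(\<alpha> + \<sigma> \<odot> (opA D n \<phi> - q)) + adjF D n (adjB D n (\<beta> + \<sigma> \<odot> (z - opB D n (opF D n q) - dvec D n))) = 0"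
    by (simp only: rA_def rN_def)
qed


theorem theorem4p1:
  fixes D :: nat and n :: "nat \<Rightarrow> nat"
    and \<rho>0 \<rho>1 :: "(nat \<Rightarrow> real) measure"
    and c :: "idx \<Rightarrow> real"
    and \<sigma> \<tau> :: real
    and \<phi> :: "nat \<Rightarrow> idx \<Rightarrow> real"
    and z q \<alpha> \<beta> :: "nat \<Rightarrow> nat \<times> idx \<Rightarrow> real"
  assumes "D \<ge> 1" and "\<forall>d\<in>{0..D}. n d \<ge> 1"
    and "borel_prob_on (cube D) \<rho>0" and "borel_prob_on (cube D) \<rho>1"
    and "(\<Sum>i\<in>GcX D n. measure \<rho>0 (cell D n i)) = 1"
    and "(\<Sum>i\<in>GcX D n. measure \<rho>1 (cell D n i)) = 1"
    and "c = cvec D n \<rho>0 \<rho>1"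
    and "\<sigma> > 0" and "0 < \<tau>" and "\<tau> < 2"
    and "q 0 \<in> rvec (Iq D n)" and "\<alpha> 0 \<in> rvec (Iq D n)" and "\<beta> 0 \<in> coneQ D n"
    and "\<And>k. is_arg_min
           (\<lambda>(\<phi>', z'). aug_lagrangian D n c \<sigma> \<phi>' z' (q k) (\<alpha> k) (\<beta> k))
           (\<lambda>(\<phi>', z'). \<phi>' \<in> rge_adjA D n \<and> z' \<in> rvec (Iz D n))
           (\<phi> (Suc k), z (Suc k))"
    and "\<And>k. is_arg_min
           (\<lambda>q'. aug_lagrangian D n c \<sigma> (\<phi> (Suc k)) (z (Suc k)) q' (\<alpha> k) (\<beta> k))
           (\<lambda>q'. q' \<in> rvec (Iq D n))
           (q (Suc k))"
    and "\<And>k. \<alpha> (Suc k) =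
           (\<lambda>p. \<alpha> k p + \<tau> * \<sigma> * (opA D n (\<phi> (Suc k)) - q (Suc k)) p)"
    and "\<And>k. \<beta> (Suc k) =
           (\<lambda>p. \<beta> k p + \<tau> * \<sigma> * (z (Suc k) - opB D n (opF D n (q (Suc k))) - dvec D n) p)"
  shows "\<exists>\<phi>' z' q' \<alpha>' \<beta>'.
           converges_on (Gc D n) \<phi> \<phi>' \<and> converges_on (Iz D n) z z' \<and>
           converges_on (Iq D n) q q' \<and> converges_on (Iq D n) \<alpha> \<alpha>' \<and>
           converges_on (Iz D n) \<beta> \<beta>' \<and>
           KKT D n c \<phi>' z' q' \<alpha>' \<beta>' \<and> KKT_free D n c \<phi>' z' q' \<alpha>' \<beta>'"
proof -
  let ?N = "\<lambda>q. opB D n (opF D n q)" and ?Nt = "\<lambda>y. adjF D n (adjB D n y)"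
  have n0: "n 0 \<ge> 1" using assms(2) by (auto dest: bspec[of _ _ 0])
  have cG: "c \<in> rvec (Gc D n)" unfolding assms(7) by (simp add: rvec_def cvec_def)
  have slices: "(\<Sum>i | i \<in> Gc D n \<and> i 0 = real s. c i) = (if s = 0 then 1 else 0) - (if s = n 0 then 1 else 0)"
    if "s \<le> n 0" for s
    unfolding assms(7) by (rule cvec_slices[where n = n and D = D, OF n0 that assms(5,6)])
  obtain \<alpha>s \<kappa> where \<alpha>s: "\<alpha>s \<in> rvec (Iq D n)" "adjA D n \<alpha>s = - c" "\<kappa> > 0"
      "\<forall>k\<in>Gs D n 0. \<alpha>s (0, k) = \<kappa>"
    by (rule positive_density_flux[where n = n and D = D and c = c, OF n0 cG slices])
  obtain \<beta>s where \<beta>s: "\<beta>s \<in> rvec (Iz D n)" "\<alpha>s + ?Nt \<beta>s = 0"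
      "\<forall>i\<in>Gs D n 0. tail_norm D \<beta>s i < head \<beta>s i"
    by (rule strictly_feasible_multiplier[where n = n and D = D, OF n0 \<alpha>s(1,3,4)])
  obtain \<phi>s where \<phi>s: "\<phi>s \<in> sum_zero D n"
      "\<forall>i\<in>Gs D n 0. tail_norm D (?N (opA D n \<phi>s) + dvec D n) i < head (?N (opA D n \<phi>s) + dvec D n) i"
    by (rule strictly_feasible_potential[OF assms(2)])
  have cV: "c \<in> sum_zero D n"
    using sum_zero_closed_ops(2)[OF adjA_in_sum_zero[of D n \<alpha>s], of "- 1"]
    by (simp add: \<alpha>s(2) uminus_eq_scl[symmetric])
  interpret conic_problem "Gc D n" "Iq D n" "Iz D n" "opA D n" "adjA D n" ?N ?Nt c "dvec D n"
      "sum_zero D n" "coneQ D n"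
  proof
    show "\<exists>y. \<forall>q\<in>rvec (Iq D n). q j = inner_on (Iz D n) (?N q) y" if jI: "j \<in> Iq D n" for j
    proof -
      obtain d i where j: "j = (d, i)" by (cases j)
      obtain m k a where mk: "(m, k) \<in> Iz D n" "\<forall>q. q (d, i) = a * ?N q (m, k)"
        by (rule recover_flux[where n = n and D = D, OF n0 jI[unfolded j]]) blast
      show ?thesis
        unfolding j using mk by (intro exI[of _ "a \<odot> unit_vec (m, k)"]) (simp add: inner_on_unit_vec)
    qed
  qed (auto simp: ops_in_rvec dvec_in_rvec cG inner_adjA inner_adjFB lin_opA lin_adj lin_comp lin_opB lin_opF
      sum_zero_closed_ops recover_potential coneQ_add coneQ_scl coneQ_pairing
      intro: sum_zero_closed coneQ_closed, auto simp: sum_zero_def coneQ_def)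
  note min = assms(14)[unfolded rge_adjA_eq_sum_zero]
  have upd: "\<alpha> (Suc k) = \<alpha> k + (\<tau> * \<sigma>) \<odot> (opA D n (\<phi> (Suc k)) - q (Suc k))"
    "\<beta> (Suc k) = \<beta> k + (\<tau> * \<sigma>) \<odot> (z (Suc k) - ?N (q (Suc k)) - dvec D n)" for k
    by (auto simp: assms(16,17) fun_eq_iff)
  have q_in: "q k \<in> rvec (Iq D n)" for k
    using assms(11) assms(15)[of "k - 1"] by (cases k) (auto simp: is_arg_min_def)
  have z_in: "z (Suc k) \<in> rvec (Iz D n)" for k
    using assms(14)[of k] by (auto simp: is_arg_min_def)
  have \<alpha>_in: "\<alpha> k \<in> rvec (Iq D n)" for k
  proof (induction k)
    case (Suc k)
    have "\<alpha> k \<in> rvec (Iq D n)" by (rule Suc.IH)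
    then show "\<alpha> (Suc k) \<in> rvec (Iq D n)" unfolding upd by (intro rvec_closed ops_in_rvec q_in)
  qed (rule assms(12))
  have \<beta>_in: "\<beta> k \<in> rvec (Iz D n)" for k
  proof (induction k)
    case 0
    show ?case using assms(13) by (simp add: coneQ_def)
  next
    case (Suc k)
    have "\<beta> k \<in> rvec (Iz D n)" by (rule Suc.IH)
    then show "\<beta> (Suc k) \<in> rvec (Iz D n)"
      unfolding upd by (intro rvec_closed ops_in_rvec z_in dvec_in_rvec)
  qed
  note opt1 = optimality_potential_slack[OF assms(8) min cV \<beta>_in]
  note opt2 = optimality_flux[OF opt1(2) \<alpha>_in assms(15)]
  interpret admm_iteration "Gc D n" "Iq D n" "Iz D n" "opA D n" "adjA D n" ?N ?Nt c "dvec D n"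
      "sum_zero D n" "coneQ D n" \<sigma> \<tau> \<phi> z \<beta> q \<alpha>
    by unfold_locales (use assms(8-10) q_in \<alpha>_in \<beta>_in opt1 opt2(2) upd in auto)
  have Q: "y \<in> coneQ D n" if "y \<in> rvec (Iz D n)" "\<forall>i\<in>Gs D n 0. tail_norm D y i < head y i" for y
    using that by (auto simp: coneQ_iff intro: less_imp_le)
  have int: "interior_pt y" if "\<forall>i\<in>Gs D n 0. tail_norm D y i < head y i" for y
    unfolding interior_pt_def using that by (intro coneQ_interior) blast
  have feas: "feasible \<phi>s (?N (opA D n \<phi>s) + dvec D n) (opA D n \<phi>s) \<alpha>s \<beta>s"
    unfolding feasible_def using \<phi>s \<alpha>s \<beta>s
    by (auto intro!: Q ops_in_rvec rvec_closed dvec_in_rvec)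
  obtain \<phi>' z' q' \<alpha>' \<beta>' where *: "feasible \<phi>' z' q' \<alpha>' \<beta>'" "inner_on (Iz D n) z' \<beta>' = 0"
    "converges_on (Gc D n) \<phi> \<phi>'" "converges_on (Iz D n) z z'" "converges_on (Iq D n) q q'"
    "converges_on (Iq D n) \<alpha> \<alpha>'" "converges_on (Iz D n) \<beta> \<beta>'"
    by (rule converges_to_saddle_point[OF feas int[OF \<phi>s(2)] int[OF \<beta>s(3)]])
  have "KKT_free D n c \<phi>' z' q' \<alpha>' \<beta>'" "\<phi>' \<in> rge_adjA D n"
    using *(1,2) unfolding feasible_def KKT_free_def rge_adjA_eq_sum_zero
    by (auto simp: sum_zero_def coneQ_def)
  with * show ?thesis unfolding KKT_def by blast
qed

end
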